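(* Let $\kappa$ be a completely characterizable cardinal such that $\aleph_1$ is the least cardinal $\mu$ with $\kappa<\kappa^{\mu}$. Then $\kappa^{\aleph_1}$ is completely characterizable.
   Context: All languages are countable. An infinite cardinal $\kappa$ is completely characterizable if there is a countable structure whose Scott sentence has a model of cardinality $\kappa$ but no model of cardinality $\kappa^+$. *)

theory Defs
  imports Main
begin

unbundle cardinal_syntax

text \<open>
  A countable first-order language: symbols are natural numbers, and the two partial maps give
  the arities of the function symbols (constants have arity 0) and relation symbols that belong
  to the language. Every countable language is of this form up to renaming of symbols.
\<close>

record language =
  fun_arity :: "nat \<Rightarrow> nat option"
  rel_arity :: "nat \<Rightarrow> nat option"

datatype trm = Var nat | App nat "trm list"

text \<open>
  Formulas of \<open>L\<^sub>\<omega>\<^sub>1\<^sub>,\<^sub>\<omega>\<close>. Countable conjunctions are indexed by all natural numbers; a finite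
  nonempty conjunction is obtained by repeating a conjunct, an empty one as a valid sentence such
  as \<open>\<exists>x. x = x\<close>. Universal quantifiers and countable disjunctions are obtained through negation.
\<close>

datatype form =
    Eq trm trm
  | Rel nat "trm list"
  | Neg form
  | Conj "nat \<Rightarrow> form"
  | Ex nat form

primrec term_of_language :: "language \<Rightarrow> trm \<Rightarrow> bool" where
  "term_of_language L (Var x) \<longleftrightarrow> True"
| "term_of_language L (App f ts) \<longleftrightarrow>
     fun_arity L f = Some (length ts) \<and> list_all (term_of_language L) ts"

primrec form_of_language :: "language \<Rightarrow> form \<Rightarrow> bool" where
  "form_of_language L (Eq s t) \<longleftrightarrow> term_of_language L s \<and> term_of_language L t"
| "form_of_language L (Rel R ts) \<longleftrightarrow>
     rel_arity L R = Some (length ts) \<and> list_all (term_of_language L) ts"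
| "form_of_language L (Neg \<phi>) \<longleftrightarrow> form_of_language L \<phi>"
| "form_of_language L (Conj \<Phi>) \<longleftrightarrow> (\<forall>i. form_of_language L (\<Phi> i))"
| "form_of_language L (Ex x \<phi>) \<longleftrightarrow> form_of_language L \<phi>"

primrec term_vars :: "trm \<Rightarrow> nat set" where
  "term_vars (Var x) = {x}"
| "term_vars (App f ts) = \<Union> (set (map term_vars ts))"

primrec free_vars :: "form \<Rightarrow> nat set" where
  "free_vars (Eq s t) = term_vars s \<union> term_vars t"
| "free_vars (Rel R ts) = \<Union> (set (map term_vars ts))"
| "free_vars (Neg \<phi>) = free_vars \<phi>"
| "free_vars (Conj \<Phi>) = (\<Union>i. free_vars (\<Phi> i))"
| "free_vars (Ex x \<phi>) = free_vars \<phi> - {x}"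

text \<open>
  A formula need not have finitely many free variables, but every subformula of a sentence does,
  since it lies in the scope of only finitely many quantifiers.
\<close>

definition is_sentence :: "language \<Rightarrow> form \<Rightarrow> bool" where
  "is_sentence L \<phi> \<longleftrightarrow> form_of_language L \<phi> \<and> free_vars \<phi> = {}"

record 'a struct =
  universe :: "'a set"
  fun_interp :: "nat \<Rightarrow> 'a list \<Rightarrow> 'a"
  rel_interp :: "nat \<Rightarrow> 'a list \<Rightarrow> bool"

text \<open>
  Interpretations of symbols outside the language, at lists of the wrong length or at lists with
  entries outside the domain are irrelevant and left unconstrained.
\<close>

definition is_structure :: "language \<Rightarrow> 'a struct \<Rightarrow> bool" where
  "is_structure L M \<longleftrightarrow> universe M \<noteq> {} \<and>
     (\<forall>f xs. fun_arity L f = Some (length xs) \<longrightarrow> set xs \<subseteq> universe M \<longrightarrow> fun_interp M f xs \<in> universe M)"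

primrec eval_term :: "'a struct \<Rightarrow> (nat \<Rightarrow> 'a) \<Rightarrow> trm \<Rightarrow> 'a" where
  "eval_term M v (Var x) = v x"
| "eval_term M v (App f ts) = fun_interp M f (map (eval_term M v) ts)"

primrec sat :: "'a struct \<Rightarrow> form \<Rightarrow> (nat \<Rightarrow> 'a) \<Rightarrow> bool" where
  "sat M (Eq s t) v \<longleftrightarrow> eval_term M v s = eval_term M v t"
| "sat M (Rel R ts) v \<longleftrightarrow> rel_interp M R (map (eval_term M v) ts)"
| "sat M (Neg \<phi>) v \<longleftrightarrow> \<not> sat M \<phi> v"
| "sat M (Conj \<Phi>) v \<longleftrightarrow> (\<forall>i. sat M (\<Phi> i) v)"
| "sat M (Ex x \<phi>) v \<longleftrightarrow> (\<exists>a\<in>universe M. sat M \<phi> (v(x := a)))"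

definition models :: "'a struct \<Rightarrow> form \<Rightarrow> bool" where
  "models M \<phi> \<longleftrightarrow> (\<forall>v. range v \<subseteq> universe M \<longrightarrow> sat M \<phi> v)"

definition isomorphic :: "language \<Rightarrow> 'a struct \<Rightarrow> 'b struct \<Rightarrow> bool" where
  "isomorphic L M N \<longleftrightarrow> (\<exists>h. bij_betw h (universe M) (universe N) \<and>
     (\<forall>f xs. fun_arity L f = Some (length xs) \<longrightarrow> set xs \<subseteq> universe M \<longrightarrow>
        h (fun_interp M f xs) = fun_interp N f (map h xs)) \<and>
     (\<forall>R xs. rel_arity L R = Some (length xs) \<longrightarrow> set xs \<subseteq> universe M \<longrightarrow>
        (rel_interp M R xs \<longleftrightarrow> rel_interp N R (map h xs))))"

text \<open>
  A Scott sentence of a countable structure \<open>M\<close> is an \<open>L\<^sub>\<omega>\<^sub>1\<^sub>,\<^sub>\<omega>\<close> sentence whose countable models are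
  exactly the structures isomorphic to \<open>M\<close>. It exists by Scott's theorem and is unique up to logical
  equivalence (by the downward Loewenheim-Skolem theorem), so one may speak of the Scott sentence.
  Countable (that is, finite or countably infinite) structures are represented, up to isomorphism,
  by structures whose domain is a set of natural numbers.
\<close>

definition is_scott_sentence :: "language \<Rightarrow> nat struct \<Rightarrow> form \<Rightarrow> bool" where
  "is_scott_sentence L M \<phi> \<longleftrightarrow> is_sentence L \<phi> \<and>
     (\<forall>N :: nat struct. is_structure L N \<longrightarrow> (models N \<phi> \<longleftrightarrow> isomorphic L M N))"

text \<open>
  Cardinals are cardinal orders. For a cardinal order \<open>\<kappa>\<close> on \<open>'a\<close>, every structure of cardinality
  \<open>\<kappa>\<close> (on whatever type) has an isomorphic copy whose domain is a set over \<open>'a\<close>, so ranging over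
  structures on \<open>'a\<close> loses nothing.
\<close>

definition has_model_of_card :: "language \<Rightarrow> form \<Rightarrow> 'a rel \<Rightarrow> bool" where
  "has_model_of_card L \<phi> \<kappa> \<longleftrightarrow>
     (\<exists>N :: 'a struct. is_structure L N \<and> |universe N| =o \<kappa> \<and> models N \<phi>)"

definition completely_characterizable :: "'a rel \<Rightarrow> bool" where
  "completely_characterizable \<kappa> \<longleftrightarrow> Cinfinite \<kappa> \<and>
     (\<exists>L (M :: nat struct) \<phi>. is_structure L M \<and> is_scott_sentence L M \<phi> \<and>
        has_model_of_card L \<phi> \<kappa> \<and> \<not> has_model_of_card L \<phi> (cardSuc \<kappa>))"

abbreviation aleph_1 :: "nat set rel" where
  "aleph_1 \<equiv> cardSuc natLeq"

text \<open>
  \<open>\<mu>\<close> is the least cardinal with \<open>\<kappa> < \<kappa>\<^sup>\<mu>\<close>. Every cardinal smaller than \<open>\<mu>\<close> is the cardinality of a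
  set over the type of \<open>\<mu>\<close>, so minimality need only be tested against cardinal orders on that type.
\<close>

definition least_exponent :: "'a rel \<Rightarrow> 'b rel \<Rightarrow> bool" where
  "least_exponent \<kappa> \<mu> \<longleftrightarrow> Card_order \<mu> \<and> \<kappa> <o \<kappa> ^c \<mu> \<and>
     (\<forall>\<nu> :: 'b rel. Card_order \<nu> \<longrightarrow> \<kappa> <o \<kappa> ^c \<nu> \<longrightarrow> \<mu> \<le>o \<nu>)"

end

theory Submission
  imports Defs "HOL-Library.Countable_Set" "HOL-Library.Product_Lexorder" "HOL.Rat"
begin

text \<open>
  Let \<open>K\<close> be the model of cardinality \<open>\<kappa>\<close>. Since the Scott sentence of a countable structure
  decides the types of tuples, \<open>K\<close> carries a typing of its tuples by natural numbers with the
  back-and-forth property, and every set equivalent to it in this sense has at most \<open>\<kappa>\<close> elements.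
  Conversely, every back-and-forth typing by natural numbers has a Scott sentence, whose models are the
  equivalent typed sets; so it suffices to find a typed set of cardinality \<open>\<kappa> ^c aleph_1\<close> such that all
  equivalent ones are at most as large.

  The levels are \<open>\<omega>\<^sub>1 \<times> \<rat>\<close>, ordered lexicographically. They
  are the image of a homogeneous set \<open>I\<close> with a ternary relation \<open>T\<close> such that
  \<open>T a b c\<close> has finitely many solutions \<open>c\<close> and every triple is related by \<open>T\<close> in some order; by
  a theorem of Kuratowski such a set has at most \<open>\<aleph>\<^sub>1\<close> elements. It is built in \<open>\<omega>\<^sub>1\<close> steps by
  amalgamation. As \<open>\<kappa> ^c natLeq\<close> equals \<open>\<kappa>\<close>, some 1-type \<open>D\<close> of \<open>K\<close> has \<open>\<kappa>\<close> elements. The elements of the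
  structure are triples of a branch (a function from levels to \<open>D\<close> with well-ordered support),
  an index in \<open>I\<close> and a value in \<open>K\<close>: over every node of the tree sits a copy of \<open>K\<close>, and the branch
  passes through an element of this copy. There are \<open>\<kappa> ^c aleph_1\<close> branches, and in an equivalent typed set
  a branch is determined by the at most \<open>\<aleph>\<^sub>1\<close> choices it makes among at most \<open>\<kappa>\<close> values.
\<close>

section \<open>Closure under countably many finitary operations\<close>

text \<open>The obstacle is to keep the number of levels at \<open>\<aleph>\<^sub>1\<close> in every
  model, since back-and-forth cannot force an order to be well-ordered. Hence the levels are dense
  and the count comes from \<open>T\<close>: both of its properties concern finite tuples and
  survive every transfer of types. The indices are kept apart from the levels, possibly several to a
  level, so that new indices can be given arbitrary levels and the order of levels puts no
  constraint on \<open>T\<close>.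

  What replaces a well-order of the levels is the well-ordered support of each branch. It gives two
  distinct branches a first level of difference, which is all that a finite partial automorphism has
  to know about the pair. The default value \<open>d0\<close> above the prescribed part of a branch
  is harmless because all points of \<open>D\<close> have the same type. The copy
  \<open>omega1 \<times> {0}\<close> of \<open>omega1\<close> inside the levels supplies the
  \<open>\<kappa> ^c aleph_1\<close> branches.

  In another model the copies of \<open>K\<close> over different nodes are not identified, so value
  codes are compared over one node only. That suffices: two branches are told apart by their points
  over the node at which they split.\<close>

definition closed_under :: "('a list \<Rightarrow> 'a) set \<Rightarrow> 'a set \<Rightarrow> bool" where
  "closed_under W X \<longleftrightarrow> (\<forall>w\<in>W. \<forall>xs. set xs \<subseteq> X \<longrightarrow> w xs \<in> X)"

lemma closed_under_Un: "closed_under (V \<union> W) X \<longleftrightarrow> closed_under V X \<and> closed_under W X"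
  by (auto simp: closed_under_def)

lemma closed_under_UN: "closed_under (\<Union>i\<in>I. W i) X \<longleftrightarrow> (\<forall>i\<in>I. closed_under (W i) X)"
  by (auto simp: closed_under_def)

lemma card_lists_ordLeq:
  fixes B :: "'b set"
  assumes "infinite B" "|X| \<le>o |B|"
  shows "|lists X| \<le>o |B|"
proof -
  have "|{xs \<in> lists X. length xs = n}| \<le>o |B|" for n
  proof (induction n)
    case 0
    have "{xs \<in> lists X. length xs = 0} = {[]}" by auto
    moreover have "B \<noteq> {}" using assms(1) by auto
    ultimately show ?case by (simp add: card_of_singl_ordLeq)
  next
    case (Suc n)
    have "{xs \<in> lists X. length xs = Suc n} \<subseteq> (\<lambda>(x, xs). x # xs) ` (X \<times> {xs \<in> lists X. length xs = n})"
      by (auto simp: length_Suc_conv image_iff)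
    then have "|{xs \<in> lists X. length xs = Suc n}| \<le>o |X \<times> {xs \<in> lists X. length xs = n}|"
      by (rule surj_imp_ordLeq)
    also have "|X \<times> {xs \<in> lists X. length xs = n}| \<le>o |B|"
      by (rule card_of_Times_ordLeq_infinite_Field)
        (use assms Suc in \<open>simp_all add: Field_card_of card_of_card_order_on\<close>)
    finally show ?case .
  qed
  then have "|\<Union>n. {xs \<in> lists X. length xs = n}| \<le>o |B|"
    using assms(1) infinite_iff_card_of_nat
    by (intro card_of_UNION_ordLeq_infinite) auto
  moreover have "(\<Union>n. {xs \<in> lists X. length xs = n}) = lists X" by auto
  ultimately show ?thesis by metis
qed

primrec closure_stage :: "('a list \<Rightarrow> 'a) set \<Rightarrow> 'a set \<Rightarrow> nat \<Rightarrow> 'a set" where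
  "closure_stage W X 0 = X"
| "closure_stage W X (Suc n) = closure_stage W X n \<union> (\<Union>w\<in>W. w ` {xs. set xs \<subseteq> closure_stage W X n})"

lemma finite_subset_incseq:
  assumes "\<And>n. S n \<subseteq> S (Suc n)" "finite A" "A \<subseteq> (\<Union>n::nat. S n)"
  shows "\<exists>n. A \<subseteq> S n"
  using assms(2,3)
proof (induction A)
  case (insert x A)
  from insert obtain n m where "A \<subseteq> S n" "x \<in> S m" by auto
  moreover have "S n \<subseteq> S (max n m)" "S m \<subseteq> S (max n m)"
    using lift_Suc_mono_le[of S] assms(1) by (simp_all add: max_def)
  ultimately have "insert x A \<subseteq> S (max n m)" by auto
  then show ?case by blast
qed auto

text \<open>For infinite \<open>B\<close>, the finite lists over a set of size at most
  \<open>|B|\<close> are again at most \<open>|B|\<close> many, and there are only countably many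
  operations; so neither a single stage nor the union of the \<omega> stages outgrows
  \<open>B\<close>.\<close>

lemma closure_exists:
  fixes B :: "'b set"
  assumes "countable W" "X \<subseteq> U" "closed_under W U" "infinite B" "|X| \<le>o |B|"
  obtains Y where "X \<subseteq> Y" "Y \<subseteq> U" "closed_under W Y" "|Y| \<le>o |B|"
proof
  let ?S = "closure_stage W X"
  have nB: "|UNIV :: nat set| \<le>o |B|"
    using assms(4) infinite_iff_card_of_nat by blast
  have "|W| \<le>o |UNIV :: nat set|"
    using assms(1) unfolding countable_def card_of_ordLeq[symmetric] by auto
  then have WB: "|W| \<le>o |B|" using nB ordLeq_transitive by blast
  show "X \<subseteq> (\<Union>n. ?S n)" using UN_upper[of 0 UNIV ?S] by simp
  have "?S n \<subseteq> U" for n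
  proof (induction n)
    case (Suc n)
    then show ?case using assms(3) by (auto simp: closed_under_def)
  qed (use assms in simp)
  then show "(\<Union>n. ?S n) \<subseteq> U" by blast
  show "closed_under W (\<Union>n. ?S n)" unfolding closed_under_def
  proof (intro ballI allI impI)
    fix w xs assume "w \<in> W" "set xs \<subseteq> (\<Union>n. ?S n)"
    moreover from this obtain n where "set xs \<subseteq> ?S n"
      using finite_subset_incseq[of ?S "set xs"] by auto
    ultimately have "w xs \<in> ?S (Suc n)" by auto
    then show "w xs \<in> (\<Union>n. ?S n)" by blast
  qed
  have "|?S n| \<le>o |B|" for n
  proof (induction n)
    case (Suc n)
    then have "|{xs. set xs \<subseteq> ?S n}| \<le>o |B|"
      using card_lists_ordLeq[OF assms(4)] by (simp only: lists_eq_set)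
    then have "|w ` {xs. set xs \<subseteq> ?S n}| \<le>o |B|" for w :: "'a list \<Rightarrow> 'a"
      by (rule ordLeq_transitive[OF card_of_image])
    then have "|\<Union>w\<in>W. w ` {xs. set xs \<subseteq> ?S n}| \<le>o |B|"
      by (intro card_of_UNION_ordLeq_infinite[OF assms(4) WB]) simp
    with Suc show ?case using assms(4)
      by (simp add: card_of_Un_ordLeq_infinite_Field Field_card_of card_of_card_order_on)
  qed (use assms in simp)
  then show "|\<Union>n. ?S n| \<le>o |B|"
    by (intro card_of_UNION_ordLeq_infinite[OF assms(4) nB]) simp
qed

lemma countable_iff_ordLeq_nat: "countable X \<longleftrightarrow> |X| \<le>o |UNIV :: nat set|"
  unfolding countable_def card_of_ordLeq[symmetric] by auto

lemma countable_closure_exists: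
  assumes "countable W" "X \<subseteq> U" "closed_under W U" "countable X"
  obtains Y where "X \<subseteq> Y" "Y \<subseteq> U" "closed_under W Y" "countable Y"
  using closure_exists[OF assms(1-3), of "UNIV :: nat set"] assms(4)
  unfolding countable_iff_ordLeq_nat by (metis infinite_UNIV_nat)

section \<open>Satisfaction\<close>

lemma eval_term_cong:
  "(\<And>x. x \<in> term_vars t \<Longrightarrow> v x = w x) \<Longrightarrow> eval_term M v t = eval_term M w t"
proof (induction t)
  case (App f ts)
  then have "map (eval_term M v) ts = map (eval_term M w) ts" by auto
  then show ?case by (simp only: eval_term.simps)
qed simp

lemma sat_cong:
  "(\<And>x. x \<in> free_vars \<phi> \<Longrightarrow> v x = w x) \<Longrightarrow> sat M \<phi> v = sat M \<phi> w"
proof (induction \<phi> arbitrary: v w)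
  case (Eq s t)
  then show ?case using eval_term_cong[of s v w M] eval_term_cong[of t v w M] by simp
next
  case (Rel R ts)
  have "eval_term M v t = eval_term M w t" if "t \<in> set ts" for t
    by (rule eval_term_cong) (use Rel that in auto)
  then have "map (eval_term M v) ts = map (eval_term M w) ts" by simp
  then show ?case by (simp only: sat.simps)
next
  case (Neg \<phi>)
  have "sat M \<phi> v = sat M \<phi> w"
    by (rule Neg.IH) (use Neg.prems in simp)
  then show ?case by simp
next
  case (Conj \<Phi>)
  have "sat M (\<Phi> i) v = sat M (\<Phi> i) w" for i
    by (rule Conj.IH) (use Conj.prems in auto)
  then show ?case by simp
next
  case (Ex x \<phi>)
  have "sat M \<phi> (v(x := a)) = sat M \<phi> (w(x := a))" for a
    by (rule Ex.IH) (use Ex.prems in auto)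
  then show ?case by simp
qed

lemma models_iff_sat:
  assumes "is_sentence L \<phi>" "universe M \<noteq> {}"
  shows "models M \<phi> \<longleftrightarrow> sat M \<phi> v"
proof -
  obtain a where a: "a \<in> universe M" using assms(2) by blast
  have eq: "sat M \<phi> w = sat M \<phi> v" for w
    by (rule sat_cong) (use assms(1) in \<open>simp add: is_sentence_def\<close>)
  have "range (\<lambda>_ :: nat. a) \<subseteq> universe M" using a by auto
  then have "models M \<phi> \<longrightarrow> sat M \<phi> (\<lambda>_. a)" unfolding models_def by blast
  moreover have "sat M \<phi> v \<longrightarrow> models M \<phi>" unfolding models_def using eq by blast
  ultimately show ?thesis using eq by blast
qed

section \<open>Downward Loewenheim-Skolem\<close>

lemma eval_term_universe_update [simp]: "eval_term (M\<lparr>universe := X\<rparr>) v = eval_term M v"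
proof
  fix t show "eval_term (M\<lparr>universe := X\<rparr>) v t = eval_term M v t"
  proof (induction t)
    case (App f ts)
    then have "map (eval_term (M\<lparr>universe := X\<rparr>) v) ts = map (eval_term M v) ts" by auto
    then show ?case by (simp only: eval_term.simps) simp
  qed simp
qed

text \<open>Witnesses for \<open>Ex x \<phi>\<close> depend only on the values of finitely many free
  variables, so a single operation on lists supplies them; a conjunction unites countably many
  countable families. The claim is made for all closed \<open>X\<close> at once, so that the
  induction hypotheses speak of the same \<open>X\<close>.\<close>

lemma skolem_functions:
  assumes "u \<in> universe K" "finite (free_vars \<phi>)"
  shows "\<exists>W. countable W \<and> closed_under W (universe K) \<and>
    (\<forall>X v. X \<subseteq> universe K \<longrightarrow> closed_under W X \<longrightarrow> range v \<subseteq> X \<longrightarrow> sat (K\<lparr>universe := X\<rparr>) \<phi> v = sat K \<phi> v)"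
  using assms(2)
proof (induction \<phi>)
  case (Eq s t)
  show ?case by (rule exI[of _ "{}"]) (auto simp: closed_under_def)
next
  case (Rel R ts)
  show ?case by (rule exI[of _ "{}"]) (auto simp: closed_under_def)
next
  case (Neg \<phi>)
  then show ?case by simp
next
  case (Conj \<Phi>)
  have "finite (free_vars (\<Phi> i))" for i
    using Conj.prems by (auto intro: finite_subset[of _ "\<Union>i. free_vars (\<Phi> i)"])
  with Conj.IH have "\<forall>i. \<exists>W. countable W \<and> closed_under W (universe K) \<and>
    (\<forall>X v. X \<subseteq> universe K \<longrightarrow> closed_under W X \<longrightarrow> range v \<subseteq> X \<longrightarrow>
       sat (K\<lparr>universe := X\<rparr>) (\<Phi> i) v = sat K (\<Phi> i) v)" by blast
  then obtain W where W: "\<And>i. countable (W i)" "\<And>i. closed_under (W i) (universe K)"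
    "\<And>i X v. X \<subseteq> universe K \<Longrightarrow> closed_under (W i) X \<Longrightarrow> range v \<subseteq> X \<Longrightarrow>
       sat (K\<lparr>universe := X\<rparr>) (\<Phi> i) v = sat K (\<Phi> i) v" by metis
  show ?case
    by (rule exI[of _ "\<Union>i. W i"]) (use W in \<open>simp add: closed_under_UN\<close>)
next
  case (Ex x \<phi>)
  have "finite (free_vars \<phi>)" using Ex.prems by simp
  with Ex.IH obtain W where W: "countable W" "closed_under W (universe K)"
    "\<And>X v. X \<subseteq> universe K \<Longrightarrow> closed_under W X \<Longrightarrow> range v \<subseteq> X \<Longrightarrow>
       sat (K\<lparr>universe := X\<rparr>) \<phi> v = sat K \<phi> v" by metis
  obtain ns where ns: "set ns = free_vars (Ex x \<phi>)"
    using Ex.prems finite_list by blast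
  define asg where "asg xs n = (case map_of (zip ns xs) n of Some a \<Rightarrow> a | None \<Rightarrow> u)" for xs n
  define s where "s xs = (if \<exists>a\<in>universe K. sat K \<phi> ((asg xs)(x := a))
    then SOME a. a \<in> universe K \<and> sat K \<phi> ((asg xs)(x := a)) else u)" for xs
  have s1: "s xs \<in> universe K" for xs
    unfolding s_def using assms(1) someI_ex[of "\<lambda>a. a \<in> universe K \<and> sat K \<phi> ((asg xs)(x := a))"]
    by auto
  have s2: "sat K \<phi> ((asg xs)(x := s xs))"
    if "a \<in> universe K" "sat K \<phi> ((asg xs)(x := a))" for xs a
    unfolding s_def using that someI_ex[of "\<lambda>a. a \<in> universe K \<and> sat K \<phi> ((asg xs)(x := a))"]
    by auto
  have asg: "asg (map v ns) n = v n" if "n \<in> set ns" for v n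
    unfolding asg_def using that by (simp add: map_of_zip_map)
  have sat_asg: "sat K \<phi> ((asg (map v ns))(x := a)) = sat K \<phi> (v(x := a))" for v a
    by (rule sat_cong) (use ns asg in auto)
  show ?case
  proof (intro exI[of _ "insert s W"] conjI allI impI)
    fix X and v :: "nat \<Rightarrow> 'a"
    assume X: "X \<subseteq> universe K" "closed_under (insert s W) X" "range v \<subseteq> X"
    have "range (v(x := a)) \<subseteq> X" if "a \<in> X" for a using X(3) that by auto
    then have 1: "sat (K\<lparr>universe := X\<rparr>) \<phi> (v(x := a)) = sat K \<phi> (v(x := a))" if "a \<in> X" for a
      using W(3)[of X "v(x := a)"] X that by (auto simp: closed_under_def)
    have "set (map v ns) \<subseteq> X" using X(3) by auto
    then have 2: "s (map v ns) \<in> X" using X by (auto simp: closed_under_def)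
    show "sat (K\<lparr>universe := X\<rparr>) (Ex x \<phi>) v = sat K (Ex x \<phi>) v"
      using 1 2 s2[of _ "map v ns"] X(1) by (auto simp: sat_asg) 
  qed (use W s1 in \<open>auto simp: closed_under_def\<close>)
qed

text \<open>The result is a set of operations rather than one substructure, so that further closure
  conditions can be imposed on the same \<open>X\<close>.\<close>

lemma loewenheim_skolem:
  assumes "is_structure L K" "is_sentence L \<phi>"
  obtains W where "countable W" "closed_under W (universe K)"
    "\<And>X. X \<subseteq> universe K \<Longrightarrow> X \<noteq> {} \<Longrightarrow> closed_under W X \<Longrightarrow>
       is_structure L (K\<lparr>universe := X\<rparr>) \<and> (models (K\<lparr>universe := X\<rparr>) \<phi> \<longleftrightarrow> models K \<phi>)"
proof -
  obtain u where u: "u \<in> universe K" using assms(1) by (auto simp: is_structure_def)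
  obtain W where W: "countable W" "closed_under W (universe K)"
    "\<And>X v. X \<subseteq> universe K \<Longrightarrow> closed_under W X \<Longrightarrow> range v \<subseteq> X \<Longrightarrow>
       sat (K\<lparr>universe := X\<rparr>) \<phi> v = sat K \<phi> v"
    using skolem_functions[OF u, of \<phi>] assms(2) by (auto simp: is_sentence_def)
  \<comment> \<open>The functions of the language join the Skolem functions. The default
    \<open>u\<close> keeps the universe closed under \<open>g f\<close> at those lists where the
    interpretation of \<open>f\<close> is unconstrained.\<close>
  define g where "g f xs = (if fun_arity L f = Some (length xs) \<and> set xs \<subseteq> universe K
    then fun_interp K f xs else u)" for f xs
  show ?thesis
  proof (rule that[of "W \<union> range g"])
    have "g f xs \<in> universe K" for f xs
      using u assms(1) by (auto simp: g_def is_structure_def)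
    then show "closed_under (W \<union> range g) (universe K)"
      using W(2) by (auto simp: closed_under_def)
    fix X assume X: "X \<subseteq> universe K" "X \<noteq> {}" "closed_under (W \<union> range g) X"
    have "fun_interp K f xs \<in> X" if "fun_arity L f = Some (length xs)" "set xs \<subseteq> X" for f xs
    proof -
      have "g f xs \<in> X" using that(2) X(3) by (auto simp: closed_under_def)
      moreover have "set xs \<subseteq> universe K" using that(2) X(1) by blast
      ultimately show ?thesis using that(1) by (simp add: g_def)
    qed
    then have "is_structure L (K\<lparr>universe := X\<rparr>)" using X(2) by (simp add: is_structure_def)
    moreover obtain x where "x \<in> X" using X(2) by blast
    then have "sat (K\<lparr>universe := X\<rparr>) \<phi> (\<lambda>_. x) = sat K \<phi> (\<lambda>_. x)"
      using W(3)[of X "\<lambda>_. x"] X by (auto simp: closed_under_def)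
    then have "models (K\<lparr>universe := X\<rparr>) \<phi> \<longleftrightarrow> models K \<phi>"
      using models_iff_sat[OF assms(2)] X(2) u by (metis empty_iff select_convs(1) surjective update_convs(1))
    ultimately show "is_structure L (K\<lparr>universe := X\<rparr>) \<and> (models (K\<lparr>universe := X\<rparr>) \<phi> \<longleftrightarrow> models K \<phi>)"
      by blast
  qed (use W(1) in simp)
qed

section \<open>Back-and-forth systems\<close>

text \<open>Functions enter through their graphs and only at pairs already in \<open>p\<close>,
  because the maps in \<open>P\<close> need not be closed under the functions. An extension may add
  more than the requested pair, so a single isomorphism also counts as a system.\<close>

definition back_forth :: "language \<Rightarrow> 'a struct \<Rightarrow> 'b struct \<Rightarrow> ('a \<times> 'b) set set \<Rightarrow> bool" where
  "back_forth L M N P \<longleftrightarrow>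
    (\<forall>p\<in>P. p \<subseteq> universe M \<times> universe N) \<and>
    (\<forall>p\<in>P. \<forall>a\<in>universe M. \<exists>b. \<exists>p'\<in>P. insert (a, b) p \<subseteq> p') \<and>
    (\<forall>p\<in>P. \<forall>b\<in>universe N. \<exists>a. \<exists>p'\<in>P. insert (a, b) p \<subseteq> p') \<and>
    (\<forall>p\<in>P. \<forall>a b a' b'. (a, b) \<in> p \<longrightarrow> (a', b') \<in> p \<longrightarrow> (a = a' \<longleftrightarrow> b = b')) \<and>
    (\<forall>p\<in>P. \<forall>R ps. rel_arity L R = Some (length ps) \<longrightarrow> set ps \<subseteq> p \<longrightarrow>
       (rel_interp M R (map fst ps) \<longleftrightarrow> rel_interp N R (map snd ps))) \<and>
    (\<forall>p\<in>P. \<forall>f ps a b. fun_arity L f = Some (length ps) \<longrightarrow> set ps \<subseteq> p \<longrightarrow> (a, b) \<in> p \<longrightarrow>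
       (fun_interp M f (map fst ps) = a \<longleftrightarrow> fun_interp N f (map snd ps) = b))"

context
  fixes L :: language and M :: "'a struct" and N :: "'b struct" and P
  assumes bf: "back_forth L M N P" and M: "is_structure L M" and N: "is_structure L N"
begin

lemma bf_dom: "p \<in> P \<Longrightarrow> p \<subseteq> universe M \<times> universe N"
  using bf by (simp add: back_forth_def)

lemma bf_forth: "p \<in> P \<Longrightarrow> a \<in> universe M \<Longrightarrow> \<exists>b. \<exists>p'\<in>P. insert (a, b) p \<subseteq> p'"
  using bf by (simp add: back_forth_def)

lemma bf_back: "p \<in> P \<Longrightarrow> b \<in> universe N \<Longrightarrow> \<exists>a. \<exists>p'\<in>P. insert (a, b) p \<subseteq> p'"
  using bf by (simp add: back_forth_def)

lemma bf_eq: "p \<in> P \<Longrightarrow> (a, b) \<in> p \<Longrightarrow> (a', b') \<in> p \<Longrightarrow> a = a' \<longleftrightarrow> b = b'"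
  using bf[unfolded back_forth_def, THEN conjunct2, THEN conjunct2, THEN conjunct2, THEN conjunct1] by blast

lemma bf_rel: "p \<in> P \<Longrightarrow> rel_arity L R = Some (length ps) \<Longrightarrow> set ps \<subseteq> p \<Longrightarrow>
    rel_interp M R (map fst ps) \<longleftrightarrow> rel_interp N R (map snd ps)"
  using bf by (simp add: back_forth_def)

lemma bf_fun: "p \<in> P \<Longrightarrow> fun_arity L f = Some (length ps) \<Longrightarrow> set ps \<subseteq> p \<Longrightarrow> (a, b) \<in> p \<Longrightarrow>
    fun_interp M f (map fst ps) = a \<longleftrightarrow> fun_interp N f (map snd ps) = b"
  using bf[unfolded back_forth_def, THEN conjunct2, THEN conjunct2, THEN conjunct2, THEN conjunct2, THEN conjunct2]
  by blast

text \<open>The extension property of single terms is a hypothesis here, so that the lemma is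
  available inside the induction over terms as well as after it. Pairs found for some entries of the
  list survive because the maps only grow.\<close>

lemma bf_terms_aux:
  assumes "\<And>t p. t \<in> set ts \<Longrightarrow> p \<in> P \<Longrightarrow> Q p t \<Longrightarrow>
      \<exists>p'\<in>P. p \<subseteq> p' \<and> (eval_term M v t, eval_term N w t) \<in> p'"
    and "\<And>t p p'. Q p t \<Longrightarrow> p \<subseteq> p' \<Longrightarrow> Q p' t" and "p \<in> P" "\<And>t. t \<in> set ts \<Longrightarrow> Q p t"
  shows "\<exists>p'\<in>P. p \<subseteq> p' \<and> (\<forall>t\<in>set ts. (eval_term M v t, eval_term N w t) \<in> p')"
  using assms
proof (induction ts)
  case Nil
  then show ?case by auto
next
  case (Cons t ts)
  have "\<exists>p'\<in>P. p \<subseteq> p' \<and> (\<forall>t\<in>set ts. (eval_term M v t, eval_term N w t) \<in> p')"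
  proof (rule Cons.IH)
    fix s q assume "s \<in> set ts" "q \<in> P" "Q q s"
    then show "\<exists>p'\<in>P. q \<subseteq> p' \<and> (eval_term M v s, eval_term N w s) \<in> p'"
      by (intro Cons.prems(1)) simp_all
  next
    fix s q q' assume "Q q s" "q \<subseteq> q'"
    then show "Q q' s" by (rule Cons.prems(2))
  next
    fix s assume "s \<in> set ts"
    then show "Q p s" by (intro Cons.prems(4)) simp
  qed (rule Cons.prems(3))
  then obtain p' where p': "p' \<in> P" "p \<subseteq> p'" "\<forall>t\<in>set ts. (eval_term M v t, eval_term N w t) \<in> p'"
    by blast
  have "Q p t" by (rule Cons.prems(4)) simp
  then have "Q p' t" using p'(2) by (rule Cons.prems(2))
  then obtain p'' where "p'' \<in> P" "p' \<subseteq> p''" "(eval_term M v t, eval_term N w t) \<in> p''"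
    using Cons.prems(1)[of t p'] p'(1) by auto
  with p'(2,3) have "p \<subseteq> p''" "\<forall>s\<in>set (t # ts). (eval_term M v s, eval_term N w s) \<in> p''" by auto
  with \<open>p'' \<in> P\<close> show ?case by blast
qed

lemma bf_eval_term:
  "term_of_language L t \<Longrightarrow> p \<in> P \<Longrightarrow> \<forall>x\<in>term_vars t. (v x, w x) \<in> p \<Longrightarrow>
   \<exists>p'\<in>P. p \<subseteq> p' \<and> (eval_term M v t, eval_term N w t) \<in> p'"
proof (induction t arbitrary: p)
  case (Var x)
  then show ?case by auto
next
  case (App f ts)
  have ar: "fun_arity L f = Some (length ts)" using App.prems by simp
  have "\<exists>p1\<in>P. p \<subseteq> p1 \<and> (\<forall>t\<in>set ts. (eval_term M v t, eval_term N w t) \<in> p1)"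
  proof (rule bf_terms_aux[where Q = "\<lambda>p t. term_of_language L t \<and> (\<forall>x\<in>term_vars t. (v x, w x) \<in> p)"])
    fix t q assume "t \<in> set ts" "q \<in> P" "term_of_language L t \<and> (\<forall>x\<in>term_vars t. (v x, w x) \<in> q)"
    then show "\<exists>p'\<in>P. q \<subseteq> p' \<and> (eval_term M v t, eval_term N w t) \<in> p'" using App.IH by blast
  qed (use App.prems in \<open>auto simp: list_all_iff\<close>)
  then obtain p1 where p1: "p1 \<in> P" "p \<subseteq> p1" "\<forall>t\<in>set ts. (eval_term M v t, eval_term N w t) \<in> p1"
    by blast
  define ps where "ps = map (\<lambda>t. (eval_term M v t, eval_term N w t)) ts"
  have ps: "length ps = length ts" "map fst ps = map (eval_term M v) ts"
    "map snd ps = map (eval_term N w) ts" "set ps \<subseteq> p1" using p1(3) by (auto simp: ps_def)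
  have "fst ` set ps \<subseteq> universe M" using ps(4) bf_dom[OF p1(1)] by auto
  then have "eval_term M v (App f ts) \<in> universe M"
    using M ar ps by (simp add: is_structure_def flip: ps(2))
  \<comment> \<open>The forth property yields some partner \<open>b\<close> of the value; the graph
    clause then forces \<open>b\<close> to be the value of the same term on the other side.\<close>
  then obtain b p2 where p2: "p2 \<in> P" "insert (eval_term M v (App f ts), b) p1 \<subseteq> p2"
    using bf_forth[OF p1(1)] by blast
  then have "fun_interp N f (map snd ps) = b"
    using bf_fun[of p2 f ps "eval_term M v (App f ts)" b] ar ps by fastforce
  then have "b = eval_term N w (App f ts)" using ps by simp
  then show ?case using p1 p2 by blast
qed

text \<open>Karp's theorem: quantifiers are answered by the forth and back properties, and the same
  \<open>P\<close> serves every subformula, so the depth of the formula does not matter.\<close>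

lemma bf_sat:
  "form_of_language L \<phi> \<Longrightarrow> p \<in> P \<Longrightarrow> \<forall>x\<in>free_vars \<phi>. (v x, w x) \<in> p \<Longrightarrow> sat M \<phi> v = sat N \<phi> w"
proof (induction \<phi> arbitrary: p v w)
  case (Eq s t)
  obtain p1 where p1: "p1 \<in> P" "p \<subseteq> p1" "(eval_term M v s, eval_term N w s) \<in> p1"
    using bf_eval_term[of s p v w] Eq by auto
  then obtain p2 where "p2 \<in> P" "p1 \<subseteq> p2" "(eval_term M v t, eval_term N w t) \<in> p2"
    using bf_eval_term[of t p1 v w] Eq by auto
  then show ?case using bf_eq[of p2] p1 by (metis sat.simps(1) subsetD)
next
  case (Rel R ts)
  have "\<exists>p1\<in>P. p \<subseteq> p1 \<and> (\<forall>t\<in>set ts. (eval_term M v t, eval_term N w t) \<in> p1)"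
  proof (rule bf_terms_aux[where Q = "\<lambda>p t. term_of_language L t \<and> (\<forall>x\<in>term_vars t. (v x, w x) \<in> p)"])
    fix t q assume "t \<in> set ts" "q \<in> P" "term_of_language L t \<and> (\<forall>x\<in>term_vars t. (v x, w x) \<in> q)"
    then show "\<exists>p'\<in>P. q \<subseteq> p' \<and> (eval_term M v t, eval_term N w t) \<in> p'" using bf_eval_term by blast
  qed (use Rel.prems in \<open>auto simp: list_all_iff\<close>)
  then obtain p1 where p1: "p1 \<in> P" "p \<subseteq> p1" "\<forall>t\<in>set ts. (eval_term M v t, eval_term N w t) \<in> p1"
    by blast
  define ps where "ps = map (\<lambda>t. (eval_term M v t, eval_term N w t)) ts"
  have ps: "length ps = length ts" "map fst ps = map (eval_term M v) ts"
    "map snd ps = map (eval_term N w) ts" "set ps \<subseteq> p1" using p1(3) by (auto simp: ps_def)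
  then show ?case using bf_rel[OF p1(1), of R ps] Rel.prems by simp
next
  case (Neg \<phi>)
  then have "sat M \<phi> v = sat N \<phi> w" by simp
  then show ?case by simp
next
  case (Conj \<Phi>)
  have "sat M (\<Phi> i) v = sat N (\<Phi> i) w" for i
    by (rule Conj.IH[of _ p]) (use Conj.prems in auto)
  then show ?case by simp
next
  case (Ex x \<phi>)
  have *: "sat M \<phi> (v(x := a)) = sat N \<phi> (w(x := b))" if "p' \<in> P" "insert (a, b) p \<subseteq> p'" for a b p'
    by (rule Ex.IH[of p']) (use Ex.prems that in auto)
  have **: "a \<in> universe M" "b \<in> universe N" if "p' \<in> P" "insert (a, b) p \<subseteq> p'" for a b p'
    using bf_dom[OF that(1)] that(2) by auto
  show ?case using bf_forth[OF Ex.prems(2)] bf_back[OF Ex.prems(2)] * ** 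
    by (metis sat.simps(5))
qed

lemma bf_models:
  assumes "P \<noteq> {}" "is_sentence L \<phi>"
  shows "models M \<phi> \<longleftrightarrow> models N \<phi>"
proof -
  obtain p where "p \<in> P" using assms by blast
  then have "sat M \<phi> undefined = sat N \<phi> undefined"
    using bf_sat assms(2) by (auto simp: is_sentence_def)
  then show ?thesis using models_iff_sat[OF assms(2)] M N by (metis is_structure_def)
qed

text \<open>Both universes are enumerated, and step \<open>n\<close> puts their \<open>n\<close>-th
  elements into the domain and the range of the map. Each clause of \<open>back_forth\<close>
  concerns finitely many pairs and therefore holds of the union \<open>G\<close> of the
  chain.\<close>

lemma bf_isomorphic:
  assumes "P \<noteq> {}" "countable (universe M)" "countable (universe N)"
  shows "isomorphic L M N"
proof -
  obtain p0 where p0: "p0 \<in> P" using assms by blast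
  have ne: "universe M \<noteq> {}" "universe N \<noteq> {}" using M N by (auto simp: is_structure_def)
  define a where "a = from_nat_into (universe M)"
  define b where "b = from_nat_into (universe N)"
  have "\<exists>p'\<in>P. p \<subseteq> p' \<and> a n \<in> Domain p' \<and> b n \<in> Range p'" if pP: "p \<in> P" for p n
  proof -
    obtain y p1 where 1: "p1 \<in> P" "insert (a n, y) p \<subseteq> p1"
      using bf_forth[OF pP, of "a n"] ne by (auto simp: a_def from_nat_into)
    obtain x p2 where 2: "p2 \<in> P" "insert (x, b n) p1 \<subseteq> p2"
      using bf_back[OF 1(1), of "b n"] ne by (auto simp: b_def from_nat_into)
    show ?thesis using 1 2 by blast
  qed
  then have "\<exists>p. p 0 = p0 \<and> (\<forall>n. p n \<in> P \<and> (p n \<subseteq> p (Suc n) \<and> a n \<in> Domain (p (Suc n)) \<and> b n \<in> Range (p (Suc n))))"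
    using dependent_nat_choice[of "\<lambda>n p. p \<in> P \<and> (n = 0 \<longrightarrow> p = p0)"
        "\<lambda>n p p'. p \<subseteq> p' \<and> a n \<in> Domain p' \<and> b n \<in> Range p'"] p0
    by (metis nat.simps(3))
  then obtain p where p: "\<And>n. p n \<in> P" "\<And>n. p n \<subseteq> p (Suc n)"
    "\<And>n. a n \<in> Domain (p (Suc n))" "\<And>n. b n \<in> Range (p (Suc n))" by blast
  define G where "G = (\<Union>n. p n)"
  have mono: "p m \<subseteq> p n" if "m \<le> n" for m n using lift_Suc_mono_le[of p] p(2) that by blast
  have fin: "\<exists>n. set ps \<subseteq> p n" if "set ps \<subseteq> G" for ps
    using finite_subset_incseq[of p "set ps"] p(2) that unfolding G_def by auto
  have GP: "\<exists>q\<in>P. set ps \<subseteq> q" if "set ps \<subseteq> G" for ps using fin[OF that] p(1) by blast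
  have Gdom: "G \<subseteq> universe M \<times> universe N" using bf_dom[OF p(1)] by (auto simp: G_def)
  have "universe M \<subseteq> Domain G"
  proof
    fix x assume "x \<in> universe M"
    then obtain n where "x = a n" unfolding a_def using assms(2) by (metis from_nat_into_surj)
    with p(3)[of n] show "x \<in> Domain G" unfolding G_def by blast
  qed
  moreover have "universe N \<subseteq> Range G"
  proof
    fix x assume "x \<in> universe N"
    then obtain n where "x = b n" unfolding b_def using assms(3) by (metis from_nat_into_surj)
    with p(4)[of n] show "x \<in> Range G" unfolding G_def by blast
  qed
  ultimately have DR: "Domain G = universe M" "Range G = universe N" using Gdom by auto
  have Geq: "x = x' \<longleftrightarrow> y = y'" if xy: "(x, y) \<in> G" "(x', y') \<in> G" for x y x' y'
  proof -
    obtain q where "q \<in> P" "(x, y) \<in> q" "(x', y') \<in> q"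
      using GP[of "[(x, y), (x', y')]"] xy by auto
    then show ?thesis by (rule bf_eq)
  qed
  define h where "h x = (THE y. (x, y) \<in> G)" for x
  have h: "(x, h x) \<in> G" if "x \<in> universe M" for x
  proof -
    have "x \<in> Domain G" using DR that by simp
    then obtain y where y: "(x, y) \<in> G" by blast
    have "h x = y" unfolding h_def
      by (rule the_equality, rule y) (use Geq[OF y] in blast)
    with y show ?thesis by simp
  qed
  have "inj_on h (universe M)" 
  proof (rule inj_onI)
    fix x x' assume "x \<in> universe M" "x' \<in> universe M" "h x = h x'"
    then show "x = x'" using Geq[OF h h, of x x'] by blast
  qed
  moreover have "h ` universe M = universe N"
  proof (intro equalityI subsetI)
    fix y assume "y \<in> universe N"
    then have "y \<in> Range G" using DR by simp
    then obtain x where x: "(x, y) \<in> G" by blast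
    then have "x \<in> universe M" using Gdom by blast
    moreover from this have "h x = y" using Geq[OF x h] by blast
    ultimately show "y \<in> h ` universe M" by blast
  qed (use h Gdom in blast)
  ultimately have "bij_betw h (universe M) (universe N)" by (simp add: bij_betw_def)
  moreover have "h (fun_interp M f xs) = fun_interp N f (map h xs)"
    if "fun_arity L f = Some (length xs)" "set xs \<subseteq> universe M" for f xs
  proof -
    let ?ps = "map (\<lambda>x. (x, h x)) xs" and ?y = "fun_interp M f xs"
    have "?y \<in> universe M" using that M by (simp add: is_structure_def)
    then have "set ((?y, h ?y) # ?ps) \<subseteq> G" using h that(2) by auto
    then obtain q where q: "q \<in> P" "set ((?y, h ?y) # ?ps) \<subseteq> q" using GP by blast
    then show ?thesis using bf_fun[of q f ?ps ?y "h ?y"] that(1) by (simp add: comp_def)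
  qed
  moreover have "rel_interp M R xs \<longleftrightarrow> rel_interp N R (map h xs)"
    if "rel_arity L R = Some (length xs)" "set xs \<subseteq> universe M" for R xs
  proof -
    let ?ps = "map (\<lambda>x. (x, h x)) xs"
    have "set ?ps \<subseteq> G" using h that(2) by auto
    then obtain q where q: "q \<in> P" "set ?ps \<subseteq> q" using GP by blast
    then show ?thesis using bf_rel[of q R ?ps] that(1) by (simp add: comp_def)
  qed
  ultimately show ?thesis unfolding isomorphic_def by blast
qed

end

lemma isomorphic_back_forth:
  assumes "isomorphic L M N" "is_structure L M"
  shows "\<exists>p. back_forth L M N {p}"
proof -
  obtain h where h: "bij_betw h (universe M) (universe N)"
     "\<And>f xs. fun_arity L f = Some (length xs) \<Longrightarrow> set xs \<subseteq> universe M \<Longrightarrow>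
        h (fun_interp M f xs) = fun_interp N f (map h xs)"
     "\<And>R xs. rel_arity L R = Some (length xs) \<Longrightarrow> set xs \<subseteq> universe M \<Longrightarrow>
        (rel_interp M R xs \<longleftrightarrow> rel_interp N R (map h xs))"
    using assms(1) unfolding isomorphic_def by blast
  let ?p = "(\<lambda>x. (x, h x)) ` universe M"
  have inj: "inj_on h (universe M)" and im: "h ` universe M = universe N"
    using h(1) by (auto simp: bij_betw_def)
  have ps: "map snd ps = map h (map fst ps)" "set (map fst ps) \<subseteq> universe M" if "set ps \<subseteq> ?p" for ps
    using that by auto
  have "back_forth L M N {?p}" unfolding back_forth_def
  proof (intro conjI ballI allI impI; (elim singletonE; hypsubst)?)
    fix f ps a b assume *: "fun_arity L f = Some (length ps)" "set ps \<subseteq> ?p" "(a, b) \<in> ?p"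
    have "fun_interp M f (map fst ps) \<in> universe M"
      using assms(2) * ps(2)[OF *(2)] by (simp add: is_structure_def)
    then have "fun_interp M f (map fst ps) = a \<longleftrightarrow> h (fun_interp M f (map fst ps)) = b"
      using *(3) inj by (auto dest: inj_onD)
    then show "fun_interp M f (map fst ps) = a \<longleftrightarrow> fun_interp N f (map snd ps) = b"
      using h(2)[of f "map fst ps"] *(1) ps(2)[OF *(2)] unfolding ps(1)[OF *(2)] by simp
  next
    fix R ps assume *: "rel_arity L R = Some (length ps)" "set ps \<subseteq> ?p"
    then show "rel_interp M R (map fst ps) = rel_interp N R (map snd ps)"
      using h(3)[of R "map fst ps"] ps(2)[OF *(2)] unfolding ps(1)[OF *(2)] by simp
  next
    fix b assume "b \<in> universe N"
    then obtain a where "a \<in> universe M" "b = h a" using im by blast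
    then have "insert (a, b) ?p \<subseteq> ?p" by blast
    then show "\<exists>a. \<exists>p'\<in>{?p}. insert (a, b) ?p \<subseteq> p'" by blast
  qed (use inj im in \<open>auto dest: inj_onD\<close>)
  then show ?thesis by blast
qed

lemma isomorphic_models:
  assumes "isomorphic L M N" "is_structure L M" "is_structure L N" "is_sentence L \<phi>"
  shows "models M \<phi> \<longleftrightarrow> models N \<phi>"
  using isomorphic_back_forth[OF assms(1,2)] bf_models assms by blast

definition copy_struct :: "('a \<Rightarrow> 'b) \<Rightarrow> 'a struct \<Rightarrow> 'b struct" where
  "copy_struct h M = \<lparr>universe = h ` universe M,
     fun_interp = \<lambda>f ys. h (fun_interp M f (map (inv_into (universe M) h) ys)),
     rel_interp = \<lambda>R ys. rel_interp M R (map (inv_into (universe M) h) ys)\<rparr>"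

lemma copy_struct:
  assumes "is_structure L M" "inj_on h (universe M)"
  shows "is_structure L (copy_struct h M)" "isomorphic L M (copy_struct h M)"
proof -
  let ?i = "inv_into (universe M) h"
  have "set (map ?i ys) \<subseteq> universe M" if "set ys \<subseteq> h ` universe M" for ys
    using that by (auto simp: inv_into_into)
  then show "is_structure L (copy_struct h M)"
    using assms(1) unfolding is_structure_def copy_struct_def
    by simp
  have "map ?i (map h xs) = xs" if "set xs \<subseteq> universe M" for xs
    using that assms(2) by (induction xs) auto
  then show "isomorphic L M (copy_struct h M)"
    unfolding isomorphic_def copy_struct_def using assms(2)
    by (intro exI[of _ h]) (auto simp: bij_betw_def)
qed

text \<open>\<open>has_model_of_card\<close> asks for a model over the type of the cardinal; a model
  over any other type is copied along a bijection from its universe to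
  \<open>Field r\<close>.\<close>

lemma has_model_of_cardI:
  assumes "is_structure L N" "|universe N| =o r" "Card_order r" "models N \<phi>" "is_sentence L \<phi>"
  shows "has_model_of_card L \<phi> r"
proof -
  have "|universe N| =o |Field r|"
    using assms(2,3) card_of_Field_ordIso ordIso_symmetric ordIso_transitive by blast
  then obtain h where h: "bij_betw h (universe N) (Field r)" using card_of_ordIso by blast
  then have inj: "inj_on h (universe N)" by (simp add: bij_betw_def)
  have u: "universe (copy_struct h N) = Field r" using h by (simp add: copy_struct_def bij_betw_def)
  then have "|universe (copy_struct h N)| =o r" using assms(3) card_of_Field_ordIso by simp
  moreover have "models (copy_struct h N) \<phi>"
    using isomorphic_models copy_struct[OF assms(1) inj] assms by blast
  ultimately show ?thesis
    using copy_struct(1)[OF assms(1) inj] unfolding has_model_of_card_def by blast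
qed

section \<open>Typings of tuples\<close>

text \<open>
  The maps \<open>s\<close> and \<open>t\<close> assign to a tuple its type, a natural number: tuples of equal type form a
  back-and-forth system between \<open>U\<close> and \<open>V\<close>.
\<close>

definition type_equiv ::
    "'a set \<Rightarrow> ('a list \<Rightarrow> nat) \<Rightarrow> 'b set \<Rightarrow> ('b list \<Rightarrow> nat) \<Rightarrow> bool" where
  "type_equiv U s V t \<longleftrightarrow> s [] = t [] \<and>
    (\<forall>us vs. set us \<subseteq> U \<longrightarrow> set vs \<subseteq> V \<longrightarrow> s us = t vs \<longrightarrow>
       length us = length vs \<and>
       (\<forall>i<length us. \<forall>j<length us. us ! i = us ! j \<longleftrightarrow> vs ! i = vs ! j) \<and>
       (\<forall>is. set is \<subseteq> {..<length us} \<longrightarrow> s (map ((!) us) is) = t (map ((!) vs) is)) \<and>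
       (\<forall>a\<in>U. \<exists>b\<in>V. s (us @ [a]) = t (vs @ [b])) \<and>
       (\<forall>b\<in>V. \<exists>a\<in>U. s (us @ [a]) = t (vs @ [b])))"

lemma type_equiv_Nil: "type_equiv U s V t \<Longrightarrow> s [] = t []"
  by (simp add: type_equiv_def)

lemma type_equiv_step:
  assumes "type_equiv U s V t" "set us \<subseteq> U" "set vs \<subseteq> V" "s us = t vs"
  shows "length us = length vs \<and>
       (\<forall>i<length us. \<forall>j<length us. us ! i = us ! j \<longleftrightarrow> vs ! i = vs ! j) \<and>
       (\<forall>is. set is \<subseteq> {..<length us} \<longrightarrow> s (map ((!) us) is) = t (map ((!) vs) is)) \<and>
       (\<forall>a\<in>U. \<exists>b\<in>V. s (us @ [a]) = t (vs @ [b])) \<and>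
       (\<forall>b\<in>V. \<exists>a\<in>U. s (us @ [a]) = t (vs @ [b]))"
  using assms(1)[unfolded type_equiv_def, THEN conjunct2, rule_format, OF assms(2-4)] by auto

lemma type_equiv_length:
  "type_equiv U s V t \<Longrightarrow> set us \<subseteq> U \<Longrightarrow> set vs \<subseteq> V \<Longrightarrow> s us = t vs \<Longrightarrow> length us = length vs"
  using type_equiv_step[THEN conjunct1] .

lemma type_equiv_eq:
  "type_equiv U s V t \<Longrightarrow> set us \<subseteq> U \<Longrightarrow> set vs \<subseteq> V \<Longrightarrow> s us = t vs \<Longrightarrow>
   i < length us \<Longrightarrow> j < length us \<Longrightarrow> us ! i = us ! j \<longleftrightarrow> vs ! i = vs ! j"
  using type_equiv_step[THEN conjunct2, THEN conjunct1] by blast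

lemma type_equiv_sub:
  "type_equiv U s V t \<Longrightarrow> set us \<subseteq> U \<Longrightarrow> set vs \<subseteq> V \<Longrightarrow> s us = t vs \<Longrightarrow>
   set is \<subseteq> {..<length us} \<Longrightarrow> s (map ((!) us) is) = t (map ((!) vs) is)"
  using type_equiv_step[THEN conjunct2, THEN conjunct2, THEN conjunct1] by blast

lemma type_equiv_forth:
  "type_equiv U s V t \<Longrightarrow> set us \<subseteq> U \<Longrightarrow> set vs \<subseteq> V \<Longrightarrow> s us = t vs \<Longrightarrow> a \<in> U \<Longrightarrow>
   \<exists>b\<in>V. s (us @ [a]) = t (vs @ [b])"
  using type_equiv_step[THEN conjunct2, THEN conjunct2, THEN conjunct2, THEN conjunct1] by blast

lemma type_equiv_back:
  "type_equiv U s V t \<Longrightarrow> set us \<subseteq> U \<Longrightarrow> set vs \<subseteq> V \<Longrightarrow> s us = t vs \<Longrightarrow> b \<in> V \<Longrightarrow>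
   \<exists>a\<in>U. s (us @ [a]) = t (vs @ [b])"
  using type_equiv_step[THEN conjunct2, THEN conjunct2, THEN conjunct2, THEN conjunct2] by blast

lemma type_equivI:
  assumes "s [] = t []"
    and "\<And>us vs. set us \<subseteq> U \<Longrightarrow> set vs \<subseteq> V \<Longrightarrow> s us = t vs \<Longrightarrow> length us = length vs"
    and "\<And>us vs i j. set us \<subseteq> U \<Longrightarrow> set vs \<subseteq> V \<Longrightarrow> s us = t vs \<Longrightarrow> length us = length vs \<Longrightarrow>
       i < length us \<Longrightarrow> j < length us \<Longrightarrow> us ! i = us ! j \<longleftrightarrow> vs ! i = vs ! j"
    and "\<And>us vs is. set us \<subseteq> U \<Longrightarrow> set vs \<subseteq> V \<Longrightarrow> s us = t vs \<Longrightarrow> length us = length vs \<Longrightarrow>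
       set is \<subseteq> {..<length us} \<Longrightarrow> s (map ((!) us) is) = t (map ((!) vs) is)"
    and "\<And>us vs a. set us \<subseteq> U \<Longrightarrow> set vs \<subseteq> V \<Longrightarrow> s us = t vs \<Longrightarrow> length us = length vs \<Longrightarrow>
       a \<in> U \<Longrightarrow> \<exists>b\<in>V. s (us @ [a]) = t (vs @ [b])"
    and "\<And>us vs b. set us \<subseteq> U \<Longrightarrow> set vs \<subseteq> V \<Longrightarrow> s us = t vs \<Longrightarrow> length us = length vs \<Longrightarrow>
       b \<in> V \<Longrightarrow> \<exists>a\<in>U. s (us @ [a]) = t (vs @ [b])"
  shows "type_equiv U s V t"
  unfolding type_equiv_def
proof (intro conjI allI impI ballI)
  fix us vs assume *: "set us \<subseteq> U" "set vs \<subseteq> V" "s us = t vs"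
  show len: "length us = length vs" by (rule assms(2)[OF *])
  show "us ! i = us ! j \<longleftrightarrow> vs ! i = vs ! j" if "i < length us" "j < length us" for i j
    by (rule assms(3)[OF * len that])
  show "s (map ((!) us) is) = t (map ((!) vs) is)" if "set is \<subseteq> {..<length us}" for "is"
    by (rule assms(4)[OF * len that])
  show "\<exists>b\<in>V. s (us @ [a]) = t (vs @ [b])" if "a \<in> U" for a
    by (rule assms(5)[OF * len that])
  show "\<exists>a\<in>U. s (us @ [a]) = t (vs @ [b])" if "b \<in> V" for b
    by (rule assms(6)[OF * len that])
qed (rule assms(1))

lemma type_equiv_sym:
  assumes "type_equiv U s V t"
  shows "type_equiv V t U s"
proof (rule type_equivI)
  show "t [] = s []" using type_equiv_Nil[OF assms] by simp
  fix us vs assume "set us \<subseteq> V" "set vs \<subseteq> U" "t us = s vs"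
  note * = this(2,1) this(3)[symmetric]
  show len: "length us = length vs" using type_equiv_length[OF assms *] by simp
  show "us ! i = us ! j \<longleftrightarrow> vs ! i = vs ! j" if "i < length us" "j < length us" for i j
    using type_equiv_eq[OF assms *, of i j] that len by simp
  show "t (map ((!) us) is) = s (map ((!) vs) is)" if "set is \<subseteq> {..<length us}" for "is"
    using type_equiv_sub[OF assms *, of "is"] that len by simp
  show "\<exists>b\<in>U. t (us @ [a]) = s (vs @ [b])" if "a \<in> V" for a
    using type_equiv_back[OF assms * that] by (simp add: eq_commute)
  show "\<exists>a\<in>V. t (us @ [a]) = s (vs @ [b])" if "b \<in> U" for b
    using type_equiv_forth[OF assms * that] by (simp add: eq_commute)
qed

lemma type_equiv_extend_back:
  assumes "type_equiv U s V t" "set us \<subseteq> U" "set vs \<subseteq> V" "s us = t vs" "set vs' \<subseteq> V"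
  shows "\<exists>us'. set us' \<subseteq> U \<and> length us' = length vs' \<and> s (us @ us') = t (vs @ vs')"
  using assms(5)
proof (induction vs' rule: rev_induct)
  case Nil
  then show ?case using assms(4) by simp
next
  case (snoc b vs')
  then obtain us' where us': "set us' \<subseteq> U" "length us' = length vs'" "s (us @ us') = t (vs @ vs')"
    by auto
  have "set (us @ us') \<subseteq> U" "set (vs @ vs') \<subseteq> V" "b \<in> V"
    using us'(1) assms(2,3) snoc.prems by auto
  from type_equiv_back[OF assms(1) this(1,2) us'(3) this(3)]
  obtain a where "a \<in> U" "s ((us @ us') @ [a]) = t ((vs @ vs') @ [b])" by blast
  with us' show ?case by (intro exI[of _ "us' @ [a]"]) simp
qed

lemma type_equiv_match_back:
  assumes "type_equiv U s V t" "set vs \<subseteq> V"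
  obtains us where "set us \<subseteq> U" "length us = length vs" "s us = t vs"
  using type_equiv_extend_back[OF assms(1) _ _ type_equiv_Nil[OF assms(1)] assms(2)] that by auto

lemma type_equiv_trans:
  assumes "type_equiv U s V t" "type_equiv V t W r"
  shows "type_equiv U s W r"
proof (rule type_equivI)
  show "s [] = r []" using type_equiv_Nil[OF assms(1)] type_equiv_Nil[OF assms(2)] by simp
  fix us ws assume us: "set us \<subseteq> U" and ws: "set ws \<subseteq> W" and eq: "s us = r ws"
  obtain vs where vs: "set vs \<subseteq> V" "length vs = length ws" "t vs = r ws"
    by (rule type_equiv_match_back[OF assms(2) ws])
  have sv: "s us = t vs" using vs eq by simp
  note 1 = assms(1) us vs(1) sv and 2 = assms(2) vs(1) ws vs(3)
  show len: "length us = length ws" using type_equiv_length[OF 1] type_equiv_length[OF 2] by simp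
  have len': "length us = length vs" using type_equiv_length[OF 1] .
  show "us ! i = us ! j \<longleftrightarrow> ws ! i = ws ! j" if "i < length us" "j < length us" for i j
    using type_equiv_eq[OF 1, of i j] type_equiv_eq[OF 2, of i j] that len' by simp
  show "s (map ((!) us) is) = r (map ((!) ws) is)" if "set is \<subseteq> {..<length us}" for "is"
    using type_equiv_sub[OF 1, of "is"] type_equiv_sub[OF 2, of "is"] that len' by simp
  show "\<exists>b\<in>W. s (us @ [a]) = r (ws @ [b])" if "a \<in> U" for a
  proof -
    obtain b where b: "b \<in> V" "s (us @ [a]) = t (vs @ [b])" using type_equiv_forth[OF 1 \<open>a \<in> U\<close>] by blast
    then show ?thesis using type_equiv_forth[OF 2 b(1)] by simp
  qed
  show "\<exists>a\<in>U. s (us @ [a]) = r (ws @ [b])" if "b \<in> W" for b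
  proof -
    obtain a where a: "a \<in> V" "t (vs @ [a]) = r (ws @ [b])" using type_equiv_back[OF 2 \<open>b \<in> W\<close>] by blast
    then show ?thesis using type_equiv_back[OF 1 a(1)] by simp
  qed
qed

lemma type_equiv_refl_left: "type_equiv U s V t \<Longrightarrow> type_equiv U s U s"
  by (rule type_equiv_trans[OF _ type_equiv_sym])

lemma index_list_exists:
  assumes "set ps \<subseteq> set qs"
  obtains "is" where "set is \<subseteq> {..<length qs}" "ps = map ((!) qs) is"
proof -
  have "\<exists>is. set is \<subseteq> {..<length qs} \<and> ps = map ((!) qs) is"
    using assms
  proof (induction ps)
    case (Cons p ps)
    then obtain "is" where "set is \<subseteq> {..<length qs}" "ps = map ((!) qs) is" by auto
    moreover obtain i where "i < length qs" "p = qs ! i"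
      using Cons.prems by (auto simp: in_set_conv_nth)
    ultimately show ?case by (intro exI[of _ "i # is"]) auto
  qed simp
  then show ?thesis using that by blast
qed

lemma type_equiv_zip:
  assumes "type_equiv U s V t" "set us \<subseteq> U" "set vs \<subseteq> V" "s us = t vs"
    "set ps \<subseteq> set (zip us vs)"
  shows "s (map fst ps) = t (map snd ps)"
proof -
  have len: "length us = length vs" using type_equiv_length[OF assms(1-4)] .
  obtain "is" where "is": "set is \<subseteq> {..<length (zip us vs)}" "ps = map ((!) (zip us vs)) is"
    using index_list_exists[OF assms(5)] by blast
  have "map fst ps = map ((!) us) is" "map snd ps = map ((!) vs) is"
    using "is" len by (auto simp: subset_iff)
  then show ?thesis using type_equiv_sub[OF assms(1-4)] "is"(1) len by simp
qed

text \<open>The Tarski-Vaught test for typings: an answer found in \<open>U\<close> is replaced by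
  one in \<open>U0\<close> that has the same type over the same tuple.\<close>

lemma type_equiv_closed_subset:
  assumes "type_equiv U s U s" "U0 \<subseteq> U"
    and "\<And>us a. set us \<subseteq> U0 \<Longrightarrow> a \<in> U \<Longrightarrow> \<exists>b\<in>U0. s (us @ [a]) = s (us @ [b])"
  shows "type_equiv U s U0 s"
proof (rule type_equivI)
  fix us vs assume us: "set us \<subseteq> U" and vs0: "set vs \<subseteq> U0" and eq: "s us = s vs"
  have vs: "set vs \<subseteq> U" using vs0 assms(2) by blast
  note 1 = assms(1) us vs eq
  show "length us = length vs" using type_equiv_length[OF 1] .
  show "us ! i = us ! j \<longleftrightarrow> vs ! i = vs ! j" if "i < length us" "j < length us" for i j
    using type_equiv_eq[OF 1 that] .
  show "s (map ((!) us) is) = s (map ((!) vs) is)" if "set is \<subseteq> {..<length us}" for "is"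
    using type_equiv_sub[OF 1 that] .
  show "\<exists>b\<in>U0. s (us @ [a]) = s (vs @ [b])" if "a \<in> U" for a
  proof -
    obtain b where b: "b \<in> U" "s (us @ [a]) = s (vs @ [b])" using type_equiv_forth[OF 1 \<open>a \<in> U\<close>] by blast
    then show ?thesis using assms(3)[OF vs0 b(1)] by simp
  qed
  show "\<exists>a\<in>U. s (us @ [a]) = s (vs @ [b])" if "b \<in> U0" for b
    using type_equiv_back[OF 1 subsetD[OF assms(2) that]] .
qed simp

text \<open>Downward Loewenheim-Skolem for typings. Types are natural numbers, so one Skolem
  function \<open>w j\<close> for each type \<open>j\<close> makes a countable family, and the
  closure under it passes the Tarski-Vaught test.\<close>

lemma type_equiv_submodel:
  fixes B :: "'b set"
  assumes "type_equiv U s U s" "X \<subseteq> U" "X \<noteq> {}" "infinite B" "|X| \<le>o |B|"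
  obtains Y where "X \<subseteq> Y" "Y \<subseteq> U" "|Y| \<le>o |B|" "type_equiv U s Y s"
proof -
  obtain u where u: "u \<in> U" using assms(2,3) by blast
  define w where "w j us = (if \<exists>a\<in>U. s (us @ [a]) = j then SOME a. a \<in> U \<and> s (us @ [a]) = j else u)"
    for j us
  have w: "w j us \<in> U" "a \<in> U \<Longrightarrow> s (us @ [a]) = j \<Longrightarrow> s (us @ [w j us]) = j" for j us a
    unfolding w_def using u someI_ex[of "\<lambda>a. a \<in> U \<and> s (us @ [a]) = j"] by auto
  have cw: "countable (range w)" by simp
  have cl: "closed_under (range w) U" using w(1) by (auto simp: closed_under_def)
  obtain Y where Y: "X \<subseteq> Y" "Y \<subseteq> U" "closed_under (range w) Y" "|Y| \<le>o |B|"
    by (rule closure_exists[OF cw assms(2) cl assms(4,5)])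
  have "\<exists>b\<in>Y. s (us @ [a]) = s (us @ [b])" if "set us \<subseteq> Y" "a \<in> U" for us a
  proof
    show "w (s (us @ [a])) us \<in> Y" using Y(3) that(1) by (auto simp: closed_under_def)
    show "s (us @ [a]) = s (us @ [w (s (us @ [a])) us])" using w(2)[OF that(2) refl] by simp
  qed
  then show ?thesis by (rule that[OF Y(1,2,4) type_equiv_closed_subset[OF assms(1) Y(2)]])
qed

text \<open>The last condition says that \<open>s\<close> identifies no more tuples than the equivalence generated by \<open>S\<close>.\<close>

definition typing_of :: "'a set \<Rightarrow> ('a list \<Rightarrow> 'a list \<Rightarrow> bool) \<Rightarrow> ('a list \<Rightarrow> nat) \<Rightarrow> bool" where
  "typing_of U S s \<longleftrightarrow> type_equiv U s U s \<and>
    (\<forall>us vs. set us \<subseteq> U \<longrightarrow> set vs \<subseteq> U \<longrightarrow> S us vs \<longrightarrow> s us = s vs) \<and>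
    (\<forall>P. (\<forall>us vs. set us \<subseteq> U \<longrightarrow> set vs \<subseteq> U \<longrightarrow> S us vs \<longrightarrow> P us \<longrightarrow> P vs) \<longrightarrow>
       (\<forall>us vs. set us \<subseteq> U \<longrightarrow> set vs \<subseteq> U \<longrightarrow> s us = s vs \<longrightarrow> P us \<longrightarrow> P vs))"

lemma typing_of_type_equiv: "typing_of U S s \<Longrightarrow> type_equiv U s U s"
  by (simp add: typing_of_def)

lemma typing_of_invariant:
  assumes "typing_of U S s" "set us \<subseteq> U" "set vs \<subseteq> U" "s us = s vs" "P us"
    and "\<And>us vs. set us \<subseteq> U \<Longrightarrow> set vs \<subseteq> U \<Longrightarrow> S us vs \<Longrightarrow> P us \<Longrightarrow> P vs"
  shows "P vs"
proof -
  have "\<forall>us vs. set us \<subseteq> U \<longrightarrow> set vs \<subseteq> U \<longrightarrow> S us vs \<longrightarrow> P us \<longrightarrow> P vs"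
    using assms(6) by blast
  with assms(1)[unfolded typing_of_def, THEN conjunct2, THEN conjunct2, THEN spec[of _ P]]
  have "\<forall>us vs. set us \<subseteq> U \<longrightarrow> set vs \<subseteq> U \<longrightarrow> s us = s vs \<longrightarrow> P us \<longrightarrow> P vs" by (rule mp)
  with assms(2-5) show ?thesis by blast
qed

text \<open>\<open>S\<close> need not be transitive, so the types are the classes of its transitive
  closure, and each clause is passed along a chain of \<open>S\<close>-steps. The hypothesis on
  \<open>code\<close> says that a labelling by natural numbers refines \<open>S\<close>, which
  leaves only countably many classes.\<close>

lemma typing_exists:
  fixes S :: "'a list \<Rightarrow> 'a list \<Rightarrow> bool" and code :: "'a list \<Rightarrow> nat"
  assumes len: "\<And>us vs. set us \<subseteq> U \<Longrightarrow> set vs \<subseteq> U \<Longrightarrow> S us vs \<Longrightarrow> length us = length vs"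
    and sym: "\<And>us vs. set us \<subseteq> U \<Longrightarrow> set vs \<subseteq> U \<Longrightarrow> S us vs \<Longrightarrow> S vs us"
    and eq: "\<And>us vs i j. set us \<subseteq> U \<Longrightarrow> set vs \<subseteq> U \<Longrightarrow> S us vs \<Longrightarrow>
       i < length us \<Longrightarrow> j < length us \<Longrightarrow> us ! i = us ! j \<longleftrightarrow> vs ! i = vs ! j"
    and sub: "\<And>us vs is. set us \<subseteq> U \<Longrightarrow> set vs \<subseteq> U \<Longrightarrow> S us vs \<Longrightarrow>
       set is \<subseteq> {..<length us} \<Longrightarrow> S (map ((!) us) is) (map ((!) vs) is)"
    and ext: "\<And>us vs a. set us \<subseteq> U \<Longrightarrow> set vs \<subseteq> U \<Longrightarrow> S us vs \<Longrightarrow> a \<in> U \<Longrightarrow>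
       \<exists>b\<in>U. S (us @ [a]) (vs @ [b])"
    and code: "\<And>us vs. set us \<subseteq> U \<Longrightarrow> set vs \<subseteq> U \<Longrightarrow> code us = code vs \<Longrightarrow> S us vs"
  shows "\<exists>s. typing_of U S s"
proof -
  define R where "R = (\<lambda>us vs. set us \<subseteq> U \<and> set vs \<subseteq> U \<and> S us vs)"
  \<comment> \<open>A class is numbered by the least label occurring in it. Two classes with a
    common label coincide, because the tuples carrying that label are
    \<open>S\<close>-related.\<close>
  define s where "s us = (LEAST n. \<exists>ws. R\<^sup>*\<^sup>* us ws \<and> code ws = n)" for us
  have Rsym: "R\<^sup>*\<^sup>* vs us" if "R\<^sup>*\<^sup>* us vs" for us vs
    using that
  proof (induction rule: rtranclp_induct)
    case (step y z)
    then have "R z y" using sym by (auto simp: R_def)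
    then show ?case using step.IH by (rule converse_rtranclp_into_rtranclp)
  qed simp
  have RU: "set vs \<subseteq> U" if "R\<^sup>*\<^sup>* us vs" "set us \<subseteq> U" for us vs
    using that by (induction rule: rtranclp_induct) (auto simp: R_def)
  have s_eq: "s us = s vs" if "R\<^sup>*\<^sup>* us vs" for us vs
  proof -
    have "R\<^sup>*\<^sup>* us ws \<longleftrightarrow> R\<^sup>*\<^sup>* vs ws" for ws
      using that Rsym[OF that] rtranclp_trans[of R] by blast
    then show ?thesis by (simp add: s_def)
  qed
  have s_imp: "R\<^sup>*\<^sup>* us vs" if "set us \<subseteq> U" "set vs \<subseteq> U" "s us = s vs" for us vs
  proof -
    have "\<exists>ws. R\<^sup>*\<^sup>* us ws \<and> code ws = s us" for us
      unfolding s_def by (rule LeastI_ex) blast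
    then obtain ws ws' where 1: "R\<^sup>*\<^sup>* us ws" "R\<^sup>*\<^sup>* vs ws'" "code ws = s us" "code ws' = s vs"
      by meson
    have "set ws \<subseteq> U" "set ws' \<subseteq> U" using RU[OF 1(1) that(1)] RU[OF 1(2) that(2)] .
    moreover from this have "S ws ws'" using code[of ws ws'] 1(3,4) that(3) by simp
    ultimately have "R ws ws'" by (simp add: R_def)
    then have "R\<^sup>*\<^sup>* us ws'" using 1(1) by simp
    then show ?thesis by (rule rtranclp_trans[OF _ Rsym[OF 1(2)]])
  qed
  have step: "length us = length vs \<and> (\<forall>i<length us. \<forall>j<length us. us ! i = us ! j \<longleftrightarrow> vs ! i = vs ! j) \<and>
      (\<forall>is. set is \<subseteq> {..<length us} \<longrightarrow> R\<^sup>*\<^sup>* (map ((!) us) is) (map ((!) vs) is)) \<and>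
      (\<forall>a\<in>U. \<exists>b\<in>U. R\<^sup>*\<^sup>* (us @ [a]) (vs @ [b]))"
    if "R\<^sup>*\<^sup>* us vs" for us vs
    using that
  proof (induction rule: rtranclp_induct)
    case (step ys zs)
    then have yz: "set ys \<subseteq> U" "set zs \<subseteq> U" "S ys zs" by (auto simp: R_def)
    have l: "length ys = length zs" using len[OF yz] .
    have e: "ys ! i = ys ! j \<longleftrightarrow> zs ! i = zs ! j" if "i < length us" "j < length us" for i j
      using eq[OF yz] that step.IH by simp
    have b: "R\<^sup>*\<^sup>* (map ((!) us) is) (map ((!) zs) is)" if "set is \<subseteq> {..<length us}" for "is"
    proof -
      have "R (map ((!) ys) is) (map ((!) zs) is)"
        using sub[OF yz, of "is"] that yz step.IH l unfolding R_def by (force simp: subset_iff)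
      moreover have "R\<^sup>*\<^sup>* (map ((!) us) is) (map ((!) ys) is)" using step.IH that by blast
      ultimately show ?thesis by simp
    qed
    have x: "\<exists>b\<in>U. R\<^sup>*\<^sup>* (us @ [a]) (zs @ [b])" if "a \<in> U" for a
    proof -
      obtain b where "b \<in> U" "R\<^sup>*\<^sup>* (us @ [a]) (ys @ [b])" using step.IH \<open>a \<in> U\<close> by blast
      moreover from ext[OF yz this(1)] obtain c where "c \<in> U" "S (ys @ [b]) (zs @ [c])" by blast
      ultimately have "R (ys @ [b]) (zs @ [c])" using yz by (simp add: R_def)
      with \<open>R\<^sup>*\<^sup>* (us @ [a]) (ys @ [b])\<close> have "R\<^sup>*\<^sup>* (us @ [a]) (zs @ [c])" by simp
      with \<open>c \<in> U\<close> show ?thesis by blast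
    qed
    show ?case using step.IH l e b x by auto
  qed auto
  have te: "type_equiv U s U s"
  proof (rule type_equivI)
    fix us vs assume *: "set us \<subseteq> U" "set vs \<subseteq> U" "s us = s vs"
    note st = step[OF s_imp[OF *]]
    show "length us = length vs" using st by blast
    show "us ! i = us ! j \<longleftrightarrow> vs ! i = vs ! j" if "i < length us" "j < length us" for i j
      using st that by blast
    show "s (map ((!) us) is) = s (map ((!) vs) is)" if "set is \<subseteq> {..<length us}" for "is"
      using st that s_eq by blast
    show "\<exists>b\<in>U. s (us @ [a]) = s (vs @ [b])" if "a \<in> U" for a
      using st that s_eq by blast
    show "\<exists>a\<in>U. s (us @ [a]) = s (vs @ [b])" if "b \<in> U" for b
    proof -
      note st' = step[OF s_imp[OF *(2,1) *(3)[symmetric]]]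
      then obtain a where a: "a \<in> U" "R\<^sup>*\<^sup>* (vs @ [b]) (us @ [a])" using \<open>b \<in> U\<close> by blast
      show ?thesis using a(1) s_eq[OF a(2)] by (intro bexI[of _ a]) simp
    qed
  qed simp
  have "s us = s vs" if "set us \<subseteq> U" "set vs \<subseteq> U" "S us vs" for us vs
    by (rule s_eq) (use that in \<open>auto simp: R_def\<close>)
  moreover have "P vs"
    if P: "\<forall>us vs. set us \<subseteq> U \<longrightarrow> set vs \<subseteq> U \<longrightarrow> S us vs \<longrightarrow> P us \<longrightarrow> P vs"
      and "set us \<subseteq> U" "set vs \<subseteq> U" "s us = s vs" "P us" for P us vs
    using s_imp[OF that(2-4)] that(5)
    by (induction rule: rtranclp_induct) (use P in \<open>auto simp: R_def\<close>)
  ultimately show ?thesis using te unfolding typing_of_def by blast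
qed

definition zips :: "'a set \<Rightarrow> ('a list \<Rightarrow> nat) \<Rightarrow> 'b set \<Rightarrow> ('b list \<Rightarrow> nat) \<Rightarrow> ('a \<times> 'b) set set" where
  "zips U s V t = {set (zip us vs) | us vs. set us \<subseteq> U \<and> set vs \<subseteq> V \<and> s us = t vs}"

lemma zips_nonempty: "type_equiv U s V t \<Longrightarrow> zips U s V t \<noteq> {}"
  using type_equiv_Nil[of U s V t] unfolding zips_def by (auto intro!: exI[of _ "[]"])

lemma back_forth_zips:
  assumes te: "type_equiv U s V t" and "universe M = U" "universe N = V"
    and rel: "\<And>R us vs. rel_arity L R = Some (length us) \<Longrightarrow> set us \<subseteq> U \<Longrightarrow> set vs \<subseteq> V \<Longrightarrow>
       s us = t vs \<Longrightarrow> rel_interp M R us \<longleftrightarrow> rel_interp N R vs"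
    and func: "\<And>f us vs a b. fun_arity L f = Some (length us) \<Longrightarrow> set us \<subseteq> U \<Longrightarrow> set vs \<subseteq> V \<Longrightarrow>
       a \<in> U \<Longrightarrow> b \<in> V \<Longrightarrow> s (us @ [a]) = t (vs @ [b]) \<Longrightarrow>
       fun_interp M f us = a \<longleftrightarrow> fun_interp N f vs = b"
  shows "back_forth L M N (zips U s V t)"
  unfolding back_forth_def assms(2,3)
proof (intro conjI ballI)
  fix p assume "p \<in> zips U s V t"
  then obtain us vs where p: "p = set (zip us vs)" and *: "set us \<subseteq> U" "set vs \<subseteq> V" "s us = t vs"
    by (auto simp: zips_def)
  have len: "length us = length vs" using type_equiv_length[OF te *] .
  show pUV: "p \<subseteq> U \<times> V" using p * by (auto dest: set_zip_leftD set_zip_rightD)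
  have zp: "s (map fst ps) = t (map snd ps)" if "set ps \<subseteq> p" for ps
    using type_equiv_zip[OF te *] that p by blast
  have psU: "set (map fst ps) \<subseteq> U" "set (map snd ps) \<subseteq> V" if "set ps \<subseteq> p" for ps
    using that pUV by auto
  show "\<exists>b. \<exists>p'\<in>zips U s V t. insert (a, b) p \<subseteq> p'" if "a \<in> U" for a
  proof -
    obtain b where b: "b \<in> V" "s (us @ [a]) = t (vs @ [b])"
      using type_equiv_forth[OF te * \<open>a \<in> U\<close>] by blast
    have "set (zip (us @ [a]) (vs @ [b])) \<in> zips U s V t"
      unfolding zips_def using b \<open>a \<in> U\<close> * by fastforce
    moreover have "insert (a, b) p \<subseteq> set (zip (us @ [a]) (vs @ [b]))" using p len by simp
    ultimately show ?thesis by blast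
  qed
  show "\<exists>a. \<exists>p'\<in>zips U s V t. insert (a, b) p \<subseteq> p'" if "b \<in> V" for b
  proof -
    obtain a where a: "a \<in> U" "s (us @ [a]) = t (vs @ [b])"
      using type_equiv_back[OF te * \<open>b \<in> V\<close>] by blast
    have "set (zip (us @ [a]) (vs @ [b])) \<in> zips U s V t"
      unfolding zips_def using a \<open>b \<in> V\<close> * by fastforce
    moreover have "insert (a, b) p \<subseteq> set (zip (us @ [a]) (vs @ [b]))" using p len by simp
    ultimately show ?thesis by blast
  qed
  show "\<forall>a b a' b'. (a, b) \<in> p \<longrightarrow> (a', b') \<in> p \<longrightarrow> (a = a') = (b = b')"
  proof (intro allI impI)
    fix a b a' b' assume ab: "(a, b) \<in> p" "(a', b') \<in> p"
    show "(a = a') = (b = b')"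
      using type_equiv_eq[OF te psU zp, of "[(a, b), (a', b')]" 0 1] ab by simp
  qed
  show "\<forall>R ps. rel_arity L R = Some (length ps) \<longrightarrow> set ps \<subseteq> p \<longrightarrow>
      rel_interp M R (map fst ps) = rel_interp N R (map snd ps)"
    using rel psU zp by simp
  show "\<forall>f ps a b. fun_arity L f = Some (length ps) \<longrightarrow> set ps \<subseteq> p \<longrightarrow> (a, b) \<in> p \<longrightarrow>
      (fun_interp M f (map fst ps) = a) = (fun_interp N f (map snd ps) = b)"
  proof (intro allI impI)
    fix f ps a b
    assume f: "fun_arity L f = Some (length ps)" "set ps \<subseteq> p" "(a, b) \<in> p"
    have "s (map fst ps @ [a]) = t (map snd ps @ [b])" using zp[of "ps @ [(a, b)]"] f by simp
    then show "(fun_interp M f (map fst ps) = a) = (fun_interp N f (map snd ps) = b)"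
      using func[of f "map fst ps" "map snd ps" a b] f psU[OF f(2)] pUV by auto
  qed
qed

section \<open>The Scott sentence of a typing\<close>

primrec foralls :: "nat \<Rightarrow> form \<Rightarrow> form" where
  "foralls 0 \<psi> = \<psi>"
| "foralls (Suc n) \<psi> = foralls n (Neg (Ex n (Neg \<psi>)))"

definition atom :: "nat \<Rightarrow> nat list \<Rightarrow> form" where
  "atom i ks = Rel i (map Var ks)"

definition imp :: "form \<Rightarrow> form \<Rightarrow> form" where
  "imp \<phi> \<psi> = Neg (Conj (\<lambda>k. if k = 0 then \<phi> else Neg \<psi>))"

definition eq_lit :: "bool \<Rightarrow> nat \<Rightarrow> nat \<Rightarrow> form" where
  "eq_lit P a b = (if P then Eq (Var a) (Var b) else Neg (Eq (Var a) (Var b)))"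

definition conj :: "form set \<Rightarrow> form" where
  "conj \<Phi> = Conj (from_nat_into \<Phi>)"

definition disj :: "form set \<Rightarrow> form" where
  "disj \<Phi> = Neg (Conj (\<lambda>k. Neg (from_nat_into \<Phi> k)))"

lemma from_nat_into_all: "countable \<Phi> \<Longrightarrow> \<Phi> \<noteq> {} \<Longrightarrow> (\<forall>k. P (from_nat_into \<Phi> k)) \<longleftrightarrow> (\<forall>\<psi>\<in>\<Phi>. P \<psi>)"
  by (metis from_nat_into from_nat_into_surj)

lemma sat_imp [simp]: "sat M (imp \<phi> \<psi>) v \<longleftrightarrow> (sat M \<phi> v \<longrightarrow> sat M \<psi> v)"
proof -
  have "(\<forall>k :: nat. sat M (if k = 0 then \<phi> else Neg \<psi>) v) \<longleftrightarrow> sat M \<phi> v \<and> \<not> sat M \<psi> v"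
    (is "?L \<longleftrightarrow> ?R")
  proof
    assume h: ?L
    from spec[OF h, of 0] spec[OF h, of 1] show ?R by simp
  qed simp
  then show ?thesis unfolding imp_def by simp
qed

lemma sat_conj: "countable \<Phi> \<Longrightarrow> \<Phi> \<noteq> {} \<Longrightarrow> sat M (conj \<Phi>) v \<longleftrightarrow> (\<forall>\<psi>\<in>\<Phi>. sat M \<psi> v)"
  unfolding conj_def by (simp add: from_nat_into_all[where P = "\<lambda>\<psi>. sat M \<psi> v"])

lemma sat_disj: "countable \<Phi> \<Longrightarrow> \<Phi> \<noteq> {} \<Longrightarrow> sat M (disj \<Phi>) v \<longleftrightarrow> (\<exists>\<psi>\<in>\<Phi>. sat M \<psi> v)"
  unfolding disj_def using from_nat_into_all[where P = "\<lambda>\<psi>. \<not> sat M \<psi> v"] by simp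

lemma free_vars_foralls [simp]: "free_vars (foralls n \<psi>) = free_vars \<psi> - {..<n}"
  by (induction n arbitrary: \<psi>) auto

lemma free_vars_atom [simp]: "free_vars (atom i ks) = set ks"
  by (auto simp: atom_def)

lemma free_vars_imp [simp]: "free_vars (imp \<phi> \<psi>) = free_vars \<phi> \<union> free_vars \<psi>"
  by (auto simp: imp_def split: if_splits)

lemma free_vars_eq_lit [simp]: "free_vars (eq_lit P a b) = {a, b}"
  by (auto simp: eq_lit_def)

lemma free_vars_conj: "countable \<Phi> \<Longrightarrow> \<Phi> \<noteq> {} \<Longrightarrow> free_vars (conj \<Phi>) = (\<Union>\<psi>\<in>\<Phi>. free_vars \<psi>)"
  unfolding conj_def free_vars.simps by (metis image_image range_from_nat_into)

lemma free_vars_disj: "countable \<Phi> \<Longrightarrow> \<Phi> \<noteq> {} \<Longrightarrow> free_vars (disj \<Phi>) = (\<Union>\<psi>\<in>\<Phi>. free_vars \<psi>)"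
  unfolding disj_def free_vars.simps by (metis image_image range_from_nat_into)

lemma form_of_language_foralls [simp]: "form_of_language L (foralls n \<psi>) \<longleftrightarrow> form_of_language L \<psi>"
  by (induction n arbitrary: \<psi>) auto

lemma form_of_language_atom [simp]:
  "form_of_language L (atom i ks) \<longleftrightarrow> rel_arity L i = Some (length ks)"
  by (auto simp: atom_def list_all_iff)

lemma form_of_language_imp [simp]:
  "form_of_language L (imp \<phi> \<psi>) \<longleftrightarrow> form_of_language L \<phi> \<and> form_of_language L \<psi>"
  by (auto simp: imp_def split: if_splits dest: spec[of _ 0] spec[of _ "Suc 0"])

lemma form_of_language_eq_lit [simp]: "form_of_language L (eq_lit P a b)"
  by (auto simp: eq_lit_def)

lemma form_of_language_conj:
  "countable \<Phi> \<Longrightarrow> \<Phi> \<noteq> {} \<Longrightarrow> form_of_language L (conj \<Phi>) \<longleftrightarrow> (\<forall>\<psi>\<in>\<Phi>. form_of_language L \<psi>)"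
  unfolding conj_def by (simp add: from_nat_into_all[where P = "form_of_language L"])

lemma form_of_language_disj:
  "countable \<Phi> \<Longrightarrow> \<Phi> \<noteq> {} \<Longrightarrow> form_of_language L (disj \<Phi>) \<longleftrightarrow> (\<forall>\<psi>\<in>\<Phi>. form_of_language L \<psi>)"
  unfolding disj_def by (simp add: from_nat_into_all[where P = "form_of_language L"])

definition asg :: "'a list \<Rightarrow> (nat \<Rightarrow> 'a) \<Rightarrow> nat \<Rightarrow> 'a" where
  "asg as v k = (if k < length as then as ! k else v k)"

lemma sat_foralls: "sat M (foralls n \<psi>) v \<longleftrightarrow>
  (\<forall>as. length as = n \<longrightarrow> set as \<subseteq> universe M \<longrightarrow> sat M \<psi> (asg as v))"
proof (induction n arbitrary: \<psi>)
  case 0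
  have "asg [] v = v" by (auto simp: asg_def)
  then show ?case by simp
next
  case (Suc n)
  have asg: "(asg as v)(length as := a) = asg (as @ [a]) v" for as a
    by (auto simp: asg_def nth_append)
  have ex: "(\<exists>a as. length as = n \<and> as' = as @ [a]) \<longleftrightarrow> length as' = Suc n" for as' :: "'a list"
    by (cases as' rule: rev_cases) auto
  have "sat M (foralls (Suc n) \<psi>) v \<longleftrightarrow> (\<forall>as a. length as = n \<longrightarrow> set as \<subseteq> universe M \<longrightarrow>
      a \<in> universe M \<longrightarrow> sat M \<psi> (asg (as @ [a]) v))"
    unfolding foralls.simps Suc by (auto simp: asg)
  also have "\<dots> \<longleftrightarrow> (\<forall>as'. length as' = Suc n \<longrightarrow> set as' \<subseteq> universe M \<longrightarrow> sat M \<psi> (asg as' v))"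
    unfolding ex[symmetric] by auto
  finally show ?case .
qed

lemma sat_atom: "set ks \<subseteq> {..<length as} \<Longrightarrow> sat M (atom i ks) (asg as v) \<longleftrightarrow> rel_interp M i (map ((!) as) ks)"
proof -
  assume "set ks \<subseteq> {..<length as}"
  then have "map (eval_term M (asg as v)) (map Var ks) = map ((!) as) ks"
    by (auto simp: asg_def)
  then show ?thesis unfolding atom_def by (simp only: sat.simps)
qed

lemma sat_atom_all: "sat M (atom i [0..<length as]) (asg as v) \<longleftrightarrow> rel_interp M i as"
  by (subst sat_atom) (auto simp: map_nth)

lemma sat_ex_atom: "sat M (Ex (length as) (atom i [0..<Suc (length as)])) (asg as v) \<longleftrightarrow>
  (\<exists>a\<in>universe M. rel_interp M i (as @ [a]))"
proof -
  have "(asg as v)(length as := a) = asg (as @ [a]) v" for a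
    by (auto simp: asg_def nth_append)
  then show ?thesis using sat_atom_all[of M i "as @ [_]" v] by (simp del: upt_Suc)
qed

context
  fixes U :: "'a set" and s :: "'a list \<Rightarrow> nat"
begin

definition types :: "nat set" where "types = s ` {us. set us \<subseteq> U}"

definition rep :: "nat \<Rightarrow> 'a list" where "rep i = (SOME us. set us \<subseteq> U \<and> s us = i)"

definition ar :: "nat \<Rightarrow> nat" where "ar i = length (rep i)"

definition scott_lang :: language where
  "scott_lang = \<lparr>fun_arity = \<lambda>_. None, rel_arity = \<lambda>i. if i \<in> types then Some (ar i) else None\<rparr>"

definition scott_total :: "nat \<Rightarrow> form" where
  "scott_total n = foralls n (disj ((\<lambda>i. atom i [0..<n]) ` {i \<in> types. ar i = n}))"

text \<open>Only the forth property is stated. The back property follows: an extended tuple has some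
  type by \<open>scott_total\<close>, and the clauses on subtuples tell which type its initial part
  has. The bound variable \<open>ar i\<close> is the first one not occupied by the tuple.\<close>

definition scott_implications :: "(nat \<times> form) set" where
  "scott_implications =
     {(i, Neg (atom j [0..<ar i])) | i j. i \<in> types \<and> j \<in> types \<and> ar j = ar i \<and> i \<noteq> j} \<union>
     {(i, eq_lit (rep i ! a = rep i ! b) a b) | i a b.
        i \<in> types \<and> a < ar i \<and> b < ar i} \<union>
     {(i, atom (s (map ((!) (rep i)) ks)) ks) | i ks. i \<in> types \<and> set ks \<subseteq> {..<ar i}} \<union>
     {(i, Ex (ar i) (atom j [0..<Suc (ar i)])) | i j. i \<in> types \<and> (\<exists>a\<in>U. s (rep i @ [a]) = j)}"

definition scott_clauses :: "form set" where
  "scott_clauses = range scott_total \<union>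
     (\<lambda>(i, \<psi>). foralls (ar i) (imp (atom i [0..<ar i]) \<psi>)) ` scott_implications"

definition scott_sentence :: form where "scott_sentence = conj scott_clauses"

lemma countable_scott_clauses: "countable scott_clauses" "scott_clauses \<noteq> {}"
proof -
  have "countable {(i, Neg (atom j [0..<ar i])) | i j. i \<in> types \<and> j \<in> types \<and> ar j = ar i \<and> i \<noteq> j}"
    by (rule countable_subset[of _ "range (\<lambda>(i, j). (i, Neg (atom j [0..<ar i])))"]) auto
  moreover have "countable {(i, eq_lit (rep i ! a = rep i ! b) a b) | i a b.
        i \<in> types \<and> a < ar i \<and> b < ar i}"
    by (rule countable_subset[of _ "\<Union>i a b. {(i, eq_lit (rep i ! a = rep i ! b) a b)}"])
       auto
  moreover have "countable {(i, atom (s (map ((!) (rep i)) ks)) ks) | i ks. i \<in> types \<and> set ks \<subseteq> {..<ar i}}"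
    by (rule countable_subset[of _ "range (\<lambda>(i, ks). (i, atom (s (map ((!) (rep i)) ks)) ks))"]) auto
  moreover have "countable {(i, Ex (ar i) (atom j [0..<Suc (ar i)])) | i j. i \<in> types \<and> (\<exists>a\<in>U. s (rep i @ [a]) = j)}"
    by (rule countable_subset[of _ "range (\<lambda>(i, j). (i, Ex (ar i) (atom j [0..<Suc (ar i)])))"]) auto
  ultimately have "countable scott_implications" unfolding scott_implications_def by simp
  then show "countable scott_clauses" unfolding scott_clauses_def by simp
  show "scott_clauses \<noteq> {}" unfolding scott_clauses_def by simp
qed

context
  assumes te: "type_equiv U s U s" and ne: "U \<noteq> {}"
begin

lemma rep: "i \<in> types \<Longrightarrow> set (rep i) \<subseteq> U" "i \<in> types \<Longrightarrow> s (rep i) = i"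
  unfolding types_def rep_def using someI_ex[of "\<lambda>us. set us \<subseteq> U \<and> s us = i"] by auto

lemma typesI: "set us \<subseteq> U \<Longrightarrow> s us \<in> types"
  by (auto simp: types_def)

lemma ar: "set us \<subseteq> U \<Longrightarrow> ar (s us) = length us"
  unfolding ar_def using type_equiv_length[OF te rep(1) _ rep(2)] typesI by simp

lemma rel_arity_scott_lang: "i \<in> types \<Longrightarrow> rel_arity scott_lang i = Some (ar i)"
  by (simp add: scott_lang_def)

lemma types_of_length: "\<exists>i\<in>types. ar i = n"
proof -
  obtain u where "u \<in> U" using ne by blast
  then have "set (replicate n u) \<subseteq> U" by auto
  then show ?thesis using ar typesI by (metis length_replicate)
qed

lemma is_sentence_scott_sentence: "is_sentence scott_lang scott_sentence"
proof -
  have total: "form_of_language scott_lang (scott_total n) \<and> free_vars (scott_total n) = {}" for n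
  proof -
    let ?D = "(\<lambda>i. atom i [0..<n]) ` {i \<in> types. ar i = n}"
    have "countable ?D" "?D \<noteq> {}" using types_of_length[of n] by auto
    then show ?thesis unfolding scott_total_def
      by (auto simp: form_of_language_disj free_vars_disj rel_arity_scott_lang)
  qed
  have impl: "i \<in> types \<and> form_of_language scott_lang \<psi> \<and> free_vars \<psi> \<subseteq> {..<ar i}"
    if "(i, \<psi>) \<in> scott_implications" for i \<psi>
  proof -
    consider j where "i \<in> types" "j \<in> types" "ar j = ar i" "\<psi> = Neg (atom j [0..<ar i])"
      | a b where "i \<in> types" "a < ar i" "b < ar i"
          "\<psi> = eq_lit (rep i ! a = rep i ! b) a b"
      | ks where "i \<in> types" "set ks \<subseteq> {..<ar i}" "\<psi> = atom (s (map ((!) (rep i)) ks)) ks"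
      | a where "i \<in> types" "a \<in> U" "\<psi> = Ex (ar i) (atom (s (rep i @ [a])) [0..<Suc (ar i)])"
      using \<open>(i, \<psi>) \<in> scott_implications\<close> unfolding scott_implications_def by blast
    then show ?thesis
    proof cases
      case 3
      have "set (map ((!) (rep i)) ks) \<subseteq> set (rep i)" using 3 by (force simp: ar_def)
      then have *: "set (map ((!) (rep i)) ks) \<subseteq> U" using rep(1)[OF 3(1)] by blast
      then show ?thesis using 3 ar[OF *] rel_arity_scott_lang[OF typesI[OF *]] by simp
    next
      case 4
      have *: "set (rep i @ [a]) \<subseteq> U" using rep(1)[OF 4(1)] 4(2) by simp
      show ?thesis using 4 ar[OF *] rel_arity_scott_lang[OF typesI[OF *]] by (auto simp: ar_def)
    qed (auto simp: rel_arity_scott_lang)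
  qed
  have "form_of_language scott_lang \<psi> \<and> free_vars \<psi> = {}" if "\<psi> \<in> scott_clauses" for \<psi>
    using that total impl unfolding scott_clauses_def
    by (force simp: rel_arity_scott_lang split: prod.splits)
  then show ?thesis unfolding is_sentence_def scott_sentence_def
    using form_of_language_conj[OF countable_scott_clauses] free_vars_conj[OF countable_scott_clauses]
    by simp
qed

lemma models_scott_sentence_iff:
  assumes "universe M \<noteq> {}"
  shows "models M scott_sentence \<longleftrightarrow>
    (\<forall>vs. set vs \<subseteq> universe M \<longrightarrow> (\<exists>i\<in>types. ar i = length vs \<and> rel_interp M i vs)) \<and>
    (\<forall>i\<in>types. \<forall>vs. length vs = ar i \<longrightarrow> set vs \<subseteq> universe M \<longrightarrow> rel_interp M i vs \<longrightarrow>
      (\<forall>j\<in>types. ar j = ar i \<longrightarrow> rel_interp M j vs \<longrightarrow> i = j) \<and>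
      (\<forall>a<ar i. \<forall>b<ar i. rep i ! a = rep i ! b \<longleftrightarrow> vs ! a = vs ! b) \<and>
      (\<forall>ks. set ks \<subseteq> {..<ar i} \<longrightarrow> rel_interp M (s (map ((!) (rep i)) ks)) (map ((!) vs) ks)) \<and>
      (\<forall>a\<in>U. \<exists>b\<in>universe M. rel_interp M (s (rep i @ [a])) (vs @ [b])))"
    (is "_ \<longleftrightarrow> ?T \<and> ?I")
proof -
  fix v :: "nat \<Rightarrow> 'b"
  have "sat M (scott_total n) v \<longleftrightarrow>
    (\<forall>vs. length vs = n \<longrightarrow> set vs \<subseteq> universe M \<longrightarrow> (\<exists>i\<in>types. ar i = n \<and> rel_interp M i vs))" for n
  proof -
    let ?D = "(\<lambda>i. atom i [0..<n]) ` {i \<in> types. ar i = n}"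
    have D: "countable ?D" "?D \<noteq> {}" using types_of_length[of n] by auto
    have "(\<exists>\<psi>\<in>?D. sat M \<psi> (asg vs v)) \<longleftrightarrow> (\<exists>i\<in>types. ar i = n \<and> rel_interp M i vs)"
      if "length vs = n" for vs
    proof -
      have "sat M (atom i [0..<n]) (asg vs v) \<longleftrightarrow> rel_interp M i vs" for i
        using sat_atom_all[of M i vs v] that by simp
      then show ?thesis by auto
    qed
    then show ?thesis unfolding scott_total_def sat_foralls sat_disj[OF D] by simp
  qed
  then have T: "(\<forall>n. sat M (scott_total n) v) \<longleftrightarrow> ?T" by auto
  have clause: "sat M (foralls (ar i) (imp (atom i [0..<ar i]) \<psi>)) v \<longleftrightarrow>
    (\<forall>vs. length vs = ar i \<longrightarrow> set vs \<subseteq> universe M \<longrightarrow> rel_interp M i vs \<longrightarrow> sat M \<psi> (asg vs v))" for i \<psi>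
    unfolding sat_foralls sat_imp using sat_atom_all[of M i _ v] by metis
  have eqs: "sat M (eq_lit P a b) (asg vs v) \<longleftrightarrow>
      (P \<longleftrightarrow> vs ! a = vs ! b)" if "a < length vs" "b < length vs" for P a b vs
    using that by (auto simp: asg_def eq_lit_def)
  have "(\<forall>(i, \<psi>)\<in>scott_implications. sat M (foralls (ar i) (imp (atom i [0..<ar i]) \<psi>)) v) \<longleftrightarrow>
    (\<forall>i\<in>types. \<forall>vs. length vs = ar i \<longrightarrow> set vs \<subseteq> universe M \<longrightarrow> rel_interp M i vs \<longrightarrow>
      (\<forall>j\<in>types. ar j = ar i \<longrightarrow> i \<noteq> j \<longrightarrow> sat M (Neg (atom j [0..<ar i])) (asg vs v)) \<and>
      (\<forall>a<ar i. \<forall>b<ar i. sat M (eq_lit (rep i ! a = rep i ! b) a b) (asg vs v)) \<and>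
      (\<forall>ks. set ks \<subseteq> {..<ar i} \<longrightarrow> sat M (atom (s (map ((!) (rep i)) ks)) ks) (asg vs v)) \<and>
      (\<forall>a\<in>U. sat M (Ex (ar i) (atom (s (rep i @ [a])) [0..<Suc (ar i)])) (asg vs v)))"
    unfolding clause scott_implications_def by blast
  also have "\<dots> \<longleftrightarrow> ?I"
  proof -
    have "((\<forall>j\<in>types. ar j = ar i \<longrightarrow> i \<noteq> j \<longrightarrow> sat M (Neg (atom j [0..<ar i])) (asg vs v)) \<and>
      (\<forall>a<ar i. \<forall>b<ar i. sat M (eq_lit (rep i ! a = rep i ! b) a b) (asg vs v)) \<and>
      (\<forall>ks. set ks \<subseteq> {..<ar i} \<longrightarrow> sat M (atom (s (map ((!) (rep i)) ks)) ks) (asg vs v)) \<and>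
      (\<forall>a\<in>U. sat M (Ex (ar i) (atom (s (rep i @ [a])) [0..<Suc (ar i)])) (asg vs v))) =
      ((\<forall>j\<in>types. ar j = ar i \<longrightarrow> rel_interp M j vs \<longrightarrow> i = j) \<and>
      (\<forall>a<ar i. \<forall>b<ar i. rep i ! a = rep i ! b \<longleftrightarrow> vs ! a = vs ! b) \<and>
      (\<forall>ks. set ks \<subseteq> {..<ar i} \<longrightarrow> rel_interp M (s (map ((!) (rep i)) ks)) (map ((!) vs) ks)) \<and>
      (\<forall>a\<in>U. \<exists>b\<in>universe M. rel_interp M (s (rep i @ [a])) (vs @ [b])))"
      (is "?A1 \<and> ?A2 \<and> ?A3 \<and> ?A4 \<longleftrightarrow> ?B1 \<and> ?B2 \<and> ?B3 \<and> ?B4")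
      if "length vs = ar i" for i and vs :: "'b list"
    proof -
      have ari: "ar i = length vs" using that by simp
      have "?A1 \<longleftrightarrow> ?B1" unfolding ari sat.simps sat_atom_all by blast
      moreover have "?A2 \<longleftrightarrow> ?B2" unfolding ari by (simp add: eqs)
      moreover have "?A3 \<longleftrightarrow> ?B3" unfolding ari by (simp add: sat_atom)
      moreover have "?A4 \<longleftrightarrow> ?B4" unfolding ari sat_ex_atom by blast
      ultimately show ?thesis by simp
    qed
    then show ?thesis by simp
  qed
  finally have I: "(\<forall>(i, \<psi>)\<in>scott_implications. sat M (foralls (ar i) (imp (atom i [0..<ar i]) \<psi>)) v) \<longleftrightarrow> ?I" .
  have "models M scott_sentence \<longleftrightarrow> sat M scott_sentence v"
    by (rule models_iff_sat[OF is_sentence_scott_sentence assms])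
  also have "\<dots> \<longleftrightarrow> (\<forall>n. sat M (scott_total n) v) \<and>
     (\<forall>(i, \<psi>)\<in>scott_implications. sat M (foralls (ar i) (imp (atom i [0..<ar i]) \<psi>)) v)"
    unfolding scott_sentence_def sat_conj[OF countable_scott_clauses]
    unfolding scott_clauses_def by auto
  finally show ?thesis unfolding T I .
qed

text \<open>In a model every tuple satisfies exactly one of the relations of its length, by
  \<open>scott_total\<close> and the clauses that separate types; the index of this relation is its
  type.\<close>

lemma scott_model_typing:
  assumes "universe M \<noteq> {}" "models M scott_sentence"
  obtains t where "type_equiv U s (universe M) t"
    "\<forall>i vs. i \<in> types \<longrightarrow> length vs = ar i \<longrightarrow> set vs \<subseteq> universe M \<longrightarrow> (rel_interp M i vs \<longleftrightarrow> t vs = i)"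
proof -
  let ?V = "universe M"
  note sem = assms(2)[unfolded models_scott_sentence_iff[OF assms(1)]]
  define t where "t vs = (SOME i. i \<in> types \<and> ar i = length vs \<and> rel_interp M i vs)" for vs
  have t: "t vs \<in> types" "ar (t vs) = length vs" "rel_interp M (t vs) vs" if "set vs \<subseteq> ?V" for vs
    unfolding t_def using someI_ex[of "\<lambda>i. i \<in> types \<and> ar i = length vs \<and> rel_interp M i vs"] sem that
    by (metis (no_types, lifting))+
  have t_eq: "rel_interp M i vs \<longleftrightarrow> t vs = i" if "i \<in> types" "length vs = ar i" "set vs \<subseteq> ?V" for i vs
    using sem[THEN conjunct2, rule_format, of i vs] t[OF that(3)] that by auto
  have step: "(\<forall>a<length vs. \<forall>b<length vs. rep i ! a = rep i ! b \<longleftrightarrow> vs ! a = vs ! b) \<and>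
      (\<forall>ks. set ks \<subseteq> {..<length vs} \<longrightarrow> rel_interp M (s (map ((!) (rep i)) ks)) (map ((!) vs) ks)) \<and>
      (\<forall>a\<in>U. \<exists>b\<in>?V. rel_interp M (s (rep i @ [a])) (vs @ [b]))"
    if "set vs \<subseteq> ?V" "t vs = i" for i vs
    using sem[THEN conjunct2, rule_format, OF t(1)[OF that(1)] _ that(1) t(3)[OF that(1)]]
      t(2)[OF that(1)] that(2) by simp
  have sub: "s (map ((!) (rep i)) ks) = t (map ((!) vs) ks)"
    if "set vs \<subseteq> ?V" "t vs = i" "set ks \<subseteq> {..<length vs}" for i vs ks
  proof -
    have i: "i \<in> types" "ar i = length vs" using t[OF that(1)] that(2) by auto
    have "set (map ((!) (rep i)) ks) \<subseteq> set (rep i)" using that(3) i(2) by (force simp: ar_def)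
    then have 1: "set (map ((!) (rep i)) ks) \<subseteq> U" using rep(1)[OF i(1)] by blast
    have "set (map ((!) vs) ks) \<subseteq> set vs" using that(3) by force
    then have 2: "set (map ((!) vs) ks) \<subseteq> ?V" using that(1) by blast
    show ?thesis using t_eq[OF typesI[OF 1] _ 2] step[OF that(1,2)] that(3) ar[OF 1] by simp
  qed
  have te': "s us = s (rep i)" if "s us = t vs" "t vs = i" "set vs \<subseteq> ?V" for us vs i
    using rep(2) t(1)[OF that(3)] that by simp
  have "type_equiv U s ?V t"
  proof (rule type_equivI)
    have "rep (t []) = []" using t(2)[of "[]"] by (simp add: ar_def)
    then show "s [] = t []" using rep(2)[OF t(1)[of "[]"]] by simp
    fix us vs assume us: "set us \<subseteq> U" and vs: "set vs \<subseteq> ?V" and eq: "s us = t vs"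
    define i where "i = t vs"
    have i: "i \<in> types" using t(1)[OF vs] by (simp add: i_def)
    note 1 = te us rep(1)[OF i] trans[OF eq[folded i_def] rep(2)[OF i, symmetric]]
    show len: "length us = length vs" using ar[OF us] t(2)[OF vs] eq by simp
    show "us ! a = us ! b \<longleftrightarrow> vs ! a = vs ! b" if "a < length us" "b < length us" for a b
      using type_equiv_eq[OF 1 that] step[OF vs i_def[symmetric]] that len by simp
    show "s (map ((!) us) is) = t (map ((!) vs) is)" if "set is \<subseteq> {..<length us}" for "is"
      using type_equiv_sub[OF 1 that] sub[OF vs i_def[symmetric]] that len by simp
    show "\<exists>b\<in>?V. s (us @ [a]) = t (vs @ [b])" if "a \<in> U" for a
    proof -
      obtain a' where a': "a' \<in> U" "s (us @ [a]) = s (rep i @ [a'])"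
        using type_equiv_forth[OF 1 \<open>a \<in> U\<close>] by blast
      obtain b where b: "b \<in> ?V" "rel_interp M (s (rep i @ [a'])) (vs @ [b])"
        using step[OF vs i_def[symmetric]] a'(1) by blast
      have 2: "set (us @ [a]) \<subseteq> U" using us \<open>a \<in> U\<close> by simp
      have "t (vs @ [b]) = s (us @ [a])"
        using t_eq[OF typesI[OF 2], of "vs @ [b]"] ar[OF 2] b a'(2) vs len by simp
      with b(1) show ?thesis by (intro bexI[of _ b]) simp_all
    qed
    show "\<exists>a\<in>U. s (us @ [a]) = t (vs @ [b])" if "b \<in> ?V" for b
    proof -
      \<comment> \<open>The extended tuple has a type \<open>j\<close>, realized in \<open>U\<close>
        by \<open>rep j\<close>. The initial part of \<open>rep j\<close> has the type of
        \<open>us\<close>, so the forth property of \<open>U\<close> moves the last entry of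
        \<open>rep j\<close> over \<open>us\<close>.\<close>
      define j where "j = t (vs @ [b])"
      have vb: "set (vs @ [b]) \<subseteq> ?V" using vs \<open>b \<in> ?V\<close> by simp
      have j: "j \<in> types" "length (rep j) = Suc (length vs)"
        using t[OF vb] by (auto simp: j_def ar_def)
      have split: "butlast (rep j) @ [last (rep j)] = rep j"
        using j(2) by (intro append_butlast_last_id) auto
      have "s (map ((!) (rep j)) [0..<length vs]) = t (map ((!) (vs @ [b])) [0..<length vs])"
        by (rule sub[OF vb]) (auto simp: j_def)
      moreover have "map ((!) (rep j)) [0..<length vs] = butlast (rep j)"
        using j(2) by (intro nth_equalityI) (auto simp: nth_butlast)
      moreover have "map ((!) (vs @ [b])) [0..<length vs] = vs"
        by (intro nth_equalityI) (auto simp: nth_append)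
      ultimately have 2: "s (butlast (rep j)) = s us" using eq by simp
      have "set (butlast (rep j) @ [last (rep j)]) \<subseteq> U" unfolding split by (rule rep(1)[OF j(1)])
      then have 3: "set (butlast (rep j)) \<subseteq> U" "last (rep j) \<in> U" by auto
      obtain a where a: "a \<in> U" "s (butlast (rep j) @ [last (rep j)]) = s (us @ [a])"
        using type_equiv_forth[OF te 3(1) us 2 3(2)] by blast
      have "s (us @ [a]) = j" using a(2) rep(2)[OF j(1)] unfolding split by simp
      with a(1) show ?thesis unfolding j_def by blast
    qed
  qed
  moreover have "\<forall>i vs. i \<in> types \<longrightarrow> length vs = ar i \<longrightarrow> set vs \<subseteq> ?V \<longrightarrow> (rel_interp M i vs \<longleftrightarrow> t vs = i)"
    using t_eq by blast
  ultimately show ?thesis by (rule that)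
qed

definition typed_structure :: "'b set \<Rightarrow> ('b list \<Rightarrow> nat) \<Rightarrow> 'b struct" where
  "typed_structure V t = \<lparr>universe = V, fun_interp = \<lambda>_ _. undefined, rel_interp = \<lambda>i vs. t vs = i\<rparr>"

lemma is_structure_scott_lang: "is_structure scott_lang M \<longleftrightarrow> universe M \<noteq> {}"
  by (simp add: is_structure_def scott_lang_def)

lemma typed_structure_models:
  assumes V: "type_equiv U s V t" "V \<noteq> {}"
  shows "models (typed_structure V t) scott_sentence"
proof -
  have univ: "universe (typed_structure V t) = V" "rel_interp (typed_structure V t) i vs \<longleftrightarrow> t vs = i"
    for i vs by (simp_all add: typed_structure_def)
  show ?thesis
  proof (subst models_scott_sentence_iff; (unfold univ)?)
    show "V \<noteq> {}" by fact
    show "(\<forall>vs. set vs \<subseteq> V \<longrightarrow> (\<exists>i\<in>types. ar i = length vs \<and> t vs = i)) \<and>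
    (\<forall>i\<in>types. \<forall>vs. length vs = ar i \<longrightarrow> set vs \<subseteq> V \<longrightarrow> t vs = i \<longrightarrow>
      (\<forall>j\<in>types. ar j = ar i \<longrightarrow> t vs = j \<longrightarrow> i = j) \<and>
      (\<forall>a<ar i. \<forall>b<ar i. (rep i ! a = rep i ! b) = (vs ! a = vs ! b)) \<and>
      (\<forall>ks. set ks \<subseteq> {..<ar i} \<longrightarrow> t (map ((!) vs) ks) = s (map ((!) (rep i)) ks)) \<and>
      (\<forall>a\<in>U. \<exists>b\<in>V. t (vs @ [b]) = s (rep i @ [a])))"
    proof (rule conjI; intro allI ballI impI)
      fix vs assume vs: "set vs \<subseteq> V"
      obtain us where "set us \<subseteq> U" "length us = length vs" "s us = t vs"
        by (rule type_equiv_match_back[OF V(1) vs])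
      then show "\<exists>i\<in>types. ar i = length vs \<and> t vs = i" using ar typesI by metis
    next
      fix i vs assume i: "i \<in> types" and vs: "length vs = ar i" "set vs \<subseteq> V" "t vs = i"
      have "s (rep i) = t vs" using rep(2)[OF i] vs(3) by simp
      note 1 = V(1) rep(1)[OF i] vs(2) this
      show "(\<forall>j\<in>types. ar j = ar i \<longrightarrow> t vs = j \<longrightarrow> i = j) \<and>
      (\<forall>a<ar i. \<forall>b<ar i. (rep i ! a = rep i ! b) = (vs ! a = vs ! b)) \<and>
      (\<forall>ks. set ks \<subseteq> {..<ar i} \<longrightarrow> t (map ((!) vs) ks) = s (map ((!) (rep i)) ks)) \<and>
      (\<forall>a\<in>U. \<exists>b\<in>V. t (vs @ [b]) = s (rep i @ [a]))"
      proof (intro conjI allI ballI impI)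
        show "\<exists>b\<in>V. t (vs @ [b]) = s (rep i @ [a])" if "a \<in> U" for a
          using type_equiv_forth[OF 1 that] by (simp add: eq_commute)
        show "(rep i ! a = rep i ! b) = (vs ! a = vs ! b)" if "a < ar i" "b < ar i" for a b
          using type_equiv_eq[OF 1, of a b] that by (simp add: ar_def)
        show "t (map ((!) vs) ks) = s (map ((!) (rep i)) ks)" if "set ks \<subseteq> {..<ar i}" for ks
          using type_equiv_sub[OF 1, of ks] that by (simp add: ar_def)
        show "i = j" if "t vs = j" for j using that vs(3) by simp
      qed
    qed
  qed
qed

text \<open>A countable equivalent subset of \<open>U\<close> is copied to the natural numbers. Any
  other countable model carries a typing equivalent to that of \<open>U\<close>, hence to that of
  the copy, and countable equivalent typed sets are isomorphic.\<close>

lemma scott_sentence_exists: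
  "\<exists>M :: nat struct. is_structure scott_lang M \<and> is_scott_sentence scott_lang M scott_sentence"
proof -
  obtain u where u: "u \<in> U" using ne by blast
  have inf: "infinite (UNIV :: nat set)" by simp
  have "|{u}| \<le>o |UNIV :: nat set|" by (rule card_of_singl_ordLeq) simp
  then obtain Y where Y: "{u} \<subseteq> Y" "Y \<subseteq> U" "|Y| \<le>o |UNIV :: nat set|" "type_equiv U s Y s"
    using type_equiv_submodel[OF te _ _ inf, of "{u}"] u by auto
  have cY: "countable Y" using Y(3) countable_iff_ordLeq_nat by blast
  let ?N = "typed_structure Y s"
  define M where "M = copy_struct (to_nat_on Y) ?N"
  have NY: "universe ?N = Y" by (simp add: typed_structure_def)
  have N: "is_structure scott_lang ?N" "models ?N scott_sentence"
    using Y(1) NY typed_structure_models[OF Y(4)] by (auto simp: is_structure_scott_lang)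
  have "inj_on (to_nat_on Y) (universe ?N)" using inj_on_to_nat_on[OF cY] NY by simp
  note M = copy_struct[OF N(1) this, folded M_def]
  have M_models: "models M scott_sentence"
    using isomorphic_models[OF M(2) N(1) M(1) is_sentence_scott_sentence] N(2) by simp
  have "models N scott_sentence \<longleftrightarrow> isomorphic scott_lang M N"
    if N: "is_structure scott_lang N" for N :: "nat struct"
  proof
    assume "isomorphic scott_lang M N"
    then show "models N scott_sentence"
      using isomorphic_models[OF _ M(1) N is_sentence_scott_sentence] M_models by simp
  next
    assume N_models: "models N scott_sentence"
    have neM: "universe M \<noteq> {}" "universe N \<noteq> {}" using M(1) N by (auto simp: is_structure_def)
    obtain t where t: "type_equiv U s (universe M) t" "\<forall>i vs. i \<in> types \<longrightarrow> length vs = ar i \<longrightarrow>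
        set vs \<subseteq> universe M \<longrightarrow> (rel_interp M i vs \<longleftrightarrow> t vs = i)"
      by (rule scott_model_typing[OF neM(1) M_models])
    obtain t' where t': "type_equiv U s (universe N) t'" "\<forall>i vs. i \<in> types \<longrightarrow> length vs = ar i \<longrightarrow>
        set vs \<subseteq> universe N \<longrightarrow> (rel_interp N i vs \<longleftrightarrow> t' vs = i)"
      by (rule scott_model_typing[OF neM(2) N_models])
    have te': "type_equiv (universe M) t (universe N) t'"
      by (rule type_equiv_trans[OF type_equiv_sym[OF t(1)] t'(1)])
    have "back_forth scott_lang M N (zips (universe M) t (universe N) t')"
    proof (rule back_forth_zips[OF te' refl refl])
      fix R us vs
      assume R: "rel_arity scott_lang R = Some (length us)" and
        us: "set us \<subseteq> universe M" "set vs \<subseteq> universe N" "t us = t' vs"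
      have "R \<in> types" "ar R = length us" using R by (auto simp: scott_lang_def split: if_splits)
      then show "rel_interp M R us \<longleftrightarrow> rel_interp N R vs"
        using t(2)[rule_format, of R us] t'(2)[rule_format, of R vs] us type_equiv_length[OF te' us] by simp
    qed (simp add: scott_lang_def)
    then show "isomorphic scott_lang M N"
      by (rule bf_isomorphic[OF _ M(1) N zips_nonempty[OF te']]) auto
  qed
  then show ?thesis using M(1) is_sentence_scott_sentence unfolding is_scott_sentence_def by blast
qed

end

end

section \<open>Models of a Scott sentence\<close>

lemma isomorphic_sym:
  assumes "isomorphic L M N" "is_structure L M"
  shows "isomorphic L N M"
proof -
  obtain h where h: "bij_betw h (universe M) (universe N)"
     "\<And>f xs. fun_arity L f = Some (length xs) \<Longrightarrow> set xs \<subseteq> universe M \<Longrightarrow>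
        h (fun_interp M f xs) = fun_interp N f (map h xs)"
     "\<And>R xs. rel_arity L R = Some (length xs) \<Longrightarrow> set xs \<subseteq> universe M \<Longrightarrow>
        (rel_interp M R xs \<longleftrightarrow> rel_interp N R (map h xs))"
    using assms(1) unfolding isomorphic_def by blast
  let ?g = "inv_into (universe M) h"
  have g: "bij_betw ?g (universe N) (universe M)" by (rule bij_betw_inv_into[OF h(1)])
  have inj: "inj_on h (universe M)" using h(1) by (simp add: bij_betw_def)
  have ys: "map h (map ?g ys) = ys" "set (map ?g ys) \<subseteq> universe M" if "set ys \<subseteq> universe N" for ys
    using that h(1) g by (auto simp: map_idI bij_betw_def f_inv_into_f subset_iff inv_into_into)
  show ?thesis unfolding isomorphic_def
  proof (intro exI[of _ ?g] conjI allI impI g)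
    fix f xs assume f: "fun_arity L f = Some (length xs)" "set xs \<subseteq> universe N"
    have "fun_interp M f (map ?g xs) \<in> universe M"
      using assms(2) f ys(2)[OF f(2)] by (simp add: is_structure_def)
    then show "?g (fun_interp N f xs) = fun_interp M f (map ?g xs)"
      using h(2)[of f "map ?g xs"] f ys[OF f(2)] inj by (metis inv_into_f_f length_map)
  next
    fix R xs assume "rel_arity L R = Some (length xs)" "set xs \<subseteq> universe N"
    then show "rel_interp N R xs = rel_interp M R (map ?g xs)"
      using h(3)[of R "map ?g xs"] ys by simp
  qed
qed

lemma isomorphic_trans:
  assumes "isomorphic L M N" "isomorphic L N K"
  shows "isomorphic L M K"
proof -
  obtain g where g: "bij_betw g (universe M) (universe N)"
     "\<And>f xs. fun_arity L f = Some (length xs) \<Longrightarrow> set xs \<subseteq> universe M \<Longrightarrow>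
        g (fun_interp M f xs) = fun_interp N f (map g xs)"
     "\<And>R xs. rel_arity L R = Some (length xs) \<Longrightarrow> set xs \<subseteq> universe M \<Longrightarrow>
        (rel_interp M R xs \<longleftrightarrow> rel_interp N R (map g xs))"
    using assms(1) unfolding isomorphic_def by blast
  obtain h where h: "bij_betw h (universe N) (universe K)"
     "\<And>f xs. fun_arity L f = Some (length xs) \<Longrightarrow> set xs \<subseteq> universe N \<Longrightarrow>
        h (fun_interp N f xs) = fun_interp K f (map h xs)"
     "\<And>R xs. rel_arity L R = Some (length xs) \<Longrightarrow> set xs \<subseteq> universe N \<Longrightarrow>
        (rel_interp N R xs \<longleftrightarrow> rel_interp K R (map h xs))"
    using assms(2) unfolding isomorphic_def by blast
  have "set (map g xs) \<subseteq> universe N" if "set xs \<subseteq> universe M" for xs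
    using that g(1) by (auto simp: bij_betw_def)
  then show ?thesis unfolding isomorphic_def
    using bij_betw_trans[OF g(1) h(1)] g(2,3) h(2,3)
    by (intro exI[of _ "h \<circ> g"]) simp
qed

definition atomic_match :: "language \<Rightarrow> 'a struct \<Rightarrow> 'b struct \<Rightarrow> ('a \<times> 'b) set \<Rightarrow> bool" where
  "atomic_match L M N p \<longleftrightarrow>
    (\<forall>a b a' b'. (a, b) \<in> p \<longrightarrow> (a', b') \<in> p \<longrightarrow> (a = a' \<longleftrightarrow> b = b')) \<and>
    (\<forall>R ps. rel_arity L R = Some (length ps) \<longrightarrow> set ps \<subseteq> p \<longrightarrow>
       (rel_interp M R (map fst ps) \<longleftrightarrow> rel_interp N R (map snd ps))) \<and>
    (\<forall>f ps a b. fun_arity L f = Some (length ps) \<longrightarrow> set ps \<subseteq> p \<longrightarrow> (a, b) \<in> p \<longrightarrow>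
       (fun_interp M f (map fst ps) = a \<longleftrightarrow> fun_interp N f (map snd ps) = b))"

lemma atomic_match_mono:
  assumes "atomic_match L M N q" "p \<subseteq> q"
  shows "atomic_match L M N p"
  unfolding atomic_match_def
proof (intro conjI allI impI)
  show "a = a' \<longleftrightarrow> b = b'" if "(a, b) \<in> p" "(a', b') \<in> p" for a b a' b'
    using assms that unfolding atomic_match_def by blast
  show "rel_interp M R (map fst ps) \<longleftrightarrow> rel_interp N R (map snd ps)"
    if "rel_arity L R = Some (length ps)" "set ps \<subseteq> p" for R ps
    using assms(1)[unfolded atomic_match_def, THEN conjunct2, THEN conjunct1] that assms(2) by blast
  show "fun_interp M f (map fst ps) = a \<longleftrightarrow> fun_interp N f (map snd ps) = b"
    if "fun_arity L f = Some (length ps)" "set ps \<subseteq> p" "(a, b) \<in> p" for f ps a b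
    using assms(1)[unfolded atomic_match_def, THEN conjunct2, THEN conjunct2] that assms(2) by blast
qed

text \<open>Positions from which the first player wins the back-and-forth game.\<close>

inductive spoiled :: "language \<Rightarrow> 'a struct \<Rightarrow> 'b struct \<Rightarrow> ('a \<times> 'b) set \<Rightarrow> bool" for L M N where
  mismatch: "\<not> atomic_match L M N p \<Longrightarrow> spoiled L M N p"
| left: "a \<in> universe M \<Longrightarrow> (\<And>b. b \<in> universe N \<Longrightarrow> spoiled L M N (insert (a, b) p)) \<Longrightarrow> spoiled L M N p"
| right: "b \<in> universe N \<Longrightarrow> (\<And>a. a \<in> universe M \<Longrightarrow> spoiled L M N (insert (a, b) p)) \<Longrightarrow> spoiled L M N p"

lemma spoiled_mono: "spoiled L M N p \<Longrightarrow> p \<subseteq> q \<Longrightarrow> spoiled L M N q"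
proof (induction p arbitrary: q rule: spoiled.induct)
  case (mismatch p)
  then show ?case using atomic_match_mono spoiled.mismatch by blast
next
  case (left a p)
  show ?case by (rule spoiled.left[OF left.hyps(1)], rule left.IH) (use left.prems in auto)
next
  case (right b p)
  show ?case by (rule spoiled.right[OF right.hyps(1)], rule right.IH) (use right.prems in auto)
qed

text \<open>A back-and-forth system is a strategy for the second player that never leaves
  \<open>P\<close>; the induction runs along the first player's winning strategy.\<close>

lemma back_forth_not_spoiled:
  assumes bf: "back_forth L M N P" and "spoiled L M N p" "q \<in> P"
  shows "\<not> p \<subseteq> q"
  using assms(2,3)
proof (induction p arbitrary: q rule: spoiled.induct)
  case (mismatch p)
  have "atomic_match L M N q"
    using bf mismatch.prems unfolding back_forth_def atomic_match_def by simp
  then show ?case using atomic_match_mono mismatch.hyps by blast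
next
  case (left a p)
  have "\<exists>b. \<exists>q'\<in>P. insert (a, b) q \<subseteq> q'" and dom: "\<forall>q\<in>P. q \<subseteq> universe M \<times> universe N"
    using bf left.hyps(1) left.prems unfolding back_forth_def by simp_all
  then obtain b q' where q': "q' \<in> P" "insert (a, b) q \<subseteq> q'" by blast
  then have "b \<in> universe N" using dom by blast
  then have "\<not> insert (a, b) p \<subseteq> q'" using left.IH q'(1) by blast
  then show ?case using q'(2) by blast
next
  case (right b p)
  have "\<exists>a. \<exists>q'\<in>P. insert (a, b) q \<subseteq> q'" and dom: "\<forall>q\<in>P. q \<subseteq> universe M \<times> universe N"
    using bf right.hyps(1) right.prems unfolding back_forth_def by simp_all
  then obtain a q' where q': "q' \<in> P" "insert (a, b) q \<subseteq> q'" by blast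
  then have "a \<in> universe M" using dom by blast
  then have "\<not> insert (a, b) p \<subseteq> q'" using right.IH q'(1) by blast
  then show ?case using q'(2) by blast
qed

text \<open>A winning strategy of the first player against a countable structure can be played inside
  every substructure closed under suitable countably many operations.\<close>

lemma spoiled_reflect:
  assumes "spoiled L K M p" "countable (universe M)" "u \<in> universe K"
  shows "\<exists>W. countable W \<and> closed_under W (universe K) \<and>
    (\<forall>X. X \<subseteq> universe K \<longrightarrow> closed_under W X \<longrightarrow> spoiled L (K\<lparr>universe := X\<rparr>) M p)"
  using assms(1)
proof (induction p rule: spoiled.induct)
  case (mismatch p)
  have "\<not> atomic_match L (K\<lparr>universe := X\<rparr>) M p" for X
    using mismatch unfolding atomic_match_def by simp
  then show ?case by (intro exI[of _ "{}"]) (auto simp: closed_under_def intro: spoiled.mismatch)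
next
  case (left a p)
  then obtain W where W: "\<And>b. b \<in> universe M \<Longrightarrow> countable (W b)"
    "\<And>b. b \<in> universe M \<Longrightarrow> closed_under (W b) (universe K)"
    "\<And>b X. b \<in> universe M \<Longrightarrow> X \<subseteq> universe K \<Longrightarrow> closed_under (W b) X \<Longrightarrow>
      spoiled L (K\<lparr>universe := X\<rparr>) M (insert (a, b) p)"
    by metis
  \<comment> \<open>The constant operation puts the move \<open>a\<close> into \<open>X\<close>. The
    answers \<open>b\<close> range over a countable universe, so the operations for all
    continuations can simply be united.\<close>
  let ?W = "insert (\<lambda>_. a) (\<Union>b\<in>universe M. W b)"
  have cl: "closed_under ?W X \<longleftrightarrow> a \<in> X \<and> (\<forall>b\<in>universe M. closed_under (W b) X)" for X
  proof -
    have "\<exists>xs. set xs \<subseteq> X" by (rule exI[of _ "[]"]) simp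
    then show ?thesis by (auto simp: closed_under_def)
  qed
  show ?case
  proof (intro exI[of _ ?W] conjI allI impI)
    fix X assume X: "X \<subseteq> universe K" "closed_under ?W X"
    show "spoiled L (K\<lparr>universe := X\<rparr>) M p"
      by (rule spoiled.left[of a]) (use X W(3) cl in auto)
  qed (use W assms(2) cl left.hyps in auto)
next
  case (right b p)
  then obtain W where W: "\<And>a. a \<in> universe K \<Longrightarrow> countable (W a)"
    "\<And>a. a \<in> universe K \<Longrightarrow> closed_under (W a) (universe K)"
    "\<And>a X. a \<in> universe K \<Longrightarrow> X \<subseteq> universe K \<Longrightarrow> closed_under (W a) X \<Longrightarrow>
      spoiled L (K\<lparr>universe := X\<rparr>) M (insert (a, b) p)"
    by metis
  \<comment> \<open>The continuation depends on the answer \<open>a\<close>, which ranges over the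
    possibly uncountable universe of \<open>K\<close>. Passing \<open>a\<close> as the first
    argument merges the countable families \<open>W a\<close> into one sequence of operations. The
    constant \<open>u\<close> makes each enumerated family nonempty and is the value outside the
    universe.\<close>
  define w where "w n xs = (case xs of [] \<Rightarrow> u | a # ys \<Rightarrow>
      if a \<in> universe K then from_nat_into (insert (\<lambda>_. u) (W a)) n ys else u)" for n xs
  have in_W: "from_nat_into (insert (\<lambda>_. u) (W a)) n \<in> insert (\<lambda>_. u) (W a)" for a n
    by (rule from_nat_into) simp
  show ?case
  proof (intro exI[of _ "range w"] conjI allI impI)
    have "from_nat_into (insert (\<lambda>_. u) (W a)) n ys \<in> universe K"
      if "a \<in> universe K" "set ys \<subseteq> universe K" for a n ys
      using in_W[of a n] W(2)[OF that(1)] that(2) assms(3) by (auto simp: closed_under_def)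
    then show "closed_under (range w) (universe K)"
      using assms(3) by (auto simp: closed_under_def w_def split: list.split)
    fix X assume X: "X \<subseteq> universe K" "closed_under (range w) X"
    have cl: "closed_under (W a) X" if "a \<in> X" for a
      unfolding closed_under_def
    proof (intro ballI allI impI)
      fix v ys assume v: "v \<in> W a" "set ys \<subseteq> X"
      have aK: "a \<in> universe K" using \<open>a \<in> X\<close> X(1) by blast
      have "countable (insert (\<lambda>_. u) (W a))" using W(1)[OF aK] by simp
      then obtain n where "v = from_nat_into (insert (\<lambda>_. u) (W a)) n"
        using v(1) by (metis from_nat_into_surj insertCI)
      then have "v ys = w n (a # ys)" using aK by (simp add: w_def)
      moreover have "set (a # ys) \<subseteq> X" using v(2) \<open>a \<in> X\<close> by simp
      ultimately show "v ys \<in> X" using X(2) unfolding closed_under_def by auto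
    qed
    show "spoiled L (K\<lparr>universe := X\<rparr>) M p"
      by (rule spoiled.right[OF right.hyps(1)]) (use X(1) W(3) cl in auto)
  qed auto
qed

text \<open>A winning strategy of the first player would survive in a countable substructure
  satisfying \<open>\<phi>\<close>. That substructure is isomorphic to \<open>M\<close> because
  \<open>\<phi>\<close> is a Scott sentence, and an isomorphism defeats every such strategy.\<close>

lemma scott_model_not_spoiled:
  assumes M: "is_structure L M" "is_scott_sentence L M \<phi>"
    and K: "is_structure L K" "models K \<phi>"
  shows "\<not> spoiled L K M {}"
proof
  assume spoiled: "spoiled L K M {}"
  have sent: "is_sentence L \<phi>" using M(2) by (simp add: is_scott_sentence_def)
  obtain W where W: "countable W" "closed_under W (universe K)"
    "\<forall>X. X \<subseteq> universe K \<longrightarrow> X \<noteq> {} \<longrightarrow> closed_under W X \<longrightarrow>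
       is_structure L (K\<lparr>universe := X\<rparr>) \<and> (models (K\<lparr>universe := X\<rparr>) \<phi> \<longleftrightarrow> models K \<phi>)"
    using loewenheim_skolem[OF K(1) sent] by metis
  obtain u where u: "u \<in> universe K" using K(1) by (auto simp: is_structure_def)
  have "countable (universe M)" by simp
  from spoiled_reflect[OF spoiled this u]
  obtain V where V: "countable V" "closed_under V (universe K)"
    "\<And>X. X \<subseteq> universe K \<Longrightarrow> closed_under V X \<Longrightarrow> spoiled L (K\<lparr>universe := X\<rparr>) M {}"
    by blast
  have 1: "countable (W \<union> V)" "{u} \<subseteq> universe K" "closed_under (W \<union> V) (universe K)" "countable {u}"
    using W V u by (auto simp: closed_under_Un)
  obtain X where X: "{u} \<subseteq> X" "X \<subseteq> universe K" "closed_under (W \<union> V) X" "countable X"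
    by (rule countable_closure_exists[OF 1])
  let ?K0 = "K\<lparr>universe := X\<rparr>"
  have cl: "closed_under W X" "closed_under V X" using X(3) by (auto simp: closed_under_Un)
  have K0: "is_structure L ?K0" "models ?K0 \<phi>"
    using W(3)[rule_format, OF X(2) _ cl(1)] X(1) K(2) by auto
  have inj: "inj_on (to_nat_on X) (universe ?K0)" using inj_on_to_nat_on[OF X(4)] by simp
  note copy = copy_struct[OF K0(1) inj]
  have "models (copy_struct (to_nat_on X) ?K0) \<phi>"
    using isomorphic_models[OF copy(2) K0(1) copy(1) sent] K0(2) by simp
  then have "isomorphic L M (copy_struct (to_nat_on X) ?K0)"
    using M(2) copy(1) by (simp add: is_scott_sentence_def)
  then have "isomorphic L ?K0 M"
    using isomorphic_trans[OF copy(2)] isomorphic_sym[OF _ M(1)] by blast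
  then obtain G where G: "back_forth L ?K0 M {G}"
    using isomorphic_back_forth[OF _ K0(1)] by blast
  show False using back_forth_not_spoiled[OF G V(3)[OF X(2) cl(2)]] by simp
qed

text \<open>A tuple of \<open>K\<close> is labelled by a tuple of \<open>M\<close> against which the
  first player does not win. \<open>M\<close> lives on the natural numbers, so there are countably
  many labels, and two tuples with a common label can be played against each other through
  \<open>M\<close>.\<close>

lemma scott_model_typing_exists:
  assumes M: "is_structure L (M :: nat struct)" "is_scott_sentence L M \<phi>"
    and K: "is_structure L K" "models K \<phi>"
  obtains k where "type_equiv (universe K) k (universe K) k"
    "\<forall>R us vs. rel_arity L R = Some (length us) \<longrightarrow> set us \<subseteq> universe K \<longrightarrow> set vs \<subseteq> universe K \<longrightarrow>
       k us = k vs \<longrightarrow> (rel_interp K R us \<longleftrightarrow> rel_interp K R vs)"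
    "\<forall>f us vs a b. fun_arity L f = Some (length us) \<longrightarrow> set us \<subseteq> universe K \<longrightarrow> set vs \<subseteq> universe K \<longrightarrow>
       a \<in> universe K \<longrightarrow> b \<in> universe K \<longrightarrow> k (us @ [a]) = k (vs @ [b]) \<longrightarrow>
       (fun_interp K f us = a \<longleftrightarrow> fun_interp K f vs = b)"
proof -
  let ?U = "universe K"
  define good where "good us ms \<longleftrightarrow> set ms \<subseteq> universe M \<and> length ms = length us \<and>
    \<not> spoiled L K M (set (zip us ms))" for us ms
  define S where "S us vs \<longleftrightarrow> (\<exists>ms. good us ms \<and> good vs ms)" for us vs
  have good_forth: "\<exists>m. good (us @ [a]) (ms @ [m])" if g: "good us ms" and a: "a \<in> ?U" for us ms a
  proof -
    have "\<not> spoiled L K M (set (zip us ms))" using g by (simp add: good_def)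
    moreover have "spoiled L K M (set (zip us ms))"
      if "\<forall>m\<in>universe M. spoiled L K M (insert (a, m) (set (zip us ms)))"
      by (rule spoiled.left[OF a]) (use that in blast)
    ultimately obtain m where "m \<in> universe M" "\<not> spoiled L K M (insert (a, m) (set (zip us ms)))"
      by blast
    then show ?thesis using g by (auto simp: good_def)
  qed
  have good_back: "\<exists>a\<in>?U. good (us @ [a]) (ms @ [m])" if g: "good us ms" and m: "m \<in> universe M" for us ms m
  proof -
    have "\<not> spoiled L K M (set (zip us ms))" using g by (simp add: good_def)
    moreover have "spoiled L K M (set (zip us ms))"
      if "\<forall>a\<in>?U. spoiled L K M (insert (a, m) (set (zip us ms)))"
      by (rule spoiled.right[OF m]) (use that in blast)
    ultimately obtain a where "a \<in> ?U" "\<not> spoiled L K M (insert (a, m) (set (zip us ms)))"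
      by blast
    then show ?thesis using g m by (auto simp: good_def)
  qed
  have good_ex: "\<exists>ms. good us ms" if "set us \<subseteq> ?U" for us
    using that
  proof (induction us rule: rev_induct)
    case Nil
    then show ?case using scott_model_not_spoiled[OF M K] by (simp add: good_def)
  next
    case (snoc a us)
    then obtain ms where "good us ms" by auto
    then show ?case using good_forth[of us ms a] snoc.prems by auto
  qed
  have good_atomic: "atomic_match L K M (set (zip us ms))" if "good us ms" for us ms
    using that spoiled.mismatch unfolding good_def by blast
  have good_sub: "good (map ((!) us) is) (map ((!) ms) is)" if "good us ms" "set is \<subseteq> {..<length us}" for us ms "is"
  proof -
    have "set (zip (map ((!) us) is) (map ((!) ms) is)) \<subseteq> set (zip us ms)"
    proof
      fix x assume "x \<in> set (zip (map ((!) us) is) (map ((!) ms) is))"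
      then obtain i where "i \<in> set is" "x = (us ! i, ms ! i)"
        by (auto simp: zip_map_map zip_same_conv_map)
      then show "x \<in> set (zip us ms)" using that by (auto simp: good_def set_zip)
    qed
    moreover have "set (map ((!) ms) is) \<subseteq> set ms" using that by (force simp: good_def)
    ultimately show ?thesis using that(1) spoiled_mono[of L K M] unfolding good_def by auto
  qed
  have "\<exists>k. typing_of ?U S k"
  proof (rule typing_exists[of ?U S "\<lambda>us. to_nat (SOME ms. good us ms)"])
    fix us vs assume us: "set us \<subseteq> ?U" and vs: "set vs \<subseteq> ?U"
    show "S us vs" if "to_nat (SOME ms. good us ms) = to_nat (SOME ms. good vs ms)"
    proof -
      have "good us (SOME ms. good us ms)" "good vs (SOME ms. good vs ms)"
        using good_ex[OF us] good_ex[OF vs] by (auto intro: someI_ex)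
      then show ?thesis using that unfolding S_def by (metis from_nat_to_nat)
    qed
    assume "S us vs"
    then obtain ms where g: "good us ms" "good vs ms" by (auto simp: S_def)
    show "length us = length vs" using g by (simp add: good_def)
    show "S vs us" using g by (auto simp: S_def)
    show "us ! i = us ! j \<longleftrightarrow> vs ! i = vs ! j" if "i < length us" "j < length us" for i j
    proof -
      have "(us ! i, ms ! i) \<in> set (zip us ms)" "(us ! j, ms ! j) \<in> set (zip us ms)"
        "(vs ! i, ms ! i) \<in> set (zip vs ms)" "(vs ! j, ms ! j) \<in> set (zip vs ms)"
        using that g by (auto simp: good_def set_zip)
      then have "us ! i = us ! j \<longleftrightarrow> ms ! i = ms ! j" "vs ! i = vs ! j \<longleftrightarrow> ms ! i = ms ! j"
        using good_atomic[OF g(1), unfolded atomic_match_def, THEN conjunct1]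
          good_atomic[OF g(2), unfolded atomic_match_def, THEN conjunct1] by blast+
      then show ?thesis by simp
    qed
    show "S (map ((!) us) is) (map ((!) vs) is)" if "set is \<subseteq> {..<length us}" for "is"
    proof -
      have "length vs = length us" using g by (simp add: good_def)
      then have "set is \<subseteq> {..<length vs}" using that by simp
      then show ?thesis using good_sub[OF g(1) that] good_sub[OF g(2), of "is"] unfolding S_def by blast
    qed
    show "\<exists>b\<in>?U. S (us @ [a]) (vs @ [b])" if "a \<in> ?U" for a
    proof -
      obtain m where m: "good (us @ [a]) (ms @ [m])" using good_forth[OF g(1) \<open>a \<in> ?U\<close>] by blast
      then have "m \<in> universe M" by (simp add: good_def)
      then obtain b where "b \<in> ?U" "good (vs @ [b]) (ms @ [m])" using good_back[OF g(2)] by blast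
      then show ?thesis using m unfolding S_def by blast
    qed
  qed
  then obtain k where k: "typing_of ?U S k" by blast
  note te = typing_of_type_equiv[OF k] and inv = typing_of_invariant[OF k]
  have rel: "rel_interp K R us \<longleftrightarrow> rel_interp K R vs"
    if "rel_arity L R = Some (length us)" "S us vs" for R us vs
  proof -
    obtain ms where g: "good us ms" "good vs ms" using \<open>S us vs\<close> by (auto simp: S_def)
    have "rel_interp K R us' \<longleftrightarrow> rel_interp M R ms" if "good us' ms" for us'
      using good_atomic[OF that, unfolded atomic_match_def, THEN conjunct2, THEN conjunct1,
          rule_format, of R "zip us' ms"] \<open>rel_arity L R = Some (length us)\<close> g(1) that
      by (simp add: good_def)
    then show ?thesis using g by blast
  qed
  have func: "fun_interp K f us = a \<longleftrightarrow> fun_interp K f vs = b"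
    if "fun_arity L f = Some (length us)" "S (us @ [a]) (vs @ [b])" for f us vs a b
  proof -
    obtain ms where g: "good (us @ [a]) ms" "good (vs @ [b]) ms" using \<open>S (us @ [a]) (vs @ [b])\<close> by (auto simp: S_def)
    then have "length ms = Suc (length us)" by (simp add: good_def)
    then obtain ns m where ms: "ms = ns @ [m]" "length ns = length us"
      by (cases ms rule: rev_cases) auto
    have "fun_interp K f us' = a' \<longleftrightarrow> fun_interp M f ns = m" if "good (us' @ [a']) ms" for us' a'
      using good_atomic[OF that, unfolded atomic_match_def, THEN conjunct2, THEN conjunct2,
          rule_format, of f "zip us' ns" a' m] \<open>fun_arity L f = Some (length us)\<close> ms that
      by (auto simp: good_def)
    then show ?thesis using g by blast
  qed
  show ?thesis
  proof (rule that[OF te]; intro allI impI)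
    fix R us vs assume *: "rel_arity L R = Some (length us)" "set us \<subseteq> ?U" "set vs \<subseteq> ?U" "k us = k vs"
    show "rel_interp K R us \<longleftrightarrow> rel_interp K R vs"
    proof (rule inv[OF *(2-4), of "\<lambda>xs. rel_arity L R = Some (length xs) \<and> (rel_interp K R us \<longleftrightarrow> rel_interp K R xs)", THEN conjunct2])
      fix xs ys assume "S xs ys" "rel_arity L R = Some (length xs) \<and> (rel_interp K R us \<longleftrightarrow> rel_interp K R xs)"
      then show "rel_arity L R = Some (length ys) \<and> (rel_interp K R us \<longleftrightarrow> rel_interp K R ys)"
        using rel[of R xs ys] by (auto simp: S_def good_def)
    qed (use * in simp)
  next
    fix f us vs a b
    assume *: "fun_arity L f = Some (length us)" "set us \<subseteq> ?U" "set vs \<subseteq> ?U" "a \<in> ?U" "b \<in> ?U"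
      "k (us @ [a]) = k (vs @ [b])"
    \<comment> \<open>A chain of \<open>S\<close>-steps moves the arguments together with the
      candidate value, so the invariant speaks of whole lists whose last entry is that
      candidate.\<close>
    let ?P = "\<lambda>xs. xs \<noteq> [] \<and> fun_arity L f = Some (length (butlast xs)) \<and>
       (fun_interp K f us = a \<longleftrightarrow> fun_interp K f (butlast xs) = last xs)"
    have "?P (vs @ [b])"
    proof (rule inv[OF _ _ *(6), of ?P])
      fix xs ys assume S: "S xs ys" and P: "?P xs"
      have l: "length xs = length ys" using S by (auto simp: S_def good_def)
      have "xs \<noteq> []" using P by simp
      with l have "ys \<noteq> []" by auto
      with l \<open>xs \<noteq> []\<close> have "xs = butlast xs @ [last xs]" "ys = butlast ys @ [last ys]" "length (butlast ys) = length (butlast xs)"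
        by simp_all
      then show "?P ys" using P func[of f "butlast xs" "last xs" "butlast ys" "last ys"] S by auto
    qed (use * in auto)
    then show "fun_interp K f us = a \<longleftrightarrow> fun_interp K f vs = b" by simp
  qed
qed


text \<open>A larger \<open>Z\<close> would contain an equivalent subset \<open>Y\<close> of
  cardinality \<open>cardSuc \<kappa>\<close>. Carrying the relations and functions of
  \<open>K\<close> over to \<open>Y\<close> along equality of types makes \<open>Y\<close> a model
  of \<open>\<phi>\<close>.\<close>

lemma type_equiv_bound:
  assumes sent: "is_sentence L \<phi>" and K: "is_structure L K" "models K \<phi>"
    and rel: "\<forall>R us vs. rel_arity L R = Some (length us) \<longrightarrow> set us \<subseteq> universe K \<longrightarrow> set vs \<subseteq> universe K \<longrightarrow>
       k us = k vs \<longrightarrow> (rel_interp K R us \<longleftrightarrow> rel_interp K R vs)"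
    and func: "\<forall>f us vs a b. fun_arity L f = Some (length us) \<longrightarrow> set us \<subseteq> universe K \<longrightarrow> set vs \<subseteq> universe K \<longrightarrow>
       a \<in> universe K \<longrightarrow> b \<in> universe K \<longrightarrow> k (us @ [a]) = k (vs @ [b]) \<longrightarrow>
       (fun_interp K f us = a \<longleftrightarrow> fun_interp K f vs = b)"
    and \<kappa>: "Cinfinite \<kappa>" "\<not> has_model_of_card L \<phi> (cardSuc \<kappa>)"
    and Z: "type_equiv (universe K) k Z z"
  shows "|Z| \<le>o \<kappa>"
proof (rule ccontr)
  let ?U = "universe K"
  assume "\<not> |Z| \<le>o \<kappa>"
  then have "\<kappa> <o |Z|"
    using \<kappa>(1) by (simp add: card_of_Well_order card_order_on_well_order_on not_ordLeq_iff_ordLess)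
  then have "cardSuc \<kappa> \<le>o |Z|" using \<kappa>(1) by (simp add: cardSuc_least card_of_Card_order)
  moreover have cs: "Cinfinite (cardSuc \<kappa>)" by (rule Cinfinite_cardSuc[OF \<kappa>(1)])
  ultimately have "|Field (cardSuc \<kappa>)| \<le>o |Z|"
    using card_of_Field_ordIso ordIso_ordLeq_trans by blast
  then have "\<exists>g. inj_on g (Field (cardSuc \<kappa>)) \<and> g ` Field (cardSuc \<kappa>) \<subseteq> Z"
    by (simp only: card_of_ordLeq)
  then obtain g where g: "inj_on g (Field (cardSuc \<kappa>))" "g ` Field (cardSuc \<kappa>) \<subseteq> Z" by blast
  define X where "X = g ` Field (cardSuc \<kappa>)"
  have XF: "|X| =o |Field (cardSuc \<kappa>)|"
    unfolding X_def using g(1) by (intro ordIso_symmetric[OF card_of_ordIsoI[of g]]) (auto simp: bij_betw_def)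
  have XZ: "X \<subseteq> Z" using g(2) by (simp add: X_def)
  have infF: "infinite (Field (cardSuc \<kappa>))" using cs by (simp add: cinfinite_def)
  then have "X \<noteq> {}" by (auto simp: X_def)
  obtain Y where Y: "X \<subseteq> Y" "Y \<subseteq> Z" "|Y| \<le>o |Field (cardSuc \<kappa>)|" "type_equiv Z z Y z"
    by (rule type_equiv_submodel[OF type_equiv_refl_left[OF type_equiv_sym[OF Z]] XZ \<open>X \<noteq> {}\<close>
          infF ordIso_imp_ordLeq[OF XF]])
  have "|Field (cardSuc \<kappa>)| \<le>o |Y|"
    using card_of_mono1[OF Y(1)] ordIso_ordLeq_trans[OF ordIso_symmetric[OF XF]] by blast
  then have "|Y| =o |Field (cardSuc \<kappa>)|" using Y(3) ordIso_iff_ordLeq by blast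
  then have cardY: "|Y| =o cardSuc \<kappa>"
    using cs card_of_Field_ordIso ordIso_transitive by blast
  have te: "type_equiv ?U k Y z" by (rule type_equiv_trans[OF Z Y(4)])
  let ?F = "\<lambda>f ys y. \<exists>us a. set us \<subseteq> ?U \<and> a \<in> ?U \<and> k (us @ [a]) = z (ys @ [y]) \<and> fun_interp K f us = a"
  define N where "N = \<lparr>universe = Y, fun_interp = \<lambda>f ys. SOME y. y \<in> Y \<and> ?F f ys y,
     rel_interp = \<lambda>R ys. \<exists>us. set us \<subseteq> ?U \<and> k us = z ys \<and> rel_interp K R us\<rparr>"
  have fN: "fun_interp N f ys \<in> Y" "?F f ys (fun_interp N f ys)"
    if "fun_arity L f = Some (length ys)" "set ys \<subseteq> Y" for f ys
  proof -
    obtain us where us: "set us \<subseteq> ?U" "length us = length ys" "k us = z ys"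
      by (rule type_equiv_match_back[OF te \<open>set ys \<subseteq> Y\<close>])
    have a: "fun_interp K f us \<in> ?U" using K(1) us that(1) by (simp add: is_structure_def)
    obtain y where "y \<in> Y" "k (us @ [fun_interp K f us]) = z (ys @ [y])"
      using type_equiv_forth[OF te us(1) \<open>set ys \<subseteq> Y\<close> us(3) a] by blast
    with us(1) a have "\<exists>y. y \<in> Y \<and> ?F f ys y" by blast
    from someI_ex[OF this] show "fun_interp N f ys \<in> Y" "?F f ys (fun_interp N f ys)"
      by (simp_all add: N_def)
  qed
  have strN: "is_structure L N"
    using fN(1) \<open>X \<noteq> {}\<close> Y(1) by (auto simp: is_structure_def N_def)
  have univN: "universe N = Y" by (simp add: N_def)
  have "back_forth L K N (zips ?U k Y z)"
  proof (rule back_forth_zips[OF te refl univN])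
    fix R us vs assume R: "rel_arity L R = Some (length us)" "set us \<subseteq> ?U" "set vs \<subseteq> Y" "k us = z vs"
    have "rel_interp K R us" if "set us' \<subseteq> ?U" "k us' = z vs" "rel_interp K R us'" for us'
      using rel[rule_format, of R us us'] R that by simp
    then show "rel_interp K R us \<longleftrightarrow> rel_interp N R vs" using R by (auto simp: N_def)
  next
    fix f us vs a b
    assume f: "fun_arity L f = Some (length us)" "set us \<subseteq> ?U" "set vs \<subseteq> Y" "a \<in> ?U" "b \<in> Y"
      and eq: "k (us @ [a]) = z (vs @ [b])"
    define y where "y = fun_interp N f vs"
    have 1: "set (us @ [a]) \<subseteq> ?U" "set (vs @ [b]) \<subseteq> Y" using f by auto
    have len: "length vs = length us" using type_equiv_length[OF te 1 eq] by simp
    obtain us' a' where y: "y \<in> Y" "set us' \<subseteq> ?U" "a' \<in> ?U" "k (us' @ [a']) = z (vs @ [y])" "fun_interp K f us' = a'"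
      using fN[of f vs] f(1,3) len unfolding y_def by auto
    have yV: "set (vs @ [y]) \<subseteq> Y" using f(3) y(1) by simp
    \<comment> \<open>To compare \<open>b\<close> with the value \<open>y\<close>, both are put into
      one tuple. The partner \<open>a''\<close> of \<open>y\<close> is the value of \<open>f\<close>
      at \<open>us\<close>, since types decide the graph of \<open>f\<close>, and equality is
      decided by the type of the joint tuple.\<close>
    obtain a'' where a'': "a'' \<in> ?U" "k ((us @ [a]) @ [a'']) = z ((vs @ [b]) @ [y])"
      using type_equiv_back[OF te 1 eq y(1)] by blast
    have 2: "set ((us @ [a]) @ [a'']) \<subseteq> ?U" "set ((vs @ [b]) @ [y]) \<subseteq> Y" using 1 a''(1) y(1) by auto
    have "k (map fst (zip us vs @ [(a'', y)])) = z (map snd (zip us vs @ [(a'', y)]))"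
      by (rule type_equiv_zip[OF te 2 a''(2)]) (use len in auto)
    then have "k (us @ [a'']) = k (us' @ [a'])" using y(4) len by simp
    moreover have "length us' = length us"
      using type_equiv_length[OF te _ yV y(4)] y(2,3) len by simp
    ultimately have "fun_interp K f us = a''"
      using func[rule_format, of f us us' a'' a'] f y a''(1) by simp
    moreover have "a = a'' \<longleftrightarrow> b = y"
      using type_equiv_eq[OF te 2 a''(2), of "length us" "Suc (length us)"] len by (simp add: nth_append)
    ultimately show "fun_interp K f us = a \<longleftrightarrow> fun_interp N f vs = b" unfolding y_def[symmetric] by auto
  qed
  then have "models N \<phi>"
    using bf_models[OF _ K(1) strN zips_nonempty[OF te] sent] K(2) by simp
  then have "has_model_of_card L \<phi> (cardSuc \<kappa>)"
    using has_model_of_cardI[OF strN _ _ _ sent, of "cardSuc \<kappa>"] cardY cs by (simp add: univN)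
  then show False using \<kappa>(2) by simp
qed

section \<open>The first uncountable ordinal as a type\<close>

text \<open>As a type of class \<open>wellorder\<close> the ordinal comes with induction and
  \<open>LEAST\<close>, and its product with \<open>rat\<close> gets the lexicographic order by type
  class.\<close>

typedef omega1 = "Field aleph_1"
  using Field_cardSuc_not_empty[OF natLeq_Card_order] by blast

lemma well_order_aleph_1: "Well_order aleph_1"
  using cardSuc_Well_order[OF natLeq_Card_order] .

instantiation omega1 :: wellorder
begin

definition less_eq_omega1 :: "omega1 \<Rightarrow> omega1 \<Rightarrow> bool" where
  "x \<le> y \<longleftrightarrow> (Rep_omega1 x, Rep_omega1 y) \<in> aleph_1"

definition less_omega1 :: "omega1 \<Rightarrow> omega1 \<Rightarrow> bool" where
  "x < y \<longleftrightarrow> x \<le> y \<and> x \<noteq> (y :: omega1)"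

instance
proof
  have lin: "Linear_order aleph_1" and wf: "wf (aleph_1 - Id)"
    using well_order_aleph_1 by (auto simp: well_order_on_def)
  then have props: "refl_on (Field aleph_1) aleph_1" "trans aleph_1" "antisym aleph_1"
    "total_on (Field aleph_1) aleph_1"
    by (auto simp: linear_order_on_def partial_order_on_def preorder_on_def)
  fix x y z :: omega1
  have antisym: "x = y" if "x \<le> y" "y \<le> x" for x y :: omega1
    using that props(3) unfolding less_eq_omega1_def by (auto dest: antisymD simp: Rep_omega1_inject)
  show "x < y \<longleftrightarrow> x \<le> y \<and> \<not> y \<le> x"
    using antisym less_omega1_def props(1) Rep_omega1 unfolding less_eq_omega1_def
    by (auto simp: refl_on_def)
  show "x \<le> x" using props(1) Rep_omega1 by (auto simp: less_eq_omega1_def refl_on_def)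
  show "x \<le> z" if "x \<le> y" "y \<le> z" using that props(2) unfolding less_eq_omega1_def by (rule transD[rotated])
  show "x = y" if "x \<le> y" "y \<le> x" by (rule antisym[OF that])
  show "x \<le> y \<or> y \<le> x"
    using props(1,4) Rep_omega1[of x] Rep_omega1[of y] unfolding less_eq_omega1_def
    by (cases "x = y") (auto simp: refl_on_def total_on_def Rep_omega1_inject)
  fix P :: "omega1 \<Rightarrow> bool" and a :: omega1
  assume step: "\<And>x. (\<And>y. y < x \<Longrightarrow> P y) \<Longrightarrow> P x"
  have "\<forall>a. Rep_omega1 a = s \<longrightarrow> P a" for s
    using wf
  proof (induction s rule: wf_induct_rule)
    case (less s)
    show ?case
    proof (intro allI impI)
      fix a assume a: "Rep_omega1 a = s"
      show "P a"
      proof (rule step)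
        fix y :: omega1 assume "y < a"
        then have "(Rep_omega1 y, s) \<in> aleph_1 - Id"
          using a by (auto simp: less_omega1_def less_eq_omega1_def Rep_omega1_inject)
        from less[OF this] show "P y" by simp
      qed
    qed
  qed
  then show "P a" by simp
qed

end

lemma card_omega1: "|UNIV :: omega1 set| =o aleph_1"
proof -
  have "bij_betw Rep_omega1 UNIV (Field aleph_1)"
    using type_definition.Rep_range[OF type_definition_omega1]
    by (auto simp: bij_betw_def inj_on_def Rep_omega1_inject)
  then have "|UNIV :: omega1 set| =o |Field aleph_1|" by (rule card_of_ordIsoI)
  then show ?thesis
    using card_of_Field_ordIso[OF cardSuc_Card_order[OF natLeq_Card_order]] ordIso_transitive by blast
qed

lemma countable_iff_natLeq: "countable A \<longleftrightarrow> |A| \<le>o natLeq"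
proof -
  have "|UNIV :: nat set| =o natLeq" using card_of_nat .
  then show ?thesis unfolding countable_iff_ordLeq_nat
    using ordLeq_ordIso_trans ordIso_symmetric by blast
qed

lemma countable_lessThan_omega1: "countable {..<x :: omega1}"
proof -
  have co: "Card_order aleph_1" by (rule cardSuc_Card_order[OF natLeq_Card_order])
  have "Rep_omega1 ` {..<x} \<subseteq> underS aleph_1 (Rep_omega1 x)"
    by (auto simp: underS_def less_omega1_def less_eq_omega1_def Rep_omega1_inject)
  moreover have "|underS aleph_1 (Rep_omega1 x)| <o aleph_1"
    by (rule card_of_underS[OF co Rep_omega1])
  then have "|underS aleph_1 (Rep_omega1 x)| \<le>o natLeq"
    by (rule iffD1[OF cardSuc_ordLeq_ordLess[OF natLeq_Card_order card_of_Card_order]])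
  then have "countable (underS aleph_1 (Rep_omega1 x))" by (simp add: countable_iff_natLeq)
  ultimately have "countable (Rep_omega1 ` {..<x})" using countable_subset by blast
  then show ?thesis by (rule countable_image_inj_on) (simp add: inj_on_def Rep_omega1_inject)
qed

lemma uncountable_omega1: "uncountable (UNIV :: omega1 set)"
proof
  assume "countable (UNIV :: omega1 set)"
  then have "aleph_1 \<le>o natLeq"
    using card_omega1 ordIso_ordLeq_trans ordIso_symmetric unfolding countable_iff_natLeq by blast
  then show False
    using cardSuc_greater[OF natLeq_Card_order] not_ordLess_ordLeq by blast
qed

lemma countable_bounded_omega1:
  assumes "countable A"
  obtains x :: omega1 where "\<And>a. a \<in> A \<Longrightarrow> a < x"
proof -
  have "{..a} = insert a {..<a}" for a :: omega1 by auto
  then have "countable (\<Union>a\<in>A. {..a})" using assms countable_lessThan_omega1 by simp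
  then have "(\<Union>a\<in>A. {..a}) \<noteq> UNIV" using uncountable_omega1 by auto
  then obtain x where "x \<notin> (\<Union>a\<in>A. {..a})" by blast
  then have "a < x" if "a \<in> A" for a using that by force
  then show ?thesis by (rule that)
qed

lemma infinite_omega1: "infinite (UNIV :: omega1 set)"
  using uncountable_omega1 by (auto dest: countable_finite)

section \<open>The lexicographic order of the levels\<close>

type_synonym level = "omega1 \<times> rat"

lemma level_between:
  fixes A B :: "level set"
  assumes "finite A" "finite B" "\<And>a b. a \<in> A \<Longrightarrow> b \<in> B \<Longrightarrow> a < b"
  obtains z where "\<And>a. a \<in> A \<Longrightarrow> a < z" "\<And>b. b \<in> B \<Longrightarrow> z < b"
proof -
  have dense: "\<exists>z. x < z \<and> z < y" if "x < y" for x y :: level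
  proof (cases "fst x < fst y")
    case True
    then show ?thesis by (intro exI[of _ "(fst x, snd x + 1)"]) (auto simp: less_prod_def')
  next
    case False
    then show ?thesis using that
      by (intro exI[of _ "(fst x, (snd x + snd y) / 2)"]) (auto simp: less_prod_def' field_simps)
  qed
  have above: "\<exists>z. x < z" for x :: level
    by (intro exI[of _ "(fst x, snd x + 1)"]) (auto simp: less_prod_def')
  have below: "\<exists>z. z < x" for x :: level
    by (intro exI[of _ "(fst x, snd x - 1)"]) (auto simp: less_prod_def')
  have "\<exists>z. (\<forall>a\<in>A. a < z) \<and> (\<forall>b\<in>B. z < b)"
  proof (cases "A = {}"; cases "B = {}")
    assume "A \<noteq> {}" "B \<noteq> {}"
    then have "Max A < Min B" using assms by simp
    then obtain z where "Max A < z" "z < Min B" using dense by blast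
    then show ?thesis using \<open>A \<noteq> {}\<close> \<open>B \<noteq> {}\<close> assms(1,2) by (intro exI[of _ z]) simp
  next
    assume "A \<noteq> {}" "B = {}"
    obtain z where "Max A < z" using above by blast
    then show ?thesis using \<open>A \<noteq> {}\<close> \<open>B = {}\<close> assms(1) by (intro exI[of _ z]) simp
  next
    assume "A = {}" "B \<noteq> {}"
    obtain z where "z < Min B" using below by blast
    then show ?thesis using \<open>A = {}\<close> \<open>B \<noteq> {}\<close> assms(2) by (intro exI[of _ z]) simp
  qed simp
  then show ?thesis using that by blast
qed

text \<open>The levels are dense without endpoints, so elements can be inserted one at a time into
  any finite cut. \<open>q\<close> need not be injective; an element that ties with an earlier one
  receives the level of that one.\<close>

lemma finite_order_extension:
  fixes q :: "'e \<Rightarrow> 'o :: linorder" and g :: "'e \<Rightarrow> level"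
  assumes "finite N" "finite A" "\<forall>a\<in>A. \<forall>b\<in>A. q a < q b \<longleftrightarrow> g a < g b"
  shows "\<exists>g'. (\<forall>a\<in>A. g' a = g a) \<and> (\<forall>a\<in>A \<union> N. \<forall>b\<in>A \<union> N. q a < q b \<longleftrightarrow> g' a < g' b)"
  using assms(1)
proof (induction N)
  case empty
  then show ?case using assms(3) by auto
next
  case (insert x N)
  then obtain g1 where g1: "\<forall>a\<in>A. g1 a = g a" "\<forall>a\<in>A \<union> N. \<forall>b\<in>A \<union> N. q a < q b \<longleftrightarrow> g1 a < g1 b"
    by blast
  show ?case
  proof (cases "x \<in> A")
    case True
    then show ?thesis using g1 by (intro exI[of _ g1]) auto
  next
    case xA: False
    let ?D = "A \<union> N"
    have fin: "finite ?D" using insert assms(2) by simp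
    have "\<exists>z. \<forall>a\<in>?D. (q a < q x \<longleftrightarrow> g1 a < z) \<and> (q x < q a \<longleftrightarrow> z < g1 a)"
    proof (cases "\<exists>a\<in>?D. q a = q x")
      case True
      then obtain c where c: "c \<in> ?D" "q x = q c" by (metis (no_types))
      show ?thesis unfolding c(2) using g1(2) c(1) by blast
    next
      case False
      have "finite (g1 ` {a \<in> ?D. q a < q x})" "finite (g1 ` {a \<in> ?D. q x < q a})" using fin by auto
      moreover have "y < y'" if "y \<in> g1 ` {a \<in> ?D. q a < q x}" "y' \<in> g1 ` {a \<in> ?D. q x < q a}" for y y'
        using that g1(2) by fastforce
      ultimately obtain z where z: "\<And>y. y \<in> g1 ` {a \<in> ?D. q a < q x} \<Longrightarrow> y < z"
        "\<And>y. y \<in> g1 ` {a \<in> ?D. q x < q a} \<Longrightarrow> z < y"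
        by (rule level_between) blast+
      have "(q a < q x \<longleftrightarrow> g1 a < z) \<and> (q x < q a \<longleftrightarrow> z < g1 a)" if "a \<in> ?D" for a
      proof -
        have "q a < q x \<or> q x < q a" using False that by (meson linorder_neq_iff)
        then show ?thesis using z[of "g1 a"] that by (auto dest: less_asym)
      qed
      then show ?thesis by blast
    qed
    then obtain z where z: "\<forall>a\<in>?D. (q a < q x \<longleftrightarrow> g1 a < z) \<and> (q x < q a \<longleftrightarrow> z < g1 a)" by blast
    show ?thesis
      using g1 z xA insert.hyps(2) by (intro exI[of _ "g1(x := z)"]) auto
  qed
qed

section \<open>Set systems of cardinality at most \<open>\<aleph>\<^sub>1\<close>\<close>

text \<open>For an intersection-closed family this says that \<open>c\<close> lies in the closure of
  \<open>{a, b}\<close>. It is the relation that becomes \<open>T\<close>.\<close>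

definition dep :: "'e set set \<Rightarrow> 'e \<Rightarrow> 'e \<Rightarrow> 'e \<Rightarrow> bool" where
  "dep \<A> a b c \<longleftrightarrow> (\<forall>A\<in>\<A>. a \<in> A \<longrightarrow> b \<in> A \<longrightarrow> c \<in> A)"

lemma dep_commute: "dep \<A> a b c \<longleftrightarrow> dep \<A> b a c"
  by (auto simp: dep_def)

text \<open>By a theorem of Kuratowski, the last condition bounds the cardinality of \<open>X\<close> by \<open>\<aleph>\<^sub>1\<close>.\<close>

definition set_system :: "'e set \<Rightarrow> 'e set set \<Rightarrow> bool" where
  "set_system X \<A> \<longleftrightarrow> (\<forall>A\<in>\<A>. finite A \<and> A \<subseteq> X) \<and> {} \<in> \<A> \<and> (\<forall>A\<in>\<A>. \<forall>B\<in>\<A>. A \<inter> B \<in> \<A>) \<and>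
    (\<forall>Y. finite Y \<longrightarrow> Y \<subseteq> X \<longrightarrow> (\<exists>A\<in>\<A>. Y \<subseteq> A)) \<and>
    (\<forall>a\<in>X. \<forall>b\<in>X. \<forall>c\<in>X. a \<noteq> b \<longrightarrow> b \<noteq> c \<longrightarrow> a \<noteq> c \<longrightarrow> dep \<A> a b c \<or> dep \<A> b c a \<or> dep \<A> a c b)"

lemma set_systemD:
  assumes "set_system X \<A>"
  shows "A \<in> \<A> \<Longrightarrow> finite A" "A \<in> \<A> \<Longrightarrow> A \<subseteq> X" "{} \<in> \<A>" "A \<in> \<A> \<Longrightarrow> B \<in> \<A> \<Longrightarrow> A \<inter> B \<in> \<A>"
    "finite Y \<Longrightarrow> Y \<subseteq> X \<Longrightarrow> \<exists>A\<in>\<A>. Y \<subseteq> A"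
    "a \<in> X \<Longrightarrow> b \<in> X \<Longrightarrow> c \<in> X \<Longrightarrow> a \<noteq> b \<Longrightarrow> b \<noteq> c \<Longrightarrow> a \<noteq> c \<Longrightarrow>
       dep \<A> a b c \<or> dep \<A> b c a \<or> dep \<A> a c b"
  using assms unfolding set_system_def by simp_all

text \<open>For set systems these conditions leave the closure of every finite subset of
  \<open>X\<close> unchanged: old members stay available, and no new member separates old points in
  a new way.\<close>

definition end_extension :: "'e set \<Rightarrow> 'e set set \<Rightarrow> 'e set \<Rightarrow> 'e set set \<Rightarrow> bool" where
  "end_extension X \<A> Y \<B> \<longleftrightarrow> X \<subseteq> Y \<and> \<A> \<subseteq> \<B> \<and> (\<forall>B\<in>\<B>. B \<inter> X \<in> \<A>)"

lemma end_extension_trans: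
  assumes "end_extension X \<A> Y \<B>" "end_extension Y \<B> Z \<C>"
  shows "end_extension X \<A> Z \<C>"
proof -
  have "C \<inter> X = (C \<inter> Y) \<inter> X" for C using assms(1) by (auto simp: end_extension_def)
  then show ?thesis using assms unfolding end_extension_def by (metis order_trans)
qed

lemma end_extension_mem:
  assumes "end_extension X \<A> Y \<B>" "C \<subseteq> X"
  shows "C \<in> \<B> \<longleftrightarrow> C \<in> \<A>"
proof -
  have CX: "C \<inter> X = C" by (rule Int_absorb2[OF assms(2)])
  have "C \<inter> X \<in> \<A>" if "C \<in> \<B>" using assms(1) that by (simp add: end_extension_def)
  moreover have "C \<in> \<B>" if "C \<in> \<A>" using assms(1) that by (auto simp: end_extension_def)
  ultimately show ?thesis unfolding CX by (rule iffI)
qed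

lemma end_extension_dep:
  assumes "end_extension X \<A> Y \<B>" "dep \<A> a b c" "a \<in> X" "b \<in> X"
  shows "dep \<B> a b c"
  unfolding dep_def
proof (intro ballI impI)
  fix B assume "B \<in> \<B>" "a \<in> B" "b \<in> B"
  then have "B \<inter> X \<in> \<A>" "a \<in> B \<inter> X" "b \<in> B \<inter> X"
    using assms by (auto simp: end_extension_def)
  then have "c \<in> B \<inter> X" by (rule assms(2)[unfolded dep_def, rule_format])
  then show "c \<in> B" by simp
qed

lemma set_system_chain:
  fixes X :: "'e set"
  assumes X: "set_system X \<A>" "countable X" and B: "B \<in> \<A>"
  obtains A :: "nat \<Rightarrow> 'e set" where "A 0 = B" "\<And>n. A n \<in> \<A>" "\<And>m n. m \<le> n \<Longrightarrow> A m \<subseteq> A n" "(\<Union>n. A n) = X"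
proof -
  have "\<exists>A'\<in>\<A>. A \<subseteq> A' \<and> (X \<noteq> {} \<longrightarrow> from_nat_into X n \<in> A')" if "A \<in> \<A>" for A n
  proof (cases "X = {}")
    case False
    then have "insert (from_nat_into X n) A \<subseteq> X"
      using set_systemD(2)[OF X(1) that] from_nat_into[OF False] by auto
    then show ?thesis using set_systemD(5)[OF X(1), of "insert (from_nat_into X n) A"]
        set_systemD(1)[OF X(1) that] by auto
  qed (use that in auto)
  then have "\<exists>A. A 0 = B \<and> (\<forall>n. A n \<in> \<A> \<and> A n \<subseteq> A (Suc n) \<and> (X \<noteq> {} \<longrightarrow> from_nat_into X n \<in> A (Suc n)))"
    using dependent_nat_choice[of "\<lambda>n A. A \<in> \<A> \<and> (n = 0 \<longrightarrow> A = B)"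
        "\<lambda>n A A'. A \<subseteq> A' \<and> (X \<noteq> {} \<longrightarrow> from_nat_into X n \<in> A')"] B
    by (metis nat.simps(3))
  then obtain A where A: "A 0 = B" "\<And>n. A n \<in> \<A>" "\<And>n. A n \<subseteq> A (Suc n)"
    "\<And>n. X \<noteq> {} \<Longrightarrow> from_nat_into X n \<in> A (Suc n)" by blast
  have "(\<Union>n. A n) = X"
  proof (intro equalityI subsetI)
    fix x assume "x \<in> X"
    moreover from this obtain n where "x = from_nat_into X n" using X(2) by (metis from_nat_into_surj)
    ultimately have "x \<in> A (Suc n)" using A(4)[of n] by blast
    then show "x \<in> (\<Union>n. A n)" by blast
  qed (use set_systemD(2)[OF X(1) A(2)] in blast)
  moreover have "A m \<subseteq> A n" if "m \<le> n" for m n using lift_Suc_mono_le[of A] A(3) that by blast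
  ultimately show ?thesis using that[of A] A(1,2) by blast
qed

text \<open>One-step amalgamation of \<open>(X, \<A>)\<close> with a finite system \<open>\<C>\<close> on \<open>B \<union> N\<close> over \<open>B\<close>: the
  remaining members are the sets \<open>A\<^sub>n \<union> N\<close> for an increasing chain of members \<open>A\<^sub>n\<close> exhausting \<open>X\<close>,
  so that a new point and a point of \<open>X - B\<close> determine everything below the latter in the chain.\<close>

lemma set_system_amalgam:
  assumes X: "set_system X \<A>" "countable X" and N: "finite N" "N \<inter> X = {}"
    and B: "B \<in> \<A>" and C: "set_system (B \<union> N) \<C>" "B \<union> N \<in> \<C>"
    and CB: "\<And>D. D \<in> \<C> \<Longrightarrow> D \<inter> B \<in> \<A>" "\<And>D. D \<in> \<A> \<Longrightarrow> D \<subseteq> B \<Longrightarrow> D \<in> \<C>"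
  shows "\<exists>\<B>. set_system (X \<union> N) \<B> \<and> end_extension X \<A> (X \<union> N) \<B> \<and> end_extension (B \<union> N) \<C> (X \<union> N) \<B>"
proof -
  obtain A :: "nat \<Rightarrow> _" where A: "A 0 = B" "\<And>n. A n \<in> \<A>" "\<And>m n. m \<le> n \<Longrightarrow> A m \<subseteq> A n" "(\<Union>n. A n) = X"
    using set_system_chain[OF X B] by metis
  define \<B> where "\<B> = \<A> \<union> \<C> \<union> range (\<lambda>n. A n \<union> N)"
  have BX: "B \<subseteq> X" by (rule set_systemD(2)[OF X(1) B])
  have AX: "A n \<subseteq> X" "B \<subseteq> A n" for n using A(1,4) A(3)[of 0 n] by auto
  have extX: "end_extension X \<A> (X \<union> N) \<B>"
    unfolding end_extension_def
  proof (intro conjI ballI)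
    fix D assume "D \<in> \<B>"
    then consider "D \<in> \<A>" | "D \<in> \<C>" | n where "D = A n \<union> N" by (auto simp: \<B>_def)
    then show "D \<inter> X \<in> \<A>"
    proof cases
      case 1
      then have "D \<inter> X = D" using set_systemD(2)[OF X(1)] by blast
      then show ?thesis using 1 by simp
    next
      case 2
      then have "D \<inter> X = D \<inter> B" using set_systemD(2)[OF C(1)] BX N(2) by blast
      then show ?thesis using CB(1)[OF 2] by simp
    next
      case 3
      then have "D \<inter> X = A n" using AX N(2) by blast
      then show ?thesis using A(2) by simp
    qed
  qed (auto simp: \<B>_def)
  have extC: "end_extension (B \<union> N) \<C> (X \<union> N) \<B>"
    unfolding end_extension_def
  proof (intro conjI ballI)
    fix D assume "D \<in> \<B>"
    then consider "D \<in> \<A>" | "D \<in> \<C>" | n where "D = A n \<union> N" by (auto simp: \<B>_def)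
    then show "D \<inter> (B \<union> N) \<in> \<C>"
    proof cases
      case 1
      then have "D \<inter> (B \<union> N) = D \<inter> B" using set_systemD(2)[OF X(1)] N(2) by blast
      then show ?thesis using CB(2)[OF set_systemD(4)[OF X(1) 1 B]] by simp
    next
      case 2
      then have "D \<inter> (B \<union> N) = D" using set_systemD(2)[OF C(1)] by blast
      then show ?thesis using 2 by simp
    next
      case 3
      then have "D \<inter> (B \<union> N) = B \<union> N" using AX by blast
      then show ?thesis using C(2) by simp
    qed
  qed (use BX in \<open>auto simp: \<B>_def\<close>)
  have key: "dep \<B> x c y \<or> dep \<B> x y c" if x: "x \<in> N" and c: "c \<in> X - B" and y: "y \<in> X \<union> N" for x c y
  proof -
    have mem: "\<exists>n. D = A n \<union> N" if "D \<in> \<B>" "x \<in> D" "d \<in> D" "d \<in> X - B" for D d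
      using that x N(2) set_systemD(2)[OF X(1)] set_systemD(2)[OF C(1)] unfolding \<B>_def by blast
    show ?thesis
    \<comment> \<open>The question is which of \<open>c\<close> and \<open>y\<close> enters the
      chain first. The later one, together with the new point \<open>x\<close>, determines the
      earlier one; new points lie in every set of the chain and so count as early.\<close>
    proof (cases "\<exists>n. y \<in> X \<and> c \<in> A n \<and> y \<notin> A n")
      case True
      then obtain n where n: "y \<in> X" "c \<in> A n" "y \<notin> A n" by blast
      then have "y \<in> X - B" using AX(2) by blast
      have "dep \<B> x y c" unfolding dep_def
      proof (intro ballI impI)
        fix D assume D: "D \<in> \<B>" "x \<in> D" "y \<in> D"
        obtain m where m: "D = A m \<union> N" using mem[OF D \<open>y \<in> X - B\<close>] by blast
        then have "y \<in> A m" using D(3) n(1) N(2) by blast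
        then have "\<not> m \<le> n" using A(3) n(3) by blast
        then have "A n \<subseteq> A m" by (intro A(3)) simp
        then show "c \<in> D" using n(2) m by blast
      qed
      then show ?thesis ..
    next
      case False
      have "dep \<B> x c y" unfolding dep_def
      proof (intro ballI impI)
        fix D assume D: "D \<in> \<B>" "x \<in> D" "c \<in> D"
        obtain m where m: "D = A m \<union> N" using mem[OF D c] by blast
        then have "c \<in> A m" using D(3) c N(2) by blast
        then show "y \<in> D" using False y m by blast
      qed
      then show ?thesis ..
    qed
  qed
  have "set_system (X \<union> N) \<B>"
    unfolding set_system_def
  proof (intro conjI ballI allI impI)
    show "finite D" "D \<subseteq> X \<union> N" if "D \<in> \<B>" for D
      using that set_systemD(1,2)[OF X(1)] set_systemD(1,2)[OF C(1)] A(2) N(1) BX unfolding \<B>_def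
      by blast+
    show "{} \<in> \<B>" using set_systemD(3)[OF X(1)] by (simp add: \<B>_def)
    have AB: "D \<inter> E \<in> \<B>" if "D \<in> \<A>" "E \<in> \<B>" for D E
    proof -
      have "D \<inter> E = D \<inter> (E \<inter> X)" using set_systemD(2)[OF X(1) that(1)] by blast
      also have "\<dots> \<in> \<A>" using extX that set_systemD(4)[OF X(1)] by (simp add: end_extension_def)
      finally show ?thesis by (simp add: \<B>_def)
    qed
    have CA: "D \<inter> (A n \<union> N) = D" if "D \<in> \<C>" for D n
      using set_systemD(2)[OF C(1) that] AX(2)[of n] by blast
    have AA: "(A m \<union> N) \<inter> (A n \<union> N) \<in> \<B>" for m n
    proof -
      have "(A m \<union> N) \<inter> (A n \<union> N) = A (min m n) \<union> N"
        using A(3)[of m n] A(3)[of n m] by (cases "m \<le> n") (auto simp: min_def)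
      then show ?thesis by (simp add: \<B>_def)
    qed
    show "D \<inter> E \<in> \<B>" if DE: "D \<in> \<B>" "E \<in> \<B>" for D E
    proof -
      consider "D \<in> \<A>" | "E \<in> \<A>" | "D \<in> \<C>" "E \<in> \<C>" | n where "D \<in> \<C>" "E = A n \<union> N"
        | n where "E \<in> \<C>" "D = A n \<union> N" | m n where "D = A m \<union> N" "E = A n \<union> N"
        using DE unfolding \<B>_def by blast
      then show ?thesis
      proof cases
        case 1 then show ?thesis using AB DE by blast
      next
        case 2 then show ?thesis using AB[OF 2 DE(1)] by (simp add: Int_commute)
      next
        case 3 then show ?thesis using set_systemD(4)[OF C(1) 3] by (simp add: \<B>_def)
      next
        case 4 then show ?thesis using CA DE by simp
      next
        case 5 then show ?thesis using CA[OF 5(1), of n] DE by (simp add: Int_commute)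
      next
        case 6 then show ?thesis using AA by simp
      qed
    qed
    show "\<exists>D\<in>\<B>. Y \<subseteq> D" if "finite Y" "Y \<subseteq> X \<union> N" for Y
    proof -
      have "\<exists>n. Y \<inter> X \<subseteq> A n"
        by (rule finite_subset_incseq) (use A(3) A(4) \<open>finite Y\<close> in auto)
      then obtain n where "Y \<subseteq> A n \<union> N" using \<open>Y \<subseteq> X \<union> N\<close> by blast
      then show ?thesis by (auto simp: \<B>_def)
    qed
    fix a b c
    note com = dep_commute[of \<B> a b c] dep_commute[of \<B> b c a] dep_commute[of \<B> a c b]
    assume abc: "a \<in> X \<union> N" "b \<in> X \<union> N" "c \<in> X \<union> N" "a \<noteq> b" "b \<noteq> c" "a \<noteq> c"
    \<comment> \<open>A triple contained neither in \<open>X\<close> nor in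
      \<open>B \<union> N\<close> has an entry in \<open>N\<close> and another in
      \<open>X - B\<close>, and \<open>key\<close> applies to this pair.\<close>
    consider "a \<in> X" "b \<in> X" "c \<in> X" | "a \<in> B \<union> N" "b \<in> B \<union> N" "c \<in> B \<union> N"
      | "a \<in> N" "b \<in> X - B" | "a \<in> N" "c \<in> X - B" | "b \<in> N" "a \<in> X - B" | "b \<in> N" "c \<in> X - B"
      | "c \<in> N" "a \<in> X - B" | "c \<in> N" "b \<in> X - B"
      using abc by blast
    then show "dep \<B> a b c \<or> dep \<B> b c a \<or> dep \<B> a c b"
    proof cases
      case 1
      then show ?thesis using set_systemD(6)[OF X(1) 1 abc(4-6)] end_extension_dep[OF extX] by blast
    next
      case 2
      then show ?thesis using set_systemD(6)[OF C(1) 2 abc(4-6)] end_extension_dep[OF extC] by blast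
    next
      case 3 show ?thesis using key[OF 3 abc(3)] com by argo
    next
      case 4 show ?thesis using key[OF 4 abc(2)] com by argo
    next
      case 5 show ?thesis using key[OF 5 abc(3)] com by argo
    next
      case 6 show ?thesis using key[OF 6 abc(1)] com by argo
    next
      case 7 show ?thesis using key[OF 7 abc(2)] com by argo
    next
      case 8 show ?thesis using key[OF 8 abc(1)] com by argo
    qed
  qed
  then show ?thesis using extX extC by blast
qed

text \<open>An intersection of members from different indices is computed inside one of them,
  through the trace of the other on it. The empty set is inserted for the case that \<open>J\<close>
  is empty, which occurs at the first stage of the construction.\<close>

lemma set_system_union:
  fixes J :: "'i :: linorder set"
  assumes sys: "\<And>i. i \<in> J \<Longrightarrow> set_system (X i) (\<A> i)"
    and ext: "\<And>i j. i \<in> J \<Longrightarrow> j \<in> J \<Longrightarrow> i < j \<Longrightarrow> end_extension (X i) (\<A> i) (X j) (\<A> j)"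
  defines "\<U> \<equiv> insert {} (\<Union>i\<in>J. \<A> i)"
  shows "set_system (\<Union>i\<in>J. X i) \<U>" "\<And>i. i \<in> J \<Longrightarrow> end_extension (X i) (\<A> i) (\<Union>i\<in>J. X i) \<U>"
proof -
  have ext': "end_extension (X i) (\<A> i) (X j) (\<A> j)" if "i \<in> J" "j \<in> J" "i \<le> j" for i j
  proof (cases "i = j")
    case True
    then show ?thesis using set_systemD(2)[OF sys[OF that(2)]] by (auto simp: end_extension_def Int_absorb2)
  qed (use ext that in simp)
  have inter: "B \<inter> X i \<in> \<A> i" if "i \<in> J" "j \<in> J" "B \<in> \<A> j" for i j B
  proof (cases "i \<le> j")
    case True
    then show ?thesis using ext'[OF that(1,2)] that(3) by (simp add: end_extension_def)
  next
    case False
    then have e: "end_extension (X j) (\<A> j) (X i) (\<A> i)" using ext' that by simp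
    then have "B \<in> \<A> i" using that(3) by (auto simp: end_extension_def)
    moreover from this have "B \<inter> X i = B" using set_systemD(2)[OF sys[OF that(1)]] by blast
    ultimately show ?thesis by simp
  qed
  show extU: "end_extension (X i) (\<A> i) (\<Union>i\<in>J. X i) \<U>" if "i \<in> J" for i
    unfolding end_extension_def \<U>_def
    using that inter[OF that] set_systemD(3)[OF sys[OF that]] by auto
  have bound: "\<exists>i\<in>J. Y \<subseteq> X i" if "finite Y" "Y \<noteq> {}" "Y \<subseteq> (\<Union>i\<in>J. X i)" for Y
    using that
  proof (induction Y rule: finite_ne_induct)
    case (insert y Y)
    then obtain i j where "i \<in> J" "Y \<subseteq> X i" "j \<in> J" "y \<in> X j" by auto
    moreover have "X i \<subseteq> X j \<or> X j \<subseteq> X i"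
      using ext'[of i j] ext'[of j i] \<open>i \<in> J\<close> \<open>j \<in> J\<close> linear[of i j] by (auto simp: end_extension_def)
    ultimately show ?case by blast
  qed auto
  show "set_system (\<Union>i\<in>J. X i) \<U>"
    unfolding set_system_def
  proof (intro conjI ballI allI impI)
    show "finite A" "A \<subseteq> (\<Union>i\<in>J. X i)" if "A \<in> \<U>" for A
    proof -
      have "A = {} \<or> (\<exists>i\<in>J. A \<in> \<A> i)" using that by (auto simp: \<U>_def)
      then have "finite A \<and> A \<subseteq> (\<Union>i\<in>J. X i)"
      proof (elim disjE bexE)
        fix i assume i: "i \<in> J" "A \<in> \<A> i"
        from set_systemD(1,2)[OF sys[OF i(1)] i(2)] i(1) show ?thesis by blast
      qed simp
      then show "finite A" "A \<subseteq> (\<Union>i\<in>J. X i)" by simp_all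
    qed
    show "{} \<in> \<U>" by (simp add: \<U>_def)
    show "A \<inter> B \<in> \<U>" if A: "A \<in> \<U>" and B: "B \<in> \<U>" for A B
    proof (cases "A = {} \<or> B = {}")
      case False
      then obtain i where i: "i \<in> J" "A \<in> \<A> i" using A by (auto simp: \<U>_def)
      then have "B \<inter> X i \<in> \<A> i" using extU[OF i(1)] B by (simp add: end_extension_def)
      then have "A \<inter> (B \<inter> X i) \<in> \<A> i" using set_systemD(4)[OF sys[OF i(1)] i(2)] by blast
      moreover have "A \<inter> (B \<inter> X i) = A \<inter> B" using set_systemD(2)[OF sys[OF i(1)] i(2)] by blast
      ultimately show ?thesis using i(1) by (auto simp: \<U>_def)
    qed (auto simp: \<U>_def)
    show "\<exists>A\<in>\<U>. Y \<subseteq> A" if Y: "finite Y" "Y \<subseteq> (\<Union>i\<in>J. X i)" for Y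
    proof (cases "Y = {}")
      case False
      then obtain i where i: "i \<in> J" "Y \<subseteq> X i" using bound[OF Y(1) False Y(2)] by blast
      obtain A where "A \<in> \<A> i" "Y \<subseteq> A" using set_systemD(5)[OF sys[OF i(1)] Y(1) i(2)] by blast
      then show ?thesis using i(1) by (auto simp: \<U>_def)
    qed (auto simp: \<U>_def)
    fix a b c assume abc: "a \<in> (\<Union>i\<in>J. X i)" "b \<in> (\<Union>i\<in>J. X i)" "c \<in> (\<Union>i\<in>J. X i)" "a \<noteq> b" "b \<noteq> c" "a \<noteq> c"
    obtain i where i: "i \<in> J" "{a, b, c} \<subseteq> X i" using bound[of "{a, b, c}"] abc(1-3) by auto
    then have "dep (\<A> i) a b c \<or> dep (\<A> i) b c a \<or> dep (\<A> i) a c b"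
      using set_systemD(6)[OF sys[OF i(1)], of a b c] abc by simp
    then show "dep \<U> a b c \<or> dep \<U> b c a \<or> dep \<U> a c b"
      using end_extension_dep[OF extU[OF i(1)], of a b c] end_extension_dep[OF extU[OF i(1)], of b c a]
        end_extension_dep[OF extU[OF i(1)], of a c b] i(2) by auto
  qed
qed

lemma set_system_restrict:
  assumes "set_system X \<A>" "A \<in> \<A>"
  shows "set_system A {C \<in> \<A>. C \<subseteq> A}"
  unfolding set_system_def
proof (intro conjI ballI allI impI)
  fix a b c assume abc: "a \<in> A" "b \<in> A" "c \<in> A" "a \<noteq> b" "b \<noteq> c" "a \<noteq> c"
  then have "a \<in> X" "b \<in> X" "c \<in> X" using set_systemD(2)[OF assms] by auto
  from set_systemD(6)[OF assms(1) this abc(4-6)]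
  show "dep {C \<in> \<A>. C \<subseteq> A} a b c \<or> dep {C \<in> \<A>. C \<subseteq> A} b c a \<or> dep {C \<in> \<A>. C \<subseteq> A} a c b"
    unfolding dep_def by blast
qed (use assms set_systemD[OF assms(1)] in auto)

lemma set_system_image:
  assumes "set_system A \<C>" "inj_on f A"
  shows "set_system (f ` A) ((`) f ` \<C>)"
  unfolding set_system_def
proof (intro conjI ballI allI impI)
  show "finite D" "D \<subseteq> f ` A" if "D \<in> (`) f ` \<C>" for D
    using that set_systemD(1,2)[OF assms(1)] by auto
  show "{} \<in> (`) f ` \<C>" using set_systemD(3)[OF assms(1)] by (simp add: image_iff)
  show "D \<inter> E \<in> (`) f ` \<C>" if DE: "D \<in> (`) f ` \<C>" "E \<in> (`) f ` \<C>" for D E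
  proof -
    obtain D' E' where D'E': "D' \<in> \<C>" "E' \<in> \<C>" "D = f ` D'" "E = f ` E'" using DE by blast
    then have "D \<inter> E = f ` (D' \<inter> E')"
      using inj_on_image_Int[OF assms(2)] set_systemD(2)[OF assms(1)] by simp
    then show ?thesis using set_systemD(4)[OF assms(1) D'E'(1,2)] by blast
  qed
  show "\<exists>D\<in>(`) f ` \<C>. Y \<subseteq> D" if Y: "finite Y" "Y \<subseteq> f ` A" for Y
  proof -
    obtain Z where Z: "Z \<subseteq> A" "finite Z" "Y = f ` Z" using finite_subset_image[OF Y] by blast
    then obtain D where "D \<in> \<C>" "Z \<subseteq> D" using set_systemD(5)[OF assms(1)] by blast
    then show ?thesis using Z by blast
  qed
  fix a b c assume abc: "a \<in> f ` A" "b \<in> f ` A" "c \<in> f ` A" "a \<noteq> b" "b \<noteq> c" "a \<noteq> c"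
  then obtain x y z where xyz: "x \<in> A" "y \<in> A" "z \<in> A" "a = f x" "b = f y" "c = f z" by blast
  have dep: "dep ((`) f ` \<C>) (f u) (f v) (f w)" if "dep \<C> u v w" "u \<in> A" "v \<in> A" for u v w
  proof -
    have mem: "u \<in> C" if "f u \<in> f ` C" "C \<in> \<C>" "u \<in> A" for C u
      using that inj_on_image_mem_iff[OF assms(2)] set_systemD(2)[OF assms(1)] by blast
    show ?thesis unfolding dep_def
    proof (intro ballI impI)
      fix D assume "D \<in> (`) f ` \<C>" "f u \<in> D" "f v \<in> D"
      then obtain C where C: "C \<in> \<C>" "D = f ` C" by blast
      have "u \<in> C" "v \<in> C"
        using mem[of u C] mem[of v C] \<open>f u \<in> D\<close> \<open>f v \<in> D\<close> \<open>u \<in> A\<close> \<open>v \<in> A\<close> C by simp_all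
      then have "w \<in> C" using \<open>dep \<C> u v w\<close> C(1) by (simp add: dep_def)
      then show "f w \<in> D" using C(2) by blast
    qed
  qed
  have "x \<noteq> y" "y \<noteq> z" "x \<noteq> z" using abc xyz by auto
  from set_systemD(6)[OF assms(1) xyz(1-3) this] show "dep ((`) f ` \<C>) a b c \<or> dep ((`) f ` \<C>) b c a \<or> dep ((`) f ` \<C>) a c b"
    unfolding xyz(4-6) using dep[of x y z] dep[of y z x] dep[of x z y] xyz(1-3) by auto
qed

text \<open>If \<open>X\<close> were larger, there would be a set \<open>A\<close> of
  \<open>\<aleph>\<^sub>1\<close> elements and a point \<open>c\<close> outside everything that
  \<open>T\<close> yields from pairs of \<open>A\<close>. For distinct points of \<open>A\<close>
  the triple with \<open>c\<close> then leaves two alternatives, so one of the points lies in the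
  finite set \<open>S\<close> of the other. This is impossible on an uncountable set.\<close>

lemma kuratowski_bound:
  assumes fin: "\<And>a b. a \<in> X \<Longrightarrow> b \<in> X \<Longrightarrow> finite {c \<in> X. T a b c}"
    and free: "\<And>a b c. a \<in> X \<Longrightarrow> b \<in> X \<Longrightarrow> c \<in> X \<Longrightarrow> a \<noteq> b \<Longrightarrow> b \<noteq> c \<Longrightarrow> a \<noteq> c \<Longrightarrow>
       T a b c \<or> T b c a \<or> T a c b"
  shows "|X| \<le>o |UNIV :: omega1 set|"
proof (rule ccontr)
  let ?W = "UNIV :: omega1 set"
  assume neg: "\<not> |X| \<le>o |?W|"
  with ordLeq_total[OF card_of_Well_order[of X] card_of_Well_order[of ?W]]
  have "|?W| \<le>o |X|" by simp
  then have "\<exists>g. inj_on g ?W \<and> g ` ?W \<subseteq> X" by (simp only: card_of_ordLeq)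
  then obtain g where g: "inj_on g ?W" "range g \<subseteq> X" by blast
  define A where "A = range g"
  have cA: "|A| \<le>o |?W|" unfolding A_def by (rule card_of_image)
  have uA: "uncountable A" unfolding A_def using uncountable_omega1 countable_image_inj_on[OF _ g(1)] by blast
  let ?B = "A \<union> (\<Union>a\<in>A. \<Union>b\<in>A. {c \<in> X. T a b c})"
  have "|{c \<in> X. T a b c}| \<le>o |?W|" if "a \<in> A" "b \<in> A" for a b
  proof -
    let ?F = "{c \<in> X. T a b c}"
    have "a \<in> X" "b \<in> X" using that g(2) by (auto simp: A_def)
    then have fF: "finite ?F" by (rule fin)
    have "\<not> |?W| \<le>o |?F|"
      using card_of_ordLeq_finite[OF _ fF, of ?W] infinite_omega1 by blast
    with ordLeq_total[OF card_of_Well_order[of ?F] card_of_Well_order[of ?W]]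
    show ?thesis by simp
  qed
  then have "|\<Union>b\<in>A. {c \<in> X. T a b c}| \<le>o |?W|" if "a \<in> A" for a
    using that by (intro card_of_UNION_ordLeq_infinite[OF infinite_omega1 cA]) auto
  then have "|\<Union>a\<in>A. \<Union>b\<in>A. {c \<in> X. T a b c}| \<le>o |?W|"
    by (intro card_of_UNION_ordLeq_infinite[OF infinite_omega1 cA]) auto
  then have "|?B| \<le>o |?W|" using cA infinite_omega1
    by (simp add: card_of_Un_ordLeq_infinite_Field Field_card_of card_of_card_order_on)
  then have "|X| \<le>o |?W|" if "X \<subseteq> ?B"
    by (rule ordLeq_transitive[OF card_of_mono1[OF that]])
  with neg have "\<not> X \<subseteq> ?B" by (rule contrapos_nn)
  then obtain c where c: "c \<in> X" "c \<notin> ?B" by blast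
  define S where "S a = {a' \<in> X. T a c a'}" for a
  have AX: "A \<subseteq> X" using g(2) by (simp add: A_def)
  have finS: "finite (S a)" if "a \<in> A" for a unfolding S_def using fin[of a c] that AX c(1) by auto
  have S: "a' \<in> S a \<or> a \<in> S a'" if "a \<in> A" "a' \<in> A" "a \<noteq> a'" for a a'
    using free[of a a' c] that c AX unfolding S_def by blast
  have "infinite A" using uA countable_finite by blast
  \<comment> \<open>Countably many points \<open>f n\<close> and their finite sets
    \<open>S (f n)\<close> do not exhaust \<open>A\<close>. A point \<open>a\<close> beyond them
    lies in no \<open>S (f n)\<close>, so every \<open>f n\<close> would have to lie in the finite
    set \<open>S a\<close>.\<close>
  then obtain f :: "nat \<Rightarrow> 'a" where f: "inj f" "range f \<subseteq> A"
    using infinite_countable_subset by blast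
  have "countable (range f \<union> (\<Union>n. S (f n)))"
    using finS f(2) by (simp add: countable_finite subset_iff)
  then have "\<not> A \<subseteq> range f \<union> (\<Union>n. S (f n))" using uA countable_subset by blast
  then obtain a where a: "a \<in> A" "a \<notin> range f" "\<And>n. a \<notin> S (f n)" by blast
  have "f n \<in> S a" for n using S[of a "f n"] a f(2) by blast
  then have "range f \<subseteq> S a" by blast
  then have "finite (range f)" using finS[OF a(1)] finite_subset by blast
  then show False using f(1) finite_imageD by blast
qed

section \<open>A homogeneous set system of cardinality \<open>\<aleph>\<^sub>1\<close>\<close>

type_synonym point = "omega1 \<times> nat"

text \<open>
  The task \<open>(xs, xs', ys, ds)\<close> of stage \<open>\<alpha>\<close> asks to extend the partial isomorphism from \<open>xs\<close> to \<open>ys\<close>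
  to \<open>xs'\<close>, by new points in block \<open>\<alpha>\<close> with the levels \<open>ds\<close>.
\<close>

type_synonym task = "point list \<times> point list \<times> point list \<times> level list"

lemma card_UNIV_prod:
  assumes "|UNIV :: 'a set| \<le>o |B|" "|UNIV :: 'b set| \<le>o |B|" "infinite B"
  shows "|UNIV :: ('a \<times> 'b) set| \<le>o |B|"
  unfolding UNIV_Times_UNIV[symmetric]
  by (rule card_of_Times_ordLeq_infinite_Field)
    (use assms in \<open>simp_all add: Field_card_of card_of_card_order_on\<close>)

lemma card_UNIV_list:
  assumes "|UNIV :: 'a set| \<le>o |B|" "infinite B"
  shows "|UNIV :: 'a list set| \<le>o |B|"
  using card_lists_ordLeq[OF assms(2,1)] by simp

text \<open>Pairs of an ordinal and a task are injected into \<open>omega1\<close>. The pairs with a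
  fixed task have an uncountable image, which is unbounded because initial segments are
  countable.\<close>

lemma task_enumeration: "\<exists>task :: omega1 \<Rightarrow> task. \<forall>t \<beta>. \<exists>\<alpha>>\<beta>. task \<alpha> = t"
proof -
  let ?W = "UNIV :: omega1 set"
  have c0: "|?W| \<le>o |?W|" by (simp add: card_of_mono1)
  have "|UNIV :: nat set| \<le>o |?W|" "|UNIV :: rat set| \<le>o |?W|"
  proof -
    show n: "|UNIV :: nat set| \<le>o |?W|" using infinite_omega1 infinite_iff_card_of_nat by blast
    have "|UNIV :: rat set| \<le>o |UNIV :: nat set|" using countable_iff_ordLeq_nat by blast
    then show "|UNIV :: rat set| \<le>o |?W|" by (rule ordLeq_transitive[OF _ n])
  qed
  note c = this
  have p: "|UNIV :: point set| \<le>o |?W|" by (rule card_UNIV_prod[OF c0 c(1) infinite_omega1])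
  have l: "|UNIV :: level set| \<le>o |?W|" by (rule card_UNIV_prod[OF c0 c(2) infinite_omega1])
  have "|UNIV :: task set| \<le>o |?W|"
    by (intro card_UNIV_prod card_UNIV_list p l infinite_omega1)
  then have "|UNIV :: (omega1 \<times> task) set| \<le>o |?W|"
    by (rule card_UNIV_prod[OF c0 _ infinite_omega1])
  then have "\<exists>f :: omega1 \<times> task \<Rightarrow> omega1. inj_on f UNIV \<and> f ` UNIV \<subseteq> ?W" by (simp only: card_of_ordLeq)
  then obtain f :: "omega1 \<times> task \<Rightarrow> omega1" where f: "inj f" by blast
  have "\<exists>\<alpha>>\<beta>. snd (inv f \<alpha>) = t" for t \<beta>
  proof -
    have "uncountable (range (\<lambda>\<gamma>. f (\<gamma>, t)))"
    proof
      assume "countable (range (\<lambda>\<gamma>. f (\<gamma>, t)))"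
      then have "countable ?W" by (rule countable_image_inj_on) (rule inj_onI, use f in \<open>auto dest: injD\<close>)
      then show False using uncountable_omega1 by simp
    qed
    moreover have "{..\<beta>} = insert \<beta> {..<\<beta>}" by auto
    then have "countable {..\<beta>}" using countable_lessThan_omega1 by simp
    ultimately have "\<not> range (\<lambda>\<gamma>. f (\<gamma>, t)) \<subseteq> {..\<beta>}" using countable_subset by blast
    then obtain \<gamma> where "\<not> f (\<gamma>, t) \<le> \<beta>" by blast
    then have "\<beta> < f (\<gamma>, t)" by simp
    then show ?thesis using f by (intro exI[of _ "f (\<gamma>, t)"]) (simp add: inv_f_f)
  qed
  then show ?thesis by (intro exI[of _ "\<lambda>\<alpha>. snd (inv f \<alpha>)"]) blast
qed

definition tmap :: "'a list \<Rightarrow> 'b list \<Rightarrow> 'a \<Rightarrow> 'b" where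
  "tmap xs ys x = the (map_of (zip xs ys) x)"

lemma tmap_nth: "distinct xs \<Longrightarrow> length xs = length ys \<Longrightarrow> i < length xs \<Longrightarrow> tmap xs ys (xs ! i) = ys ! i"
  unfolding tmap_def by (simp add: map_of_zip_nth)

lemma bij_tmap:
  assumes "distinct xs" "distinct ys" "length xs = length ys"
  shows "bij_betw (tmap xs ys) (set xs) (set ys)"
  unfolding bij_betw_def
proof
  show "inj_on (tmap xs ys) (set xs)"
  proof (rule inj_onI)
    fix x x' assume "x \<in> set xs" "x' \<in> set xs" and eq: "tmap xs ys x = tmap xs ys x'"
    then obtain i j where ij: "i < length xs" "x = xs ! i" "j < length xs" "x' = xs ! j"
      by (auto simp: in_set_conv_nth)
    then have "ys ! i = ys ! j" using eq tmap_nth[OF assms(1,3)] by simp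
    then show "x = x'" using ij assms nth_eq_iff_index_eq[OF assms(2)] by simp
  qed
  show "tmap xs ys ` set xs = set ys"
  proof -
    have "tmap xs ys ` set xs = (\<lambda>i. tmap xs ys (xs ! i)) ` {..<length xs}"
      by (auto simp: set_conv_nth image_iff)
    also have "\<dots> = (!) ys ` {..<length ys}" using tmap_nth[OF assms(1,3)] assms(3) by (intro image_cong) auto
    also have "\<dots> = set ys" by (auto simp: set_conv_nth image_iff)
    finally show ?thesis .
  qed
qed

lemma tmap_append:
  assumes "length xs = length ys" "x \<in> set xs"
  shows "tmap (xs @ xs') (ys @ ys') x = tmap xs ys x"
proof -
  obtain y where "map_of (zip xs ys) x = Some y" using assms map_of_zip_is_Some[of xs ys x] by auto
  then show ?thesis using assms(1) by (simp add: tmap_def map_add_def)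
qed

text \<open>Domain and image have to be members, hence finite and closed under \<open>dep\<close> in
  a set system; these are the sets over which \<open>set_system_amalgam\<close> amalgamates.\<close>

definition partial_iso :: "'e set set \<Rightarrow> 'e set \<Rightarrow> ('e \<Rightarrow> 'e) \<Rightarrow> bool" where
  "partial_iso \<A> A h \<longleftrightarrow> A \<in> \<A> \<and> h ` A \<in> \<A> \<and> inj_on h A \<and> (\<forall>C\<subseteq>A. C \<in> \<A> \<longleftrightarrow> h ` C \<in> \<A>)"

section \<open>The construction in \<open>omega1\<close> stages, one task at each stage\<close>

context
  fixes task :: "omega1 \<Rightarrow> task"
  assumes task: "\<And>t \<beta>. \<exists>\<alpha>>\<beta>. task \<alpha> = t"
begin

definition src where "src \<alpha> = fst (task \<alpha>)"
definition src' where "src' \<alpha> = fst (snd (task \<alpha>))"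
definition tgt where "tgt \<alpha> = fst (snd (snd (task \<alpha>)))"
definition lev where "lev \<alpha> = snd (snd (snd (task \<alpha>)))"
definition fresh where "fresh \<alpha> = map (Pair \<alpha>) [0..<length (lev \<alpha>)]"
text \<open>The underlying set is fixed in advance by the lengths of the level lists, so that only
  the set system has to be built by recursion.\<close>

definition points :: "point set" where "points = {x. snd x < length (lev (fst x))}"
definition upto where "upto \<alpha> = {x \<in> points. fst x \<le> \<alpha>}"
definition below where "below \<alpha> = {x \<in> points. fst x < \<alpha>}"
definition point_level where "point_level x = lev (fst x) ! snd x"

definition valid :: "point set set \<Rightarrow> omega1 \<Rightarrow> bool" where
  "valid F \<alpha> \<longleftrightarrow> length (tgt \<alpha>) = length (src \<alpha>) \<and> length (lev \<alpha>) = length (src' \<alpha>) \<and>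
     distinct (src \<alpha> @ src' \<alpha>) \<and> distinct (tgt \<alpha>) \<and> set (tgt \<alpha>) \<in> F \<and> set (src \<alpha>) \<in> F \<and>
     set (src \<alpha> @ src' \<alpha>) \<in> F \<and> (\<forall>C\<subseteq>set (src \<alpha>). C \<in> F \<longleftrightarrow> tmap (src \<alpha>) (tgt \<alpha>) ` C \<in> F)"

definition realized :: "point set set \<Rightarrow> point set set \<Rightarrow> omega1 \<Rightarrow> bool" where
  "realized F R \<alpha> \<longleftrightarrow> (\<forall>C\<subseteq>set (src \<alpha> @ src' \<alpha>).
     C \<in> F \<longleftrightarrow> tmap (src \<alpha> @ src' \<alpha>) (tgt \<alpha> @ fresh \<alpha>) ` C \<in> R)"

lemma upto_eq: "upto \<alpha> = below \<alpha> \<union> set (fresh \<alpha>)" and fresh_disjoint: "set (fresh \<alpha>) \<inter> below \<alpha> = {}"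
  by (auto simp: upto_def below_def fresh_def points_def)

lemma countable_below: "countable (below \<alpha>)"
proof -
  have "below \<alpha> \<subseteq> {..<\<alpha>} \<times> UNIV" by (auto simp: below_def)
  moreover have "countable ({..<\<alpha>} \<times> (UNIV :: nat set))"
    using countable_lessThan_omega1 by (intro countable_SIGMA) simp_all
  ultimately show ?thesis by (rule countable_subset)
qed

text \<open>A valid task transports the system on the extended source to the target together with
  the fresh points, and the copy is amalgamated over the target. The fresh points of an invalid task
  still have to be accommodated; they are added as one block over the empty set.\<close>

lemma set_system_step:
  assumes F: "set_system (below \<alpha>) F"
  shows "\<exists>R. set_system (upto \<alpha>) R \<and> end_extension (below \<alpha>) F (upto \<alpha>) R \<and> (valid F \<alpha> \<longrightarrow> realized F R \<alpha>)"
proof (cases "valid F \<alpha>")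
  case False
  let ?N = "set (fresh \<alpha>)"
  have N: "set_system ({} \<union> ?N) {{}, ?N}"
    unfolding set_system_def dep_def by auto
  have "\<exists>\<B>. set_system (below \<alpha> \<union> ?N) \<B> \<and> end_extension (below \<alpha>) F (below \<alpha> \<union> ?N) \<B> \<and>
      end_extension ({} \<union> ?N) {{}, ?N} (below \<alpha> \<union> ?N) \<B>"
    by (rule set_system_amalgam[OF F countable_below _ fresh_disjoint _ N])
      (use set_systemD(3)[OF F] in auto)
  then show ?thesis using False upto_eq by auto
next
  case True
  define as as' bs where "as = src \<alpha>" and "as' = src' \<alpha>" and "bs = tgt \<alpha>"
  let ?N = "set (fresh \<alpha>)" and ?h = "tmap (as @ as') (bs @ fresh \<alpha>)"
  have v: "length bs = length as" "length (fresh \<alpha>) = length as'" "distinct (as @ as')" "distinct bs"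
    "set bs \<in> F" "set as \<in> F" "set (as @ as') \<in> F" "\<And>C. C \<subseteq> set as \<Longrightarrow> C \<in> F \<longleftrightarrow> tmap as bs ` C \<in> F"
    using True unfolding valid_def as_def as'_def bs_def fresh_def by simp_all
  have bsb: "set bs \<subseteq> below \<alpha>" by (rule set_systemD(2)[OF F v(5)])
  have "distinct (fresh \<alpha>)" by (simp add: fresh_def distinct_map inj_on_def)
  then have d: "distinct (bs @ fresh \<alpha>)" using v(4) bsb fresh_disjoint by auto
  have bij: "bij_betw ?h (set (as @ as')) (set (bs @ fresh \<alpha>))"
    by (rule bij_tmap[OF v(3) d]) (use v(1,2) in simp)
  then have inj: "inj_on ?h (set (as @ as'))" and im: "?h ` set (as @ as') = set bs \<union> ?N"
    by (auto simp: bij_betw_def)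
  have hC: "?h ` C = tmap as bs ` C" if "C \<subseteq> set as" for C
    using that tmap_append[OF v(1)[symmetric]] by (intro image_cong) auto
  have bij0: "bij_betw (tmap as bs) (set as) (set bs)"
    by (rule bij_tmap) (use v in auto)
  have has: "?h ` set as = set bs" using hC[of "set as"] bij0 by (simp add: bij_betw_def)
  \<comment> \<open>The transported system. It induces the given one on \<open>set bs\<close>,
    because the map from \<open>as\<close> to \<open>bs\<close> is already a partial isomorphism;
    this is what amalgamation over \<open>set bs\<close> requires.\<close>
  define \<C> where "\<C> = (`) ?h ` {C \<in> F. C \<subseteq> set (as @ as')}"
  have C: "set_system (set bs \<union> ?N) \<C>"
    using set_system_image[OF set_system_restrict[OF F v(7)] inj] unfolding im \<C>_def .
  have "\<exists>\<B>. set_system (below \<alpha> \<union> ?N) \<B> \<and> end_extension (below \<alpha>) F (below \<alpha> \<union> ?N) \<B> \<and>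
      end_extension (set bs \<union> ?N) \<C> (below \<alpha> \<union> ?N) \<B>"
  proof (rule set_system_amalgam[OF F countable_below _ fresh_disjoint v(5) C])
    show "set bs \<union> ?N \<in> \<C>" unfolding \<C>_def im[symmetric] using v(7) by blast
    show "D \<inter> set bs \<in> F" if D: "D \<in> \<C>" for D
    proof -
      obtain C where C: "C \<in> F" "C \<subseteq> set (as @ as')" "D = ?h ` C" using D unfolding \<C>_def by blast
      have "D \<inter> set bs = ?h ` C \<inter> ?h ` set as" unfolding has C(3) ..
      also have "\<dots> = ?h ` (C \<inter> set as)" by (rule inj_on_image_Int[OF inj C(2), symmetric]) simp
      also have "\<dots> = tmap as bs ` (C \<inter> set as)" by (rule hC) simp
      also have "\<dots> \<in> F" using v(8)[of "C \<inter> set as"] set_systemD(4)[OF F C(1) v(6)] by simp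
      finally show ?thesis .
    qed
    show "D \<in> \<C>" if D: "D \<in> F" "D \<subseteq> set bs" for D
    proof -
      obtain C where C: "C \<subseteq> set as" "D = tmap as bs ` C"
        using D(2) bij0 by (metis bij_betw_def subset_imageE)
      then have "C \<in> F" using v(8)[OF C(1)] D(1) by simp
      moreover have "D = ?h ` C" using hC[OF C(1)] C(2) by simp
      ultimately show ?thesis using C(1) unfolding \<C>_def by auto
    qed
  qed simp
  then obtain \<B> where \<B>: "set_system (upto \<alpha>) \<B>" "end_extension (below \<alpha>) F (upto \<alpha>) \<B>"
    "end_extension (set bs \<union> ?N) \<C> (upto \<alpha>) \<B>" unfolding upto_eq by blast
  have "realized F \<B> \<alpha>" unfolding realized_def as_def[symmetric] as'_def[symmetric] bs_def[symmetric]
  proof (intro allI impI)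
    fix C assume C: "C \<subseteq> set (as @ as')"
    then have sub: "?h ` C \<subseteq> set bs \<union> ?N" unfolding im[symmetric] by (rule image_mono)
    have "?h ` C \<in> \<C> \<longleftrightarrow> C \<in> F"
    proof
      assume "?h ` C \<in> \<C>"
      then obtain C' where C': "C' \<in> F" "C' \<subseteq> set (as @ as')" "?h ` C = ?h ` C'" unfolding \<C>_def by blast
      then have "C = C'" using inj_on_image_eq_iff[OF inj C C'(2)] by simp
      then show "C \<in> F" using C'(1) by simp
    qed (use C in \<open>auto simp: \<C>_def\<close>)
    then show "C \<in> F \<longleftrightarrow> ?h ` C \<in> \<B>" using end_extension_mem[OF \<B>(3) sub] by simp
  qed
  then show ?thesis using \<B>(1,2) by blast
qed

definition prior :: "(omega1 \<Rightarrow> point set set) \<Rightarrow> omega1 \<Rightarrow> point set set" where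
  "prior f \<alpha> = insert {} (\<Union>\<beta>\<in>{..<\<alpha>}. f \<beta>)"

definition stage_ok :: "(omega1 \<Rightarrow> point set set) \<Rightarrow> omega1 \<Rightarrow> point set set \<Rightarrow> bool" where
  "stage_ok f \<alpha> R \<longleftrightarrow> set_system (upto \<alpha>) R \<and> end_extension (below \<alpha>) (prior f \<alpha>) (upto \<alpha>) R \<and>
     (valid (prior f \<alpha>) \<alpha> \<longrightarrow> realized (prior f \<alpha>) R \<alpha>)"

lemma below_eq: "below \<alpha> = (\<Union>\<beta>\<in>{..<\<alpha>}. upto \<beta>)"
  by (auto simp: below_def upto_def)

text \<open>\<open>stage_ok\<close> compares a stage only with the union of the earlier ones. That
  this union extends each of them presupposes their coherence, which is the induction
  hypothesis.\<close>

lemma stage_chain: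
  assumes "\<And>\<gamma>. \<gamma> \<le> \<beta> \<Longrightarrow> stage_ok f \<gamma> (f \<gamma>)" "\<gamma> < \<beta>"
  shows "end_extension (upto \<gamma>) (f \<gamma>) (upto \<beta>) (f \<beta>)"
  using assms
proof (induction \<beta> arbitrary: \<gamma> rule: less_induct)
  case (less \<beta>)
  have "end_extension (upto \<gamma>) (f \<gamma>) (\<Union>\<gamma>\<in>{..<\<beta>}. upto \<gamma>) (insert {} (\<Union>\<gamma>\<in>{..<\<beta>}. f \<gamma>))"
  proof (rule set_system_union(2))
    show "set_system (upto i) (f i)" if "i \<in> {..<\<beta>}" for i
      using less.prems(1)[of i] that by (simp add: stage_ok_def)
    show "end_extension (upto i) (f i) (upto j) (f j)" if "i \<in> {..<\<beta>}" "j \<in> {..<\<beta>}" "i < j" for i j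
      by (rule less.IH) (use that less.prems(1) in auto)
  qed (use less.prems in simp)
  moreover have "end_extension (below \<beta>) (prior f \<beta>) (upto \<beta>) (f \<beta>)"
    using less.prems(1)[of \<beta>] by (simp add: stage_ok_def)
  ultimately show ?case unfolding below_eq prior_def by (rule end_extension_trans)
qed

lemma stages_exist: "\<exists>f. \<forall>\<alpha>. stage_ok f \<alpha> (f \<alpha>)"
proof (rule dependent_wf_choice[of "{(x, y). x < y}"])
  show "wf {(x, y :: omega1). x < y}" by (rule wf)
  show "stage_ok f \<alpha> R = stage_ok g \<alpha> R" if "\<And>\<beta>. (\<beta>, \<alpha>) \<in> {(x, y). x < y} \<Longrightarrow> f \<beta> = g \<beta>" for f g \<alpha> R
  proof -
    have "prior f \<alpha> = prior g \<alpha>" unfolding prior_def using that by simp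
    then show ?thesis by (simp add: stage_ok_def)
  qed
  fix \<alpha> f assume "\<And>\<beta>. (\<beta>, \<alpha>) \<in> {(x, y). x < y} \<Longrightarrow> stage_ok f \<beta> (f \<beta>)"
  then have ok: "stage_ok f \<beta> (f \<beta>)" if "\<beta> < \<alpha>" for \<beta> using that by simp
  have "set_system (\<Union>\<beta>\<in>{..<\<alpha>}. upto \<beta>) (insert {} (\<Union>\<beta>\<in>{..<\<alpha>}. f \<beta>))"
  proof (rule set_system_union(1))
    show "set_system (upto i) (f i)" if "i \<in> {..<\<alpha>}" for i
      using ok[of i] that by (simp add: stage_ok_def)
    show "end_extension (upto i) (f i) (upto j) (f j)" if "i \<in> {..<\<alpha>}" "j \<in> {..<\<alpha>}" "i < j" for i j
      by (rule stage_chain) (use that ok in auto)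
  qed
  then show "\<exists>R. stage_ok f \<alpha> R"
    using set_system_step unfolding stage_ok_def below_eq[symmetric] prior_def[symmetric] by simp
qed

text \<open>Every extension problem is a task, and each task recurs above every ordinal. The levels
  \<open>g\<close> of the new points are arbitrary because the set system never looks at levels;
  this makes homogeneity compatible with the order of the levels.\<close>

lemma rich_set_system_exists:
  "\<exists>\<A>. set_system points \<A> \<and> (\<forall>A h A' g. partial_iso \<A> A h \<longrightarrow> A' \<in> \<A> \<longrightarrow> A \<subseteq> A' \<longrightarrow>
     (\<exists>h'. partial_iso \<A> A' h' \<and> (\<forall>a\<in>A. h' a = h a) \<and> (\<forall>a\<in>A' - A. point_level (h' a) = g a)))"
proof -
  obtain f where f: "\<And>\<alpha>. stage_ok f \<alpha> (f \<alpha>)" using stages_exist by blast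
  define \<A> where "\<A> = insert {} (\<Union>\<alpha>. f \<alpha>)"
  have points: "points = (\<Union>\<alpha>. upto \<alpha>)" by (auto simp: upto_def)
  have sys: "set_system (upto \<alpha>) (f \<alpha>)" for \<alpha> using f[of \<alpha>] by (simp add: stage_ok_def)
  have chain: "end_extension (upto \<gamma>) (f \<gamma>) (upto \<beta>) (f \<beta>)" if "\<gamma> < \<beta>" for \<gamma> \<beta>
    by (rule stage_chain[OF f that])
  have A: "set_system points \<A>" unfolding points \<A>_def
    by (rule set_system_union(1)[OF sys chain])
  have ext: "end_extension (upto \<alpha>) (f \<alpha>) points \<A>" for \<alpha> unfolding points \<A>_def
    by (rule set_system_union(2)[OF sys chain]) simp_all
  have ext': "end_extension (below \<alpha>) (prior f \<alpha>) points \<A>" for \<alpha>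
    using f[of \<alpha>] end_extension_trans[OF _ ext[of \<alpha>]] by (simp add: stage_ok_def)
  have "\<exists>h'. partial_iso \<A> A' h' \<and> (\<forall>a\<in>A. h' a = h a) \<and> (\<forall>a\<in>A' - A. point_level (h' a) = g a)"
    if h: "partial_iso \<A> A h" and A': "A' \<in> \<A>" "A \<subseteq> A'" for A h A' g
  proof -
    have h: "A \<in> \<A>" "h ` A \<in> \<A>" "inj_on h A" "\<And>C. C \<subseteq> A \<Longrightarrow> C \<in> \<A> \<longleftrightarrow> h ` C \<in> \<A>"
      using h unfolding partial_iso_def by simp_all
    have fin: "finite A" "finite A'" "finite (h ` A)" using set_systemD(1)[OF A] h A' by auto
    have sub: "A' \<subseteq> points" "h ` A \<subseteq> points" using set_systemD(2)[OF A] h A' by auto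
    obtain as where as: "set as = A" "distinct as" using finite_distinct_list[OF fin(1)] by blast
    obtain as' where as': "set as' = A' - A" "distinct as'" using finite_distinct_list[of "A' - A"] fin(2) by blast
    have un: "set (as @ as') = A'" using as(1) as'(1) A'(2) by auto
    define bs where "bs = map h as"
    have "countable (fst ` (A' \<union> h ` A))" using fin by (simp add: countable_finite)
    then obtain \<beta> where \<beta>: "\<And>\<gamma>. \<gamma> \<in> fst ` (A' \<union> h ` A) \<Longrightarrow> \<gamma> < \<beta>" by (rule countable_bounded_omega1) blast
    \<comment> \<open>The stage lies beyond all blocks that meet \<open>A'\<close> or the image of
      \<open>h\<close>, so the system prior to it already decides which of their subsets are
      members.\<close>
    obtain \<alpha> where \<alpha>: "\<beta> < \<alpha>" "task \<alpha> = (as, as', bs, map g as')" using task by blast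
    have t: "src \<alpha> = as" "src' \<alpha> = as'" "tgt \<alpha> = bs" "lev \<alpha> = map g as'"
      using \<alpha>(2) by (simp_all add: src_def src'_def tgt_def lev_def)
    have "fst x < \<alpha>" if "x \<in> A' \<union> h ` A" for x using \<beta>[of "fst x"] that \<alpha>(1) by auto
    then have bel: "A' \<subseteq> below \<alpha>" "h ` A \<subseteq> below \<alpha>" using sub by (auto simp: below_def)
    have mem: "C \<in> prior f \<alpha> \<longleftrightarrow> C \<in> \<A>" if "C \<subseteq> below \<alpha>" for C
      using end_extension_mem[OF ext' that] by simp
    have tm: "tmap as bs x = h x" if "x \<in> A" for x
    proof -
      obtain i where "i < length as" "x = as ! i" using \<open>x \<in> A\<close> as(1) by (auto simp: in_set_conv_nth)
      then show ?thesis using tmap_nth[OF as(2), of bs i] by (simp add: bs_def)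
    qed
    have tmC: "tmap as bs ` C = h ` C" if "C \<subseteq> A" for C using tm that by (intro image_cong) auto
    have bsA: "set bs = h ` A" using as(1) by (simp add: bs_def)
    have dbs: "distinct bs" using as h(3) by (simp add: bs_def distinct_map)
    have val: "valid (prior f \<alpha>) \<alpha>"
      unfolding valid_def t
    proof (intro conjI allI impI)
      show "distinct (as @ as')" using as as' by auto
      show "set bs \<in> prior f \<alpha>" using mem[of "h ` A"] bel h(2) bsA by simp
      show "set as \<in> prior f \<alpha>" using mem[of A] bel h(1) as(1) A'(2) by auto
      show "set (as @ as') \<in> prior f \<alpha>" using mem[of A'] bel A'(1) un by simp
      show "C \<in> prior f \<alpha> \<longleftrightarrow> tmap as bs ` C \<in> prior f \<alpha>" if C: "C \<subseteq> set as" for C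
      proof -
        have CA: "C \<subseteq> A" using C as(1) by simp
        then have "C \<subseteq> below \<alpha>" "h ` C \<subseteq> below \<alpha>" using bel A'(2) by auto
        then show ?thesis using mem[of C] mem[of "h ` C"] h(4)[OF CA] tmC[OF CA] by simp
      qed
    qed (simp_all add: bs_def dbs[unfolded bs_def])
    then have real: "realized (prior f \<alpha>) (f \<alpha>) \<alpha>" using f[of \<alpha>] by (simp add: stage_ok_def)
    define h' where "h' = tmap (as @ as') (bs @ fresh \<alpha>)"
    have lf: "length (fresh \<alpha>) = length as'" by (simp add: fresh_def t)
    have lb: "length as = length bs" by (simp add: bs_def)
    have dis: "distinct (bs @ fresh \<alpha>)"
      using dbs bsA bel(2) fresh_disjoint[of \<alpha>] by (auto simp: fresh_def distinct_map inj_on_def)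
    have das: "distinct (as @ as')" using as as' by auto
    have bij: "bij_betw h' A' (set (bs @ fresh \<alpha>))"
      using bij_tmap[OF das dis] lf lb unfolding h'_def un by simp
    have im: "h' ` A' \<subseteq> upto \<alpha>" using bij bsA bel(2) unfolding bij_betw_def upto_eq by auto
    have iso: "C \<in> \<A> \<longleftrightarrow> h' ` C \<in> \<A>" if C: "C \<subseteq> A'" for C
    proof -
      have "C \<in> prior f \<alpha> \<longleftrightarrow> h' ` C \<in> f \<alpha>"
        using real C unfolding realized_def t h'_def un by simp
      moreover have "h' ` C \<subseteq> upto \<alpha>" using im C by blast
      ultimately show ?thesis using mem[of C] C bel(1) end_extension_mem[OF ext, of "h' ` C" \<alpha>] by auto
    qed
    have "partial_iso \<A> A' h'"
      unfolding partial_iso_def using A'(1) iso bij by (simp add: bij_betw_def)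
    moreover have "h' a = h a" if "a \<in> A" for a
      unfolding h'_def using tmap_append[OF lb] that as(1) tm by simp
    moreover have "point_level (h' a) = g a" if a: "a \<in> A' - A" for a
    proof -
      obtain i where i: "i < length as'" "a = as' ! i" using a as'(1) by (metis in_set_conv_nth)
      have "h' ((as @ as') ! (length as + i)) = (bs @ fresh \<alpha>) ! (length as + i)"
        unfolding h'_def by (rule tmap_nth[OF das]) (use i(1) lf lb in auto)
      then have "h' a = (\<alpha>, i)" using i lb lf by (simp add: nth_append fresh_def t)
      then show ?thesis using i by (simp add: point_level_def t)
    qed
    ultimately show ?thesis by blast
  qed
  then show ?thesis using A by blast
qed

lemma point_level_surj: "point_level ` points = UNIV"
proof -
  have "x \<in> point_level ` points" for x
  proof -
    obtain \<alpha> where "task \<alpha> = ([], [], [], [x])" using task by blast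
    then have "lev \<alpha> = [x]" by (simp add: lev_def)
    then have "(\<alpha>, 0) \<in> points" "point_level (\<alpha>, 0) = x" by (simp_all add: points_def point_level_def)
    then show ?thesis by force
  qed
  then show ?thesis by blast
qed

end


section \<open>The typing of tuples of indices\<close>

definition ordered_iso :: "'e set set \<Rightarrow> ('e \<Rightarrow> 'o :: linorder) \<Rightarrow> 'e set \<Rightarrow> ('e \<Rightarrow> 'e) \<Rightarrow> bool" where
  "ordered_iso \<A> q A h \<longleftrightarrow> partial_iso \<A> A h \<and> (\<forall>a\<in>A. \<forall>b\<in>A. q a < q b \<longleftrightarrow> q (h a) < q (h b))"

definition iso_tuples :: "'e set set \<Rightarrow> ('e \<Rightarrow> 'o :: linorder) \<Rightarrow> 'e list \<Rightarrow> 'e list \<Rightarrow> bool" where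
  "iso_tuples \<A> q xs ys \<longleftrightarrow> (\<exists>A h. ordered_iso \<A> q A h \<and> set xs \<subseteq> A \<and> ys = map h xs)"

lemma ordered_iso_inverse:
  assumes "ordered_iso \<A> q A h"
  shows "ordered_iso \<A> q (h ` A) (inv_into A h)"
proof -
  let ?g = "inv_into A h"
  have h: "A \<in> \<A>" "h ` A \<in> \<A>" "inj_on h A" "\<And>C. C \<subseteq> A \<Longrightarrow> C \<in> \<A> \<longleftrightarrow> h ` C \<in> \<A>"
    "\<And>a b. a \<in> A \<Longrightarrow> b \<in> A \<Longrightarrow> q a < q b \<longleftrightarrow> q (h a) < q (h b)"
    using assms unfolding ordered_iso_def partial_iso_def by simp_all
  have gh: "?g (h a) = a" if "a \<in> A" for a using inv_into_f_f[OF h(3) that] .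
  have ghC: "?g ` h ` C = C" if "C \<subseteq> A" for C
  proof -
    have "?g ` h ` C = (\<lambda>x. ?g (h x)) ` C" by (rule image_image)
    also have "\<dots> = (\<lambda>x. x) ` C" by (intro image_cong refl gh subsetD[OF that])
    finally show ?thesis by simp
  qed
  show ?thesis unfolding ordered_iso_def partial_iso_def
  proof (intro conjI ballI allI impI)
    show "?g ` h ` A \<in> \<A>" using ghC[of A] h(1) by simp
    show "inj_on ?g (h ` A)" by (rule inj_on_inv_into) simp
    show "D \<in> \<A> \<longleftrightarrow> ?g ` D \<in> \<A>" if "D \<subseteq> h ` A" for D
    proof -
      obtain C where "C \<subseteq> A" "D = h ` C" using \<open>D \<subseteq> h ` A\<close> by (rule subset_imageE)
      then show ?thesis using h(4)[of C] ghC[of C] by simp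
    qed
    show "q a < q b \<longleftrightarrow> q (?g a) < q (?g b)" if ab: "a \<in> h ` A" "b \<in> h ` A" for a b
    proof -
      obtain x y where "x \<in> A" "a = h x" "y \<in> A" "b = h y" using ab by blast
      then show ?thesis using h(5)[of x y] gh by simp
    qed
  qed (rule h(2))
qed

lemma ordered_iso_dep:
  assumes sys: "set_system X \<A>" and iso: "ordered_iso \<A> q A h" and mem: "a \<in> A" "b \<in> A" "c \<in> A"
    and dep: "dep \<A> a b c"
  shows "dep \<A> (h a) (h b) (h c)"
  unfolding dep_def
proof (intro ballI impI)
  have h: "A \<in> \<A>" "h ` A \<in> \<A>" "inj_on h A" "\<And>C. C \<subseteq> A \<Longrightarrow> C \<in> \<A> \<longleftrightarrow> h ` C \<in> \<A>"
    using iso unfolding ordered_iso_def partial_iso_def by simp_all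
  fix D assume D: "D \<in> \<A>" "h a \<in> D" "h b \<in> D"
  have "D \<inter> h ` A \<in> \<A>" by (rule set_systemD(4)[OF sys D(1) h(2)])
  moreover obtain C where C: "C \<subseteq> A" "D \<inter> h ` A = h ` C" using subset_imageE[of "D \<inter> h ` A" h A] by blast
  ultimately have "C \<in> \<A>" using h(4)[OF C(1)] by simp
  have memC: "h x \<in> D \<longleftrightarrow> x \<in> C" if "x \<in> A" for x
  proof -
    have "h x \<in> D \<longleftrightarrow> h x \<in> h ` C" unfolding C(2)[symmetric] using that by blast
    then show ?thesis using inj_on_image_mem_iff[OF h(3) that C(1)] by simp
  qed
  have "a \<in> C" "b \<in> C" using memC mem D(2,3) by auto
  then have "c \<in> C" using dep \<open>C \<in> \<A>\<close> by (simp add: dep_def)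
  then show "h c \<in> D" using memC mem(3) by simp
qed

lemma iso_tuples_sym:
  assumes "iso_tuples \<A> q xs ys"
  shows "iso_tuples \<A> q ys xs"
proof -
  obtain A h where h: "ordered_iso \<A> q A h" "set xs \<subseteq> A" "ys = map h xs"
    using assms unfolding iso_tuples_def by blast
  have "inj_on h A" using h(1) unfolding ordered_iso_def partial_iso_def by simp
  then have "map (inv_into A h) ys = xs" unfolding h(3) map_map
    using h(2) by (intro map_idI) auto
  moreover have "set ys \<subseteq> h ` A" using h(2,3) by auto
  ultimately show ?thesis using ordered_iso_inverse[OF h(1)] unfolding iso_tuples_def by metis
qed

text \<open>Finite data that determine the position of \<open>xs\<close> in the member
  \<open>set zs\<close> up to \<open>ordered_iso\<close>, so there are only countably many codes;
  \<open>subseqs\<close> runs through all subsets of positions.\<close>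

definition iso_code :: "'e set set \<Rightarrow> ('e \<Rightarrow> 'o :: linorder) \<Rightarrow> 'e list \<Rightarrow> 'e list \<Rightarrow>
    nat \<times> bool list \<times> bool list \<times> nat list" where
  "iso_code \<A> q zs xs = (length zs,
     map (\<lambda>I. set (map ((!) zs) I) \<in> \<A>) (subseqs [0..<length zs]),
     map (\<lambda>(i, j). q (zs ! i) < q (zs ! j)) (List.product [0..<length zs] [0..<length zs]),
     map (\<lambda>x. SOME i. i < length zs \<and> zs ! i = x) xs)"

lemma iso_code_imp:
  assumes zs: "distinct zs" "set zs \<in> \<A>" "set xs \<subseteq> set zs"
    and zs': "distinct zs'" "set zs' \<in> \<A>" "set xs' \<subseteq> set zs'"
    and eq: "iso_code \<A> q zs xs = iso_code \<A> q zs' xs'"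
  shows "iso_tuples \<A> q xs xs'"
proof -
  let ?h = "tmap zs zs'" and ?idx = "\<lambda>zs x. SOME i. i < length zs \<and> zs ! i = x"
  have len: "length zs = length zs'"
    and subs: "\<And>I. I \<in> set (subseqs [0..<length zs]) \<Longrightarrow>
      set (map ((!) zs) I) \<in> \<A> \<longleftrightarrow> set (map ((!) zs') I) \<in> \<A>"
    and ord: "\<And>i j. i < length zs \<Longrightarrow> j < length zs \<Longrightarrow> q (zs ! i) < q (zs ! j) \<longleftrightarrow> q (zs' ! i) < q (zs' ! j)"
    and idx: "map (?idx zs) xs = map (?idx zs') xs'"
    using eq unfolding iso_code_def by auto
  have h: "?h (zs ! i) = zs' ! i" if "i < length zs" for i by (rule tmap_nth[OF zs(1) len that])
  have bij: "bij_betw ?h (set zs) (set zs')" by (rule bij_tmap[OF zs(1) zs'(1) len])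
  have iso: "C \<in> \<A> \<longleftrightarrow> ?h ` C \<in> \<A>" if C: "C \<subseteq> set zs" for C
  proof -
    let ?I = "{i. i < length zs \<and> zs ! i \<in> C}"
    have "?I \<in> set ` set (subseqs [0..<length zs])" unfolding subseqs_powset by auto
    then obtain I where I: "I \<in> set (subseqs [0..<length zs])" "set I = ?I" by auto
    have "set (map ((!) zs) I) = C" using C unfolding set_map I(2) by (force simp: in_set_conv_nth)
    moreover have "set (map ((!) zs') I) = ?h ` set (map ((!) zs) I)"
      unfolding set_map I(2) image_image using h by (intro image_cong) auto
    ultimately show ?thesis using subs[OF I(1)] by simp
  qed
  have "q a < q b \<longleftrightarrow> q (?h a) < q (?h b)" if ab: "a \<in> set zs" "b \<in> set zs" for a b
  proof -
    obtain i j where "i < length zs" "a = zs ! i" "j < length zs" "b = zs ! j"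
      using ab by (metis in_set_conv_nth)
    then show ?thesis using ord[of i j] h by simp
  qed
  then have oi: "ordered_iso \<A> q (set zs) ?h"
    unfolding ordered_iso_def partial_iso_def using zs(2) zs'(2) bij iso by (simp add: bij_betw_def)
  have idxP: "?idx zs x < length zs \<and> zs ! ?idx zs x = x" if "x \<in> set zs" for zs and x :: 'a
    by (rule someI_ex) (use that in \<open>auto simp: in_set_conv_nth\<close>)
  have lx: "length xs = length xs'" using arg_cong[OF idx, of length] by simp
  have "xs' = map ?h xs"
  proof (rule nth_equalityI)
    fix i assume i: "i < length xs'"
    have "?idx zs (xs ! i) = ?idx zs' (xs' ! i)" using arg_cong[OF idx, of "\<lambda>l. l ! i"] i lx by simp
    moreover have "xs ! i \<in> set zs" "xs' ! i \<in> set zs'" using i lx zs(3) zs'(3) by auto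
    ultimately have "?h (xs ! i) = xs' ! i" using idxP[of "xs ! i" zs] idxP[of "xs' ! i" zs'] h by metis
    then show "xs' ! i = map ?h xs ! i" using i lx by simp
  qed (simp add: lx)
  then show ?thesis using oi zs(3) unfolding iso_tuples_def by blast
qed

text \<open>Everything that the tree uses about indices. The set system itself is hidden behind
  \<open>T\<close>, whose two properties are the hypotheses of
  \<open>kuratowski_bound\<close>.\<close>

definition index_typing :: "point set \<Rightarrow> (point \<Rightarrow> level) \<Rightarrow> (point \<Rightarrow> point \<Rightarrow> point \<Rightarrow> bool) \<Rightarrow>
    (point list \<Rightarrow> nat) \<Rightarrow> bool" where
  "index_typing X q T s \<longleftrightarrow> type_equiv X s X s \<and> q ` X = UNIV \<and>
     (\<forall>xs ys i j. set xs \<subseteq> X \<longrightarrow> set ys \<subseteq> X \<longrightarrow> s xs = s ys \<longrightarrow> i < length xs \<longrightarrow> j < length xs \<longrightarrow>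
        (q (xs ! i) < q (xs ! j) \<longleftrightarrow> q (ys ! i) < q (ys ! j))) \<and>
     (\<forall>xs ys i j k. set xs \<subseteq> X \<longrightarrow> set ys \<subseteq> X \<longrightarrow> s xs = s ys \<longrightarrow>
        i < length xs \<longrightarrow> j < length xs \<longrightarrow> k < length xs \<longrightarrow>
        (T (xs ! i) (xs ! j) (xs ! k) \<longleftrightarrow> T (ys ! i) (ys ! j) (ys ! k))) \<and>
     (\<forall>a\<in>X. \<forall>b\<in>X. finite {c \<in> X. T a b c}) \<and>
     (\<forall>a\<in>X. \<forall>b\<in>X. \<forall>c\<in>X. a \<noteq> b \<longrightarrow> b \<noteq> c \<longrightarrow> a \<noteq> c \<longrightarrow> T a b c \<or> T b c a \<or> T a c b)"

lemma index_typing_exists: "\<exists>X q T s. index_typing X q T s"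
proof -
  obtain task :: "omega1 \<Rightarrow> task" where t: "\<forall>t \<beta>. \<exists>\<alpha>>\<beta>. task \<alpha> = t"
    using task_enumeration by blast
  then have task: "\<exists>\<alpha>>\<beta>. task \<alpha> = t" for t \<beta> by blast
  define X q where "X = points task" and "q = point_level task"
  obtain \<A> where sys: "set_system X \<A>"
    and rich: "\<And>A h A' g. partial_iso \<A> A h \<Longrightarrow> A' \<in> \<A> \<Longrightarrow> A \<subseteq> A' \<Longrightarrow>
       \<exists>h'. partial_iso \<A> A' h' \<and> (\<forall>a\<in>A. h' a = h a) \<and> (\<forall>a\<in>A' - A. q (h' a) = g a)"
    using rich_set_system_exists[OF task] unfolding X_def q_def by metis
  let ?S = "iso_tuples \<A> q"
  have closed_list: "\<exists>zs. distinct zs \<and> set zs \<in> \<A> \<and> set xs \<subseteq> set zs" if xs: "set xs \<subseteq> X" for xs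
  proof -
    obtain A where "A \<in> \<A>" "set xs \<subseteq> A" using set_systemD(5)[OF sys _ xs] by auto
    moreover obtain zs where "set zs = A" "distinct zs"
      using finite_distinct_list[OF set_systemD(1)[OF sys \<open>A \<in> \<A>\<close>]] by blast
    ultimately show ?thesis by blast
  qed
  define cl where "cl xs = (SOME zs. distinct zs \<and> set zs \<in> \<A> \<and> set xs \<subseteq> set zs)" for xs
  have cl: "distinct (cl xs)" "set (cl xs) \<in> \<A>" "set xs \<subseteq> set (cl xs)" if "set xs \<subseteq> X" for xs
    using someI_ex[OF closed_list[OF that]] unfolding cl_def by auto
  have "\<exists>s. typing_of X ?S s"
  proof (rule typing_exists[where code = "\<lambda>xs. to_nat (iso_code \<A> q (cl xs) xs)"])
    fix xs ys assume xs: "set xs \<subseteq> X" and ys: "set ys \<subseteq> X"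
    show "?S xs ys" if "to_nat (iso_code \<A> q (cl xs) xs) = to_nat (iso_code \<A> q (cl ys) ys)"
      using iso_code_imp[OF cl[OF xs] cl[OF ys]] that by simp
    assume S: "?S xs ys"
    then obtain A h where h: "ordered_iso \<A> q A h" "set xs \<subseteq> A" "ys = map h xs"
      unfolding iso_tuples_def by blast
    have hp: "A \<in> \<A>" "h ` A \<in> \<A>" "inj_on h A" "partial_iso \<A> A h"
      "\<forall>a\<in>A. \<forall>b\<in>A. q a < q b \<longleftrightarrow> q (h a) < q (h b)"
      using h(1) unfolding ordered_iso_def partial_iso_def by simp_all
    show "length xs = length ys" by (simp add: h(3))
    show "?S ys xs" by (rule iso_tuples_sym[OF S])
    show "xs ! i = xs ! j \<longleftrightarrow> ys ! i = ys ! j" if "i < length xs" "j < length xs" for i j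
    proof -
      have "xs ! i \<in> A" "xs ! j \<in> A" using that h(2) by auto
      then show ?thesis using inj_on_eq_iff[OF hp(3)] that by (simp add: h(3))
    qed
    show "?S (map ((!) xs) is) (map ((!) ys) is)" if "set is \<subseteq> {..<length xs}" for "is"
    proof -
      have "set (map ((!) xs) is) \<subseteq> A" using that h(2) by force
      moreover have "map ((!) ys) is = map h (map ((!) xs) is)" using that by (auto simp: h(3))
      ultimately show ?thesis using h(1) unfolding iso_tuples_def by blast
    qed
    show "\<exists>b\<in>X. ?S (xs @ [a]) (ys @ [b])" if a: "a \<in> X" for a
    proof -
      have "finite (insert a A)" "insert a A \<subseteq> X" using set_systemD(1,2)[OF sys hp(1)] a by auto
      then obtain A' where A': "A' \<in> \<A>" "insert a A \<subseteq> A'" using set_systemD(5)[OF sys] by metis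
      have finA: "finite A" "finite A'" using set_systemD(1)[OF sys] hp(1) A'(1) by auto
      \<comment> \<open>Levels for the images of \<open>A'\<close>: those of \<open>h\<close> on
        \<open>A\<close>, and on the rest any levels in the same order position. Richness provides
        points with whatever levels are chosen.\<close>
      obtain g where g: "\<forall>a\<in>A. g a = q (h a)" "\<forall>a\<in>A \<union> A'. \<forall>b\<in>A \<union> A'. q a < q b \<longleftrightarrow> g a < g b"
        using finite_order_extension[OF finA(2,1), of q "\<lambda>a. q (h a)"] hp(5) by blast
      obtain h' where h': "partial_iso \<A> A' h'" "\<forall>a\<in>A. h' a = h a" "\<forall>a\<in>A' - A. q (h' a) = g a"
        using rich[OF hp(4) A'(1), of g] A'(2) by blast
      have "q (h' a) = g a" if "a \<in> A'" for a using h'(2,3) g(1) that by (cases "a \<in> A") auto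
      then have oi: "ordered_iso \<A> q A' h'" using h'(1) g(2) unfolding ordered_iso_def by simp
      have "h' ` A' \<subseteq> X" using h'(1) set_systemD(2)[OF sys] unfolding partial_iso_def by blast
      then have "h' a \<in> X" using A'(2) by blast
      moreover have "ys @ [h' a] = map h' (xs @ [a])" using h'(2) h(2) by (auto simp: h(3))
      then have "?S (xs @ [a]) (ys @ [h' a])" unfolding iso_tuples_def using oi A'(2) h(2) by auto
      ultimately show ?thesis by blast
    qed
  qed
  then obtain s where s: "typing_of X ?S s" by blast
  have q_inv: "q (xs ! i) < q (xs ! j) \<longleftrightarrow> q (ys ! i) < q (ys ! j)"
    if "?S xs ys" "i < length xs" "j < length xs" for xs ys i j
  proof -
    obtain A h where h: "ordered_iso \<A> q A h" "set xs \<subseteq> A" "ys = map h xs"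
      using \<open>?S xs ys\<close> unfolding iso_tuples_def by blast
    have "xs ! i \<in> A" "xs ! j \<in> A" using that h(2) by auto
    then show ?thesis using h(1) that unfolding ordered_iso_def h(3) by simp
  qed
  have T_imp: "dep \<A> (ys ! i) (ys ! j) (ys ! k)"
    if S: "?S xs ys" and ijk: "i < length xs" "j < length xs" "k < length xs" and d: "dep \<A> (xs ! i) (xs ! j) (xs ! k)"
    for xs ys i j k
  proof -
    obtain A h where h: "ordered_iso \<A> q A h" "set xs \<subseteq> A" "ys = map h xs"
      using S unfolding iso_tuples_def by blast
    have "xs ! i \<in> A" "xs ! j \<in> A" "xs ! k \<in> A" using ijk h(2) by auto
    from ordered_iso_dep[OF sys h(1) this d] show ?thesis using ijk by (simp add: h(3))
  qed
  have lenS: "length xs = length ys" if "?S xs ys" for xs ys using that unfolding iso_tuples_def by auto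
  have "index_typing X q (dep \<A>) s"
    unfolding index_typing_def
  proof (intro conjI allI impI ballI)
    show "type_equiv X s X s" by (rule typing_of_type_equiv[OF s])
    show "q ` X = UNIV" unfolding X_def q_def by (rule point_level_surj[OF task])
    show "finite {c \<in> X. dep \<A> a b c}" if ab: "a \<in> X" "b \<in> X" for a b
    proof -
      obtain A where "A \<in> \<A>" "{a, b} \<subseteq> A" using set_systemD(5)[OF sys, of "{a, b}"] ab by auto
      then have "{c \<in> X. dep \<A> a b c} \<subseteq> A" unfolding dep_def by blast
      then show ?thesis using set_systemD(1)[OF sys \<open>A \<in> \<A>\<close>] finite_subset by blast
    qed
    show "dep \<A> a b c \<or> dep \<A> b c a \<or> dep \<A> a c b"
      if "a \<in> X" "b \<in> X" "c \<in> X" "a \<noteq> b" "b \<noteq> c" "a \<noteq> c" for a b c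
      by (rule set_systemD(6)[OF sys that])
  next
    fix xs ys i j assume *: "set xs \<subseteq> X" "set ys \<subseteq> X" "s xs = s ys" "i < length xs" "j < length xs"
    let ?P = "\<lambda>zs. i < length zs \<and> j < length zs \<and> (q (xs ! i) < q (xs ! j) \<longleftrightarrow> q (zs ! i) < q (zs ! j))"
    have step: "?P vs" if "?S us vs" "?P us" for us vs
      using q_inv[OF that(1), of i j] lenS[OF that(1)] that(2) by simp
    have "?P xs" using *(4,5) by simp
    then have "?P ys" by (rule typing_of_invariant[where P = ?P, OF s *(1-3)]) (rule step)
    then show "q (xs ! i) < q (xs ! j) \<longleftrightarrow> q (ys ! i) < q (ys ! j)" by simp
  next
    fix xs ys i j k assume *: "set xs \<subseteq> X" "set ys \<subseteq> X" "s xs = s ys"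
      "i < length xs" "j < length xs" "k < length xs"
    let ?P = "\<lambda>zs. i < length zs \<and> j < length zs \<and> k < length zs \<and> dep \<A> (zs ! i) (zs ! j) (zs ! k)"
    have step: "?P vs" if "?S us vs" "?P us" for us vs
      using T_imp[OF that(1), of i j k] lenS[OF that(1)] that(2) by simp
    have len: "length xs = length ys" by (rule type_equiv_length[OF typing_of_type_equiv[OF s] *(1-3)])
    have "?P ys" if "?P xs" by (rule typing_of_invariant[where P = ?P, OF s *(1-3) that]) (rule step)
    moreover have "?P xs" if "?P ys"
      by (rule typing_of_invariant[where P = ?P, OF s *(2,1) *(3)[symmetric] that]) (rule step)
    ultimately show "dep \<A> (xs ! i) (xs ! j) (xs ! k) \<longleftrightarrow> dep \<A> (ys ! i) (ys ! j) (ys ! k)"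
      using *(4-6) len by auto
  qed
  then show ?thesis by blast
qed

section \<open>The tree of branches\<close>

text \<open>A set of pairs rather than two parallel tuples, because the maps over nodes collect
  pairs from several sources and are cut down to subsets.\<close>

definition type_map :: "'a set \<Rightarrow> ('a list \<Rightarrow> nat) \<Rightarrow> ('a \<times> 'a) set \<Rightarrow> bool" where
  "type_map U s p \<longleftrightarrow> p \<subseteq> U \<times> U \<and> (\<forall>ps. set ps \<subseteq> p \<longrightarrow> s (map fst ps) = s (map snd ps))"

lemma type_map_mono: "type_map U s q \<Longrightarrow> p \<subseteq> q \<Longrightarrow> type_map U s p"
  unfolding type_map_def by (meson order_trans)

lemma type_map_lists: "type_map U s p \<Longrightarrow> set ps \<subseteq> p \<Longrightarrow> s (map fst ps) = s (map snd ps)"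
  unfolding type_map_def by simp

lemma type_map_zip:
  assumes "type_equiv U s U s" "set us \<subseteq> U" "set vs \<subseteq> U" "s us = s vs"
  shows "type_map U s (set (zip us vs))"
  unfolding type_map_def using assms(2,3) type_equiv_zip[OF assms]
  by (auto dest: set_zip_leftD set_zip_rightD)

lemma type_map_converse:
  assumes "type_map U s p"
  shows "type_map U s (p\<inverse>)"
  unfolding type_map_def
proof (intro conjI allI impI)
  show "p\<inverse> \<subseteq> U \<times> U" using assms by (auto simp: type_map_def)
  fix ps assume "set ps \<subseteq> p\<inverse>"
  then have "set (map prod.swap ps) \<subseteq> p" by auto
  from type_map_lists[OF assms this] show "s (map fst ps) = s (map snd ps)" by (simp add: comp_def)
qed

lemma type_map_extend:
  assumes te: "type_equiv U s U s" and p: "type_map U s p" "finite p" and a: "a \<in> U"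
  obtains b where "b \<in> U" "type_map U s (insert (a, b) p)"
proof -
  obtain ps where ps: "set ps = p" using finite_list[OF p(2)] by blast
  have U: "set (map fst ps) \<subseteq> U" "set (map snd ps) \<subseteq> U" using p(1) ps by (auto simp: type_map_def)
  have eq: "s (map fst ps) = s (map snd ps)" by (rule type_map_lists[OF p(1)]) (simp add: ps)
  obtain b where b: "b \<in> U" "s (map fst ps @ [a]) = s (map snd ps @ [b])"
    using type_equiv_forth[OF te U eq a] by blast
  have "type_map U s (set (zip (map fst ps @ [a]) (map snd ps @ [b])))"
    by (rule type_map_zip[OF te _ _ b(2)]) (use U a b(1) in auto)
  moreover have "set (zip (map fst ps @ [a]) (map snd ps @ [b])) = insert (a, b) p"
    using ps by (simp add: zip_map_fst_snd)
  ultimately show ?thesis using that[OF b(1)] by simp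
qed

lemma type_map_eq:
  assumes te: "type_equiv U s U s" and p: "type_map U s p" and "(a, b) \<in> p" "(a', b') \<in> p"
  shows "a = a' \<longleftrightarrow> b = b'"
proof -
  have "s (map fst [(a, b), (a', b')]) = s (map snd [(a, b), (a', b')])"
    by (rule type_map_lists[OF p]) (use assms in auto)
  then have eq: "s [a, a'] = s [b, b']" by simp
  have U: "set [a, a'] \<subseteq> U" "set [b, b'] \<subseteq> U" using p assms(3,4) by (auto simp: type_map_def)
  show ?thesis using type_equiv_eq[OF te U eq, of 0 1] by simp
qed

section \<open>Well-ordered supports and the splitting of branches\<close>

definition well_ordered :: "'o :: linorder set \<Rightarrow> bool" where
  "well_ordered A \<longleftrightarrow> (\<forall>S\<subseteq>A. S \<noteq> {} \<longrightarrow> (\<exists>m\<in>S. \<forall>x\<in>S. m \<le> x))"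

lemma well_ordered_subset: "well_ordered B \<Longrightarrow> A \<subseteq> B \<Longrightarrow> well_ordered A"
  unfolding well_ordered_def by (meson order_trans)

lemma well_ordered_least: "well_ordered A \<Longrightarrow> S \<subseteq> A \<Longrightarrow> S \<noteq> {} \<Longrightarrow> \<exists>m\<in>S. \<forall>x\<in>S. m \<le> x"
  unfolding well_ordered_def by simp

lemma well_ordered_singleton: "well_ordered {a}"
  unfolding well_ordered_def by (auto simp: subset_singleton_iff)

lemma well_ordered_Un:
  assumes "well_ordered A" "well_ordered B"
  shows "well_ordered (A \<union> B)"
  unfolding well_ordered_def
proof (intro allI impI)
  fix S assume S: "S \<subseteq> A \<union> B" "S \<noteq> {}"
  show "\<exists>m\<in>S. \<forall>x\<in>S. m \<le> x"
  proof (cases "S \<inter> A = {} \<or> S \<inter> B = {}")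
    case True
    then have "S \<subseteq> A \<or> S \<subseteq> B" using S(1) by blast
    then show ?thesis using well_ordered_least[OF assms(1) _ S(2)] well_ordered_least[OF assms(2) _ S(2)] by blast
  next
    case False
    obtain m where m: "m \<in> S \<inter> A" "\<forall>x\<in>S \<inter> A. m \<le> x"
      using well_ordered_least[OF assms(1), of "S \<inter> A"] False by auto
    obtain n where n: "n \<in> S \<inter> B" "\<forall>x\<in>S \<inter> B. n \<le> x"
      using well_ordered_least[OF assms(2), of "S \<inter> B"] False by auto
    have "min m n \<le> x" if "x \<in> S" for x
      using m(2) n(2) S(1) that by (metis IntI UnE min.coboundedI1 min.coboundedI2 subsetD)
    moreover have "min m n \<in> S" using m(1) n(1) by (simp add: min_def)
    ultimately show ?thesis by blast
  qed
qed

definition agree :: "('o :: linorder \<Rightarrow> 'a) \<Rightarrow> ('o \<Rightarrow> 'a) \<Rightarrow> 'o \<Rightarrow> bool" where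
  "agree f g d \<longleftrightarrow> (\<forall>e<d. f e = g e)"

definition splits :: "('o :: linorder \<Rightarrow> 'a) \<Rightarrow> ('o \<Rightarrow> 'a) \<Rightarrow> 'o \<Rightarrow> bool" where
  "splits f g d \<longleftrightarrow> agree f g d \<and> f d \<noteq> g d"

lemma agree_refl [simp]: "agree f f d" by (simp add: agree_def)

lemma agree_sym: "agree f g d \<longleftrightarrow> agree g f d" by (auto simp: agree_def)

lemma agree_trans: "agree f g d \<Longrightarrow> agree g h d \<Longrightarrow> agree f h d" by (simp add: agree_def)

lemma agree_less: "agree f g d \<Longrightarrow> e < d \<Longrightarrow> f e = g e" by (simp add: agree_def)

lemma agree_mono: "agree f g d \<Longrightarrow> e \<le> d \<Longrightarrow> agree f g e" by (auto simp: agree_def)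

lemma splits_sym: "splits f g d \<longleftrightarrow> splits g f d" by (auto simp: splits_def agree_def)

lemma splits_neq: "splits f g d \<Longrightarrow> f \<noteq> g" by (auto simp: splits_def)

lemma splits_agree: "splits f g d \<Longrightarrow> agree f g e \<longleftrightarrow> e \<le> d"
  unfolding splits_def agree_def by (metis not_le_imp_less order_less_le_trans)

lemma splits_unique: "splits f g d \<Longrightarrow> splits f g e \<Longrightarrow> d = e"
  by (metis splits_agree order_antisym splits_def)

lemma splits_agree_left:
  assumes "splits f g d" "agree f h e" "d < e"
  shows "splits h g d"
proof -
  have "agree h f d" using agree_mono[OF assms(2)] assms(3) agree_sym by (metis less_imp_le)
  moreover have "h d = f d" using agree_less[OF assms(2,3)] by simp
  ultimately show ?thesis using assms(1) agree_trans unfolding splits_def by metis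
qed

type_synonym 'a elem = "(level \<Rightarrow> 'a) \<times> point \<times> 'a"

abbreviation branch :: "'a elem \<Rightarrow> level \<Rightarrow> 'a" where "branch u \<equiv> fst u"
abbreviation index :: "'a elem \<Rightarrow> point" where "index u \<equiv> fst (snd u)"
abbreviation val :: "'a elem \<Rightarrow> 'a" where "val u \<equiv> snd (snd u)"

context
  fixes I :: "point set" and q :: "point \<Rightarrow> level" and T and ti :: "point list \<Rightarrow> nat"
    and K :: "'a set" and tk :: "'a list \<Rightarrow> nat" and d0 :: 'a
  assumes index: "index_typing I q T ti" and teK: "type_equiv K tk K tk" and d0: "d0 \<in> K"
begin

text \<open>With a single 1-type, a point of a branch may go to any other point of \<open>D\<close>
  over a node where nothing else is prescribed.\<close>

definition D :: "'a set" where "D = {d \<in> K. tk [d] = tk [d0]}"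

text \<open>The levels are not well-ordered, but the union of two well-ordered supports is, so two
  distinct branches have a first level of difference.\<close>

definition F :: "(level \<Rightarrow> 'a) set" where "F = {f. range f \<subseteq> D \<and> well_ordered {e. f e \<noteq> d0}}"

definition elems :: "'a elem set" where "elems = F \<times> I \<times> K"

text \<open>The node of an element is its level together with the restriction of its branch below this level.\<close>

definition same_node :: "'a elem \<Rightarrow> 'a elem \<Rightarrow> bool" where
  "same_node u v \<longleftrightarrow> q (index u) = q (index v) \<and> agree (branch u) (branch v) (q (index u))"

definition on_branch :: "'a elem \<Rightarrow> bool" where
  "on_branch u \<longleftrightarrow> val u = branch u (q (index u))"

lemma teI: "type_equiv I ti I ti" and q_surj: "q ` I = UNIV"
  using index by (simp_all add: index_typing_def)

lemma d0_D: "d0 \<in> D" by (simp add: D_def d0)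

lemma type_map_D: "a \<in> D \<Longrightarrow> b \<in> D \<Longrightarrow> type_map K tk {(a, b)}"
  using type_map_zip[OF teK, of "[a]" "[b]"] by (simp add: D_def)

lemma F_D: "f \<in> F \<Longrightarrow> f e \<in> D" by (auto simp: F_def)

lemma splits_exists:
  assumes "f \<in> F" "g \<in> F" "f \<noteq> g"
  shows "\<exists>d. splits f g d"
proof -
  let ?S = "{e. f e \<noteq> g e}"
  have wo: "well_ordered ({e. f e \<noteq> d0} \<union> {e. g e \<noteq> d0})"
    by (rule well_ordered_Un) (use assms(1,2) in \<open>simp_all add: F_def\<close>)
  have sub: "?S \<subseteq> {e. f e \<noteq> d0} \<union> {e. g e \<noteq> d0}" by auto
  have ne: "?S \<noteq> {}" using assms(3) by auto
  obtain m where m: "m \<in> ?S" "\<forall>x\<in>?S. m \<le> x" using well_ordered_least[OF wo sub ne] by blast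
  have "f e = g e" if "e < m" for e
  proof (rule ccontr)
    assume "f e \<noteq> g e"
    then have "m \<le> e" using m(2) by blast
    then show False using that by simp
  qed
  then have "splits f g m" using m(1) by (simp add: splits_def agree_def)
  then show ?thesis ..
qed

section \<open>Finite partial maps of branches and indices\<close>

lemma type_map_q:
  assumes "type_map I ti l" "(z, w) \<in> l" "(z', w') \<in> l"
  shows "q z < q z' \<longleftrightarrow> q w < q w'"
proof -
  have "ti (map fst [(z, w), (z', w')]) = ti (map snd [(z, w), (z', w')])"
    by (rule type_map_lists[OF assms(1)]) (use assms in auto)
  then have eq: "ti [z, z'] = ti [w, w']" by simp
  have U: "set [z, z'] \<subseteq> I" "set [w, w'] \<subseteq> I" using assms by (auto simp: type_map_def)
  have "\<forall>xs ys i j. set xs \<subseteq> I \<longrightarrow> set ys \<subseteq> I \<longrightarrow> ti xs = ti ys \<longrightarrow> i < length xs \<longrightarrow> j < length xs \<longrightarrow>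
        (q (xs ! i) < q (xs ! j) \<longleftrightarrow> q (ys ! i) < q (ys ! j))"
    using index by (simp add: index_typing_def)
  from this[rule_format, OF U eq, of 0 1] show ?thesis by simp
qed

lemma type_map_q_le:
  "type_map I ti l \<Longrightarrow> (z, w) \<in> l \<Longrightarrow> (z', w') \<in> l \<Longrightarrow> q z \<le> q z' \<longleftrightarrow> q w \<le> q w'"
  using type_map_q[of l z' w' z w] by (simp flip: not_less)

lemma type_map_q_eq:
  "type_map I ti l \<Longrightarrow> (z, w) \<in> l \<Longrightarrow> (z', w') \<in> l \<Longrightarrow> q z = q z' \<longleftrightarrow> q w = q w'"
  using type_map_q_le[of l z w z' w'] type_map_q_le[of l z' w' z w] by auto

text \<open>Two branches are compared only through their splitting level. Requiring an index of
  \<open>l\<close> at each such level gives it an image, and these images are ordered as the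
  originals since \<open>ti\<close> decides the order of levels.\<close>

definition frame :: "((level \<Rightarrow> 'a) \<times> (level \<Rightarrow> 'a)) set \<Rightarrow> (point \<times> point) set \<Rightarrow> bool" where
  "frame p l \<longleftrightarrow> finite p \<and> finite l \<and> p \<subseteq> F \<times> F \<and> type_map I ti l \<and>
     (\<forall>f g f' g'. (f, g) \<in> p \<longrightarrow> (f', g') \<in> p \<longrightarrow> (f = f' \<longleftrightarrow> g = g') \<and>
        (\<forall>d. splits f f' d \<longrightarrow> (\<exists>z w. (z, w) \<in> l \<and> q z = d \<and> splits g g' (q w))))"

lemma frameD:
  assumes "frame p l"
  shows "finite p" "finite l" "(f, g) \<in> p \<Longrightarrow> f \<in> F" "(f, g) \<in> p \<Longrightarrow> g \<in> F" "type_map I ti l"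
    "(f, g) \<in> p \<Longrightarrow> (f', g') \<in> p \<Longrightarrow> f = f' \<longleftrightarrow> g = g'"
    "(f, g) \<in> p \<Longrightarrow> (f', g') \<in> p \<Longrightarrow> splits f f' d \<Longrightarrow> \<exists>z w. (z, w) \<in> l \<and> q z = d \<and> splits g g' (q w)"
  using assms unfolding frame_def by blast+

lemma frame_split:
  assumes "frame p l" "(f, g) \<in> p" "(f', g') \<in> p" "f \<noteq> f'"
  obtains z w where "(z, w) \<in> l" "splits f f' (q z)" "splits g g' (q w)"
proof -
  obtain d where d: "splits f f' d"
    using splits_exists[OF frameD(3)[OF assms(1,2)] frameD(3)[OF assms(1,3)] assms(4)] by blast
  from frameD(7)[OF assms(1-3) d] d show ?thesis using that by blast
qed

text \<open>Branches agree up to a level exactly if it is at most their splitting level, and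
  \<open>l\<close> preserves the order of levels.\<close>

lemma frame_agree:
  assumes fr: "frame p l" and p: "(f, g) \<in> p" "(f', g') \<in> p" and l: "(z, w) \<in> l"
  shows "agree f f' (q z) \<longleftrightarrow> agree g g' (q w)"
proof (cases "f = f'")
  case True
  then have "g = g'" using frameD(6)[OF fr p] by simp
  then show ?thesis using True by simp
next
  case False
  obtain z' w' where *: "(z', w') \<in> l" "splits f f' (q z')" "splits g g' (q w')"
    by (rule frame_split[OF fr p False])
  show ?thesis
    unfolding splits_agree[OF *(2)] splits_agree[OF *(3)] by (rule type_map_q_le[OF frameD(5)[OF fr] l *(1)])
qed

lemma frame_converse:
  assumes fr: "frame p l"
  shows "frame (p\<inverse>) (l\<inverse>)"
  unfolding frame_def
proof (intro conjI allI impI)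
  show "finite (p\<inverse>)" "finite (l\<inverse>)" using frameD(1,2)[OF fr] by simp_all
  show "p\<inverse> \<subseteq> F \<times> F" using frameD(3,4)[OF fr] by auto
  show "type_map I ti (l\<inverse>)" by (rule type_map_converse[OF frameD(5)[OF fr]])
  fix g f g' f' assume "(g, f) \<in> p\<inverse>" "(g', f') \<in> p\<inverse>"
  then have p: "(f, g) \<in> p" "(f', g') \<in> p" by simp_all
  show "g = g' \<longleftrightarrow> f = f'" using frameD(6)[OF fr p] by simp
  fix d assume d: "splits g g' d"
  have "f \<noteq> f'" using splits_neq[OF d] frameD(6)[OF fr p] by simp
  then obtain z w where *: "(z, w) \<in> l" "splits f f' (q z)" "splits g g' (q w)"
    by (rule frame_split[OF fr p])
  have "q w = d" by (rule splits_unique[OF *(3) d])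
  then show "\<exists>w z. (w, z) \<in> l\<inverse> \<and> q w = d \<and> splits f f' (q z)" using * by blast
qed

text \<open>
  A finite partial automorphism \<open>(p, l, c)\<close> of the tree moves branches by \<open>p\<close>, indices by \<open>l\<close> and
  elements by \<open>c\<close>. Over the node of \<open>f\<close> at level \<open>d\<close>, which goes to level \<open>e\<close>, it moves the points
  where branches pass and the values of elements; \<open>state\<close> requires these to form a partial
  automorphism of \<open>K\<close>.
\<close>

definition node_map :: "((level \<Rightarrow> 'a) \<times> (level \<Rightarrow> 'a)) set \<Rightarrow> ('a elem \<times> 'a elem) set \<Rightarrow>
    (level \<Rightarrow> 'a) \<Rightarrow> level \<Rightarrow> level \<Rightarrow> ('a \<times> 'a) set" where
  "node_map p c f d e = {(f' d, g' e) | f' g'. (f', g') \<in> p \<and> agree f f' d} \<union>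
     {(val u, val v) | u v. (u, v) \<in> c \<and> q (index u) = d \<and> agree f (branch u) d}"

lemma node_map_branchI: "(f', g') \<in> p \<Longrightarrow> agree f f' d \<Longrightarrow> (f' d, g' e) \<in> node_map p c f d e"
  unfolding node_map_def by blast

lemma node_map_valI:
  "(u, v) \<in> c \<Longrightarrow> q (index u) = d \<Longrightarrow> agree f (branch u) d \<Longrightarrow> (val u, val v) \<in> node_map p c f d e"
  unfolding node_map_def by blast

lemma node_map_cases:
  assumes "x \<in> node_map p c f d e"
  obtains f' g' where "x = (f' d, g' e)" "(f', g') \<in> p" "agree f f' d"
    | u v where "x = (val u, val v)" "(u, v) \<in> c" "q (index u) = d" "agree f (branch u) d"
  using assms unfolding node_map_def by blast

lemma node_map_insert_branch:
  "node_map (insert (f', g') p) c f d e =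
     (if agree f f' d then insert (f' d, g' e) (node_map p c f d e) else node_map p c f d e)"
proof -
  have "{(f'' d, g'' e) | f'' g''. (f'', g'') \<in> insert (f', g') p \<and> agree f f'' d} =
      (if agree f f' d then {(f' d, g' e)} else {}) \<union> {(f'' d, g'' e) | f'' g''. (f'', g'') \<in> p \<and> agree f f'' d}"
    by (cases "agree f f' d"; simp; blast)
  then show ?thesis unfolding node_map_def by simp
qed

lemma node_map_insert_val:
  "node_map p (insert (u, v) c) f d e =
     (if q (index u) = d \<and> agree f (branch u) d then insert (val u, val v) (node_map p c f d e)
      else node_map p c f d e)"
  unfolding node_map_def
  by (cases "q (index u) = d \<and> agree f (branch u) d") (simp only: if_True if_False simp_thms, blast)+

definition state :: "((level \<Rightarrow> 'a) \<times> (level \<Rightarrow> 'a)) set \<Rightarrow> (point \<times> point) set \<Rightarrow>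
    ('a elem \<times> 'a elem) set \<Rightarrow> bool" where
  "state p l c \<longleftrightarrow> frame p l \<and> finite c \<and>
     (\<forall>u v. (u, v) \<in> c \<longrightarrow> (branch u, branch v) \<in> p \<and> (index u, index v) \<in> l \<and> val u \<in> K \<and> val v \<in> K) \<and>
     (\<forall>f g z w. (f, g) \<in> p \<longrightarrow> (z, w) \<in> l \<longrightarrow> type_map K tk (node_map p c f (q z) (q w)))"

lemma stateD:
  assumes "state p l c"
  shows "frame p l" "finite c" "(u, v) \<in> c \<Longrightarrow> (branch u, branch v) \<in> p"
    "(u, v) \<in> c \<Longrightarrow> (index u, index v) \<in> l" "(u, v) \<in> c \<Longrightarrow> val u \<in> K" "(u, v) \<in> c \<Longrightarrow> val v \<in> K"
    "(f, g) \<in> p \<Longrightarrow> (z, w) \<in> l \<Longrightarrow> type_map K tk (node_map p c f (q z) (q w))"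
  using assms unfolding state_def by blast+

lemma finite_node_map:
  assumes "finite p" "finite c"
  shows "finite (node_map p c f d e)"
proof -
  have "node_map p c f d e \<subseteq> (\<lambda>(f', g'). (f' d, g' e)) ` p \<union> (\<lambda>(u, v). (val u, val v)) ` c"
  proof
    fix x assume "x \<in> node_map p c f d e"
    then show "x \<in> (\<lambda>(f', g'). (f' d, g' e)) ` p \<union> (\<lambda>(u, v). (val u, val v)) ` c"
    proof (cases rule: node_map_cases)
      case (1 f' g')
      then show ?thesis by (intro UnI1 image_eqI[of _ _ "(f', g')"]) simp_all
    next
      case (2 u v)
      then show ?thesis by (intro UnI2 image_eqI[of _ _ "(u, v)"]) simp_all
    qed
  qed
  then show ?thesis using assms finite_subset by blast
qed

lemma node_map_cong:
  assumes "agree f f' d"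
  shows "node_map p c f d e = node_map p c f' d e"
proof -
  have "agree f h d \<longleftrightarrow> agree f' h d" for h
    using assms agree_trans agree_sym by metis
  then show ?thesis by (simp add: node_map_def)
qed

lemma state_converse:
  assumes st: "state p l c"
  shows "state (p\<inverse>) (l\<inverse>) (c\<inverse>)"
  unfolding state_def
proof (intro conjI allI impI)
  note fr = stateD(1)[OF st]
  show "frame (p\<inverse>) (l\<inverse>)" by (rule frame_converse[OF fr])
  show "finite (c\<inverse>)" using stateD(2)[OF st] by simp
  show "(branch u, branch v) \<in> p\<inverse>" "(index u, index v) \<in> l\<inverse>" "val u \<in> K" "val v \<in> K"
    if "(u, v) \<in> c\<inverse>" for u v using stateD(3-6)[OF st, of v u] that by simp_all
  fix g f w z assume "(g, f) \<in> p\<inverse>" "(w, z) \<in> l\<inverse>"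
  then have *: "(f, g) \<in> p" "(z, w) \<in> l" by auto
  have "node_map (p\<inverse>) (c\<inverse>) g (q w) (q z) \<subseteq> (node_map p c f (q z) (q w))\<inverse>"
  proof
    fix ab assume "ab \<in> node_map (p\<inverse>) (c\<inverse>) g (q w) (q z)"
    then show "ab \<in> (node_map p c f (q z) (q w))\<inverse>"
    proof (cases rule: node_map_cases)
      case (1 g' f')
      then have p': "(f', g') \<in> p" by simp
      then have "agree f f' (q z)" using frame_agree[OF fr *(1) p' *(2)] 1(3) by simp
      then show ?thesis unfolding 1(1) converse_iff by (rule node_map_branchI[OF p'])
    next
      case (2 v u)
      then have c: "(u, v) \<in> c" by simp
      then have "agree f (branch u) (q z)" using frame_agree[OF fr *(1) stateD(3)[OF st c] *(2)] 2(4) by simp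
      moreover have "q (index u) = q z"
        using type_map_q_eq[OF frameD(5)[OF fr] stateD(4)[OF st c] *(2)] 2(3) by simp
      ultimately show ?thesis unfolding 2(1) converse_iff by (intro node_map_valI[OF c])
    qed
  qed
  then show "type_map K tk (node_map (p\<inverse>) (c\<inverse>) g (q w) (q z))"
    by (rule type_map_mono[OF type_map_converse[OF stateD(7)[OF st *]]])
qed

section \<open>Extending a state by an index, a branch or a value\<close>

lemma state_add_point:
  assumes st: "state p l c" and z: "z \<in> I"
  obtains w where "state p (insert (z, w) l) c"
proof -
  note fr = stateD(1)[OF st]
  obtain w where w: "w \<in> I" "type_map I ti (insert (z, w) l)"
    by (rule type_map_extend[OF teI frameD(5,2)[OF fr] z])
  have "frame p (insert (z, w) l)"
    unfolding frame_def
  proof (intro conjI allI impI)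
    fix f g f' g' assume p: "(f, g) \<in> p" "(f', g') \<in> p"
    show "f = f' \<longleftrightarrow> g = g'" by (rule frameD(6)[OF fr p])
    show "\<exists>z' w'. (z', w') \<in> insert (z, w) l \<and> q z' = d \<and> splits g g' (q w')" if "splits f f' d" for d
      using frameD(7)[OF fr p that] by blast
  qed (use fr w(2) in \<open>simp_all add: frame_def\<close>)
  moreover have "type_map K tk (node_map p c f (q z) (q w))" if f: "(f, g) \<in> p" for f g
  proof (cases "\<exists>z' w'. (z', w') \<in> l \<and> q z' = q z")
    case True
    then obtain z' w' where zw: "(z', w') \<in> l" "q z' = q z" by blast
    then have "q w' = q w" using type_map_q_eq[OF w(2), of z' w' z w] by simp
    then show ?thesis using stateD(7)[OF st f zw(1)] zw(2) by simp
  next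
    case False
    \<comment> \<open>At a new level there are no elements of \<open>c\<close>, and branches through
      the same node split only at a higher level of \<open>l\<close>, so they share their point
      here. What remains is one pair from \<open>D\<close>.\<close>
    have "node_map p c f (q z) (q w) \<subseteq> {(f (q z), g (q w))}"
    proof
      fix ab assume "ab \<in> node_map p c f (q z) (q w)"
      then show "ab \<in> {(f (q z), g (q w))}"
      proof (cases rule: node_map_cases)
        case (1 f' g')
        show ?thesis
        proof (cases "f = f'")
          case True
          then show ?thesis using frameD(6)[OF fr f 1(2)] 1(1) by simp
        next
          case ne: False
          obtain z' w' where *: "(z', w') \<in> l" "splits f f' (q z')" "splits g g' (q w')"
            by (rule frame_split[OF fr f 1(2) ne])
          have "q z \<le> q z'" using splits_agree[OF *(2)] 1(3) by simp
          moreover have "q z' \<noteq> q z" using False *(1) by blast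
          ultimately have less: "q z < q z'" by (simp add: le_less eq_commute)
          then have "q w < q w'" using type_map_q[OF w(2), of z w z' w'] *(1) by simp
          then have "g (q w) = g' (q w)"
            using *(3) agree_less[of g g' "q w'" "q w"] by (simp add: splits_def)
          moreover have "f (q z) = f' (q z)"
            using *(2) agree_less[of f f' "q z'" "q z"] less by (simp add: splits_def)
          ultimately show ?thesis using 1(1) by simp
        qed
      next
        case (2 u v)
        then show ?thesis using False stateD(4)[OF st 2(2)] by blast
      qed
    qed
    moreover have "type_map K tk {(f (q z), g (q w))}"
      by (rule type_map_D) (use F_D frameD(3,4)[OF fr f] in auto)
    ultimately show ?thesis by (rule type_map_mono[rotated])
  qed
  ultimately have "state p (insert (z, w) l) c"
    using st unfolding state_def by blast
  then show ?thesis by (rule that)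
qed

lemma F_fun: 
  assumes "g0 \<in> F" "b \<in> D"
  shows "(\<lambda>d. if d < e then g0 d else if d = e then b else d0) \<in> F"
proof -
  let ?g = "\<lambda>d. if d < e then g0 d else if d = e then b else d0"
  have "well_ordered ({d. g0 d \<noteq> d0} \<union> {e})"
    by (rule well_ordered_Un[OF _ well_ordered_singleton]) (use assms in \<open>simp add: F_def\<close>)
  moreover have "{d. ?g d \<noteq> d0} \<subseteq> {d. g0 d \<noteq> d0} \<union> {e}" by auto
  ultimately have "well_ordered {d. ?g d \<noteq> d0}" by (rule well_ordered_subset)
  moreover have "range ?g \<subseteq> D" using F_D[OF assms(1)] assms(2) d0_D by auto
  ultimately show ?thesis by (simp add: F_def)
qed

text \<open>Let \<open>d\<close> be the last level at which \<open>f\<close> leaves a branch of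
  \<open>p\<close>, say \<open>f0\<close>. The image follows the image \<open>g0\<close> of
  \<open>f0\<close> below the level \<open>e\<close> that corresponds to \<open>d\<close>, takes a
  suitable point at \<open>e\<close>, and is \<open>d0\<close> above, where \<open>f\<close> is no
  longer accompanied by any branch of \<open>p\<close>. The map of indices grows because
  \<open>d\<close> needs an index.\<close>

lemma state_add_branch:
  assumes st: "state p l c" and f: "f \<in> F"
  obtains g l' where "l \<subseteq> l'" "state (insert (f, g) p) l' c"
proof (cases "f \<in> Domain p")
  case True
  then obtain g where "(f, g) \<in> p" by blast
  then have "insert (f, g) p = p" by blast
  then show ?thesis using that[of l g] st by simp
next
  case new: False
  note fr = stateD(1)[OF st]
  show ?thesis
  proof (cases "p = {}")
    case True
    have c: "c = {}"
    proof (rule equals0I)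
      fix x assume "x \<in> c"
      then show False using stateD(3)[OF st, of "fst x" "snd x"] True by simp
    qed
    \<comment> \<open>With no branch prescribed so far, \<open>f\<close> can be its own image: every
      node map is then a single pair from \<open>D\<close>.\<close>
    have "frame {(f, f)} l"
    proof -
      have "\<not> splits f f d" for d using splits_neq[of f f d] by blast
      then show ?thesis unfolding frame_def using frameD(2,5)[OF fr] f by simp
    qed
    moreover have "type_map K tk (node_map {(f, f)} {} f d e)" for d e
      by (rule type_map_mono[OF type_map_D[of "f d" "f e"]]) (use F_D[OF f] in \<open>auto simp: node_map_insert_branch node_map_def\<close>)
    ultimately have "state {(f, f)} l {}" unfolding state_def by simp
    then show ?thesis using that[of l f] True c by simp
  next
    case False
    define M where "M = {d. \<exists>f1 g1. (f1, g1) \<in> p \<and> splits f f1 d}"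
    have sp: "\<exists>d. splits f f1 d" if "(f1, g1) \<in> p" for f1 g1
      by (rule splits_exists[OF f frameD(3)[OF fr that]]) (use new that in auto)
    have "M \<subseteq> (\<lambda>(f1, g1). THE d. splits f f1 d) ` p"
    proof
      fix d assume "d \<in> M"
      then obtain f1 g1 where *: "(f1, g1) \<in> p" "splits f f1 d" by (auto simp: M_def)
      have "(THE d. splits f f1 d) = d"
        by (rule the_equality, rule *(2), rule splits_unique[OF _ *(2)])
      then show "d \<in> (\<lambda>(f1, g1). THE d. splits f f1 d) ` p"
        using *(1) by (intro image_eqI[of _ _ "(f1, g1)"]) simp_all
    qed
    then have finM: "finite M" using frameD(1)[OF fr] finite_subset by blast
    obtain x where "x \<in> p" using False by blast
    then have "(fst x, snd x) \<in> p" by simp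
    then have "M \<noteq> {}" using sp unfolding M_def by blast
    define d where "d = Max M"
    have "d \<in> M" unfolding d_def by (rule Max_in[OF finM \<open>M \<noteq> {}\<close>])
    then obtain f0 g0 where f0: "(f0, g0) \<in> p" "splits f f0 d" by (auto simp: M_def)
    have max: "d1 \<le> d" if "(f1, g1) \<in> p" "splits f f1 d1" for f1 g1 d1
      unfolding d_def by (rule Max_ge[OF finM]) (use that in \<open>auto simp: M_def\<close>)
    have "d \<in> q ` I" using q_surj by simp
    \<comment> \<open>A frame demands an index at every splitting level; \<open>z\<close> is one for
      \<open>d\<close>, and its image determines \<open>e\<close>.\<close>
    then obtain z where z: "z \<in> I" "q z = d" by blast
    obtain w where st': "state p (insert (z, w) l) c" by (rule state_add_point[OF st z(1)])
    define l' where "l' = insert (z, w) l"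
    define e where "e = q w"
    note st' = st'[folded l'_def]
    note fr' = stateD(1)[OF st']
    note tm' = frameD(5)[OF fr']
    have zl': "(z, w) \<in> l'" by (simp add: l'_def)
    have N0: "type_map K tk (node_map p c f0 d e)"
      using stateD(7)[OF st' f0(1) zl'] z(2) by (simp add: e_def)
    have "f d \<in> K" using F_D[OF f] by (simp add: D_def)
    \<comment> \<open>The point \<open>b\<close> is chosen over the whole map of the node, so it
      stands to the images of all branch points and values there as \<open>f d\<close> stands to the
      originals. It is again in \<open>D\<close> because 1-types are preserved.\<close>
    from type_map_extend[OF teK N0 finite_node_map[OF frameD(1)[OF fr] stateD(2)[OF st]] this]
    obtain b where b: "b \<in> K" "type_map K tk (insert (f d, b) (node_map p c f0 d e))" .
    have "tk (map fst [(f d, b)]) = tk (map snd [(f d, b)])" by (rule type_map_lists[OF b(2)]) simp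
    then have bD: "b \<in> D" using F_D[OF f, of d] b(1) by (simp add: D_def)
    define g where "g = (\<lambda>x. if x < e then g0 x else if x = e then b else d0)"
    have gF: "g \<in> F" unfolding g_def by (rule F_fun[OF frameD(4)[OF fr f0(1)] bD])
    have gg0: "agree g g0 e" by (simp add: agree_def g_def)
    have ff0: "agree f f0 d" using f0(2) by (simp add: splits_def)
    have ge: "g e = b" by (simp add: g_def)
    have new_split: "\<exists>z1 w1. (z1, w1) \<in> l' \<and> splits f f1 (q z1) \<and> splits g g1 (q w1)"
      if f1: "(f1, g1) \<in> p" for f1 g1
    proof -
      obtain d1 where d1: "splits f f1 d1" using sp[OF f1] by blast
      show ?thesis
      proof (cases "d1 = d")
        case True
        then have ff1: "agree f f1 d" "f d \<noteq> f1 d" using d1 by (auto simp: splits_def)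
        then have f01: "agree f0 f1 d" using ff0 agree_trans agree_sym by metis
        then have "agree g0 g1 e" using frame_agree[OF fr' f0(1) f1 zl'] z(2) by (simp add: e_def)
        then have gg1: "agree g g1 e" by (rule agree_trans[OF gg0])
        \<comment> \<open>\<open>f1\<close> runs through the node of \<open>f0\<close>, so its point
          belongs to the map over which \<open>b\<close> was chosen; \<open>f d\<close> and
          \<open>f1 d\<close> differ, hence so do \<open>b\<close> and \<open>g1 e\<close>.\<close>
        have "(f1 d, g1 e) \<in> node_map p c f0 d e" by (rule node_map_branchI[OF f1 f01])
        then have "f d = f1 d \<longleftrightarrow> b = g1 e" by (intro type_map_eq[OF teK b(2)]) auto
        then have "g e \<noteq> g1 e" using ff1(2) ge by simp
        then have "splits g g1 e" using gg1 by (simp add: splits_def)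
        then show ?thesis using zl' d1 True z(2) unfolding e_def by blast
      next
        case False
        then have less: "d1 < d" using max[OF f1 d1] by simp
        have s01: "splits f0 f1 d1" by (rule splits_agree_left[OF d1 ff0 less])
        then obtain z1 w1 where zw: "(z1, w1) \<in> l'" "q z1 = d1" "splits g0 g1 (q w1)"
          using frameD(7)[OF fr' f0(1) f1] by blast
        have "q w1 < e" using type_map_q[OF tm' zw(1) zl'] zw(2) z(2) less by (simp add: e_def)
        then have "splits g g1 (q w1)"
          by (rule splits_agree_left[OF zw(3) iffD1[OF agree_sym gg0]])
        then show ?thesis using zw d1 by blast
      qed
    qed
    have frame: "frame (insert (f, g) p) l'"
      unfolding frame_def
    proof (intro conjI allI impI)
      have mixed: "(f = f1 \<longleftrightarrow> g = g1) \<and>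
          (\<forall>d. splits f f1 d \<longrightarrow> (\<exists>z w. (z, w) \<in> l' \<and> q z = d \<and> splits g g1 (q w))) \<and>
          (\<forall>d. splits f1 f d \<longrightarrow> (\<exists>z w. (z, w) \<in> l' \<and> q z = d \<and> splits g1 g (q w)))"
        if f1: "(f1, g1) \<in> p" for f1 g1
      proof -
        obtain z1 w1 where *: "(z1, w1) \<in> l'" "splits f f1 (q z1)" "splits g g1 (q w1)"
          using new_split[OF f1] by blast
        have 1: "q z1 = d" if "splits f f1 d" for d by (rule splits_unique[OF *(2) that])
        then have 2: "q z1 = d" if "splits f1 f d" for d using that by (simp add: splits_sym[of f1 f])
        have 3: "splits g1 g (q w1)" using *(3) by (simp add: splits_sym[of g1 g])
        show ?thesis using splits_neq[OF *(2)] splits_neq[OF *(3)] 1 2 3 *(1,3) by blast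
      qed
      fix f1 g1 f2 g2 assume mem: "(f1, g1) \<in> insert (f, g) p" "(f2, g2) \<in> insert (f, g) p"
      then consider "f1 = f" "g1 = g" "f2 = f" "g2 = g" | "f1 = f" "g1 = g" "(f2, g2) \<in> p"
        | "f2 = f" "g2 = g" "(f1, g1) \<in> p" | "(f1, g1) \<in> p" "(f2, g2) \<in> p" by blast
      note cases = this
      from cases show "f1 = f2 \<longleftrightarrow> g1 = g2"
      proof cases
        case 2 then show ?thesis using mixed by simp
      next
        case 3 then show ?thesis using mixed[OF 3(3)] by auto
      next
        case 4 then show ?thesis using frameD(6)[OF fr'] by simp
      qed simp
      show "\<exists>z w. (z, w) \<in> l' \<and> q z = d \<and> splits g1 g2 (q w)" if d: "splits f1 f2 d" for d
        using cases
      proof cases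
        case 1 then show ?thesis using splits_neq[OF d] by simp
      next
        case 2
        have "splits f f2 d" using d 2(1) by simp
        then show ?thesis using mixed[OF 2(3)] unfolding 2(2) by blast
      next
        case 3
        have "splits f1 f d" using d 3(1) by simp
        then show ?thesis using mixed[OF 3(3)] unfolding 3(2) by blast
      next
        case 4 then show ?thesis using frameD(7)[OF fr' 4 d] by simp
      qed
    qed (use fr' f gF in \<open>simp_all add: frame_def\<close>)
    have gD: "g x \<in> D" "f x \<in> D" for x using F_D gF f by auto
    have old_node: "type_map K tk (node_map (insert (f, g) p) c f1 (q z1) (q w1))"
      if f1: "(f1, g1) \<in> p" and zw: "(z1, w1) \<in> l'" for f1 g1 z1 w1
    proof (cases "agree f1 f (q z1)")
      case False
      then have "node_map (insert (f, g) p) c f1 (q z1) (q w1) = node_map p c f1 (q z1) (q w1)"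
        by (simp add: node_map_insert_branch)
      then show ?thesis using stateD(7)[OF st' f1 zw] by simp
    next
      case True
      have ins: "node_map (insert (f, g) p) c f1 (q z1) (q w1) =
          insert (f (q z1), g (q w1)) (node_map p c f1 (q z1) (q w1))"
        using True by (simp add: node_map_insert_branch)
      obtain d1 where d1: "splits f f1 d1" using sp[OF f1] by blast
      have "q z1 \<le> d" using max[OF f1 d1] splits_agree[OF d1] True agree_sym by (metis order_trans)
      show ?thesis
      proof (cases "q z1 = d")
        case eq: True
        then have "q w1 = e" using type_map_q_eq[OF tm' zw zl'] z(2) by (simp add: e_def)
        moreover have "agree f1 f0 d" using True ff0 eq agree_trans by metis
        ultimately show ?thesis
          unfolding ins using b(2) node_map_cong[of f1 f0 d p c e] eq ge by simp
      next
        case ne: False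
        then have less: "q z1 < d" using \<open>q z1 \<le> d\<close> by simp
        then have "q w1 < e" using type_map_q[OF tm' zw zl'] z(2) by (simp add: e_def)
        then have "g (q w1) = g0 (q w1)" using agree_less[OF gg0] by simp
        moreover have "f (q z1) = f0 (q z1)" using agree_less[OF ff0 less] .
        moreover have "agree f1 f0 (q z1)"
          using True agree_mono[OF ff0] less agree_trans by (metis less_imp_le)
        ultimately have "(f (q z1), g (q w1)) \<in> node_map p c f1 (q z1) (q w1)"
          using node_map_branchI[OF f0(1)] by simp
        then show ?thesis unfolding ins using stateD(7)[OF st' f1 zw] by (simp add: insert_absorb)
      qed
    qed
    have new_node: "type_map K tk (node_map (insert (f, g) p) c f (q z1) (q w1))"
      if zw: "(z1, w1) \<in> l'" for z1 w1
    proof (cases "q z1 \<le> d")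
      case True
      then have "agree f f0 (q z1)" using agree_mono[OF ff0] by simp
      then show ?thesis using node_map_cong old_node[OF f0(1) zw] by metis
    next
      case False
      \<comment> \<open>Above \<open>d\<close> no branch of \<open>p\<close> accompanies
        \<open>f\<close>, and thus no element of \<open>c\<close> sits on its nodes; the tail with
        value \<open>d0\<close> meets no condition beyond membership in \<open>D\<close>.\<close>
      have no: "\<not> agree f f1 (q z1)" if f1: "(f1, g1) \<in> p" for f1 g1
      proof -
        obtain d1 where d1: "splits f f1 d1" using sp[OF f1] by blast
        show ?thesis using splits_agree[OF d1] max[OF f1 d1] False by auto
      qed
      have "node_map p c f (q z1) (q w1) = {}"
      proof (rule equals0I)
        fix x assume "x \<in> node_map p c f (q z1) (q w1)"
        then show False
        proof (cases rule: node_map_cases)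
          case (1 f' g') then show ?thesis using no by blast
        next
          case (2 u v) then show ?thesis using no stateD(3)[OF st'] by blast
        qed
      qed
      then have "node_map (insert (f, g) p) c f (q z1) (q w1) \<subseteq> {(f (q z1), g (q w1))}"
        by (simp add: node_map_insert_branch)
      then show ?thesis by (rule type_map_mono[OF type_map_D[OF gD(2) gD(1)]])
    qed
    have "state (insert (f, g) p) l' c"
      unfolding state_def
    proof (intro conjI allI impI frame)
      show "type_map K tk (node_map (insert (f, g) p) c f1 (q z1) (q w1))"
        if "(f1, g1) \<in> insert (f, g) p" "(z1, w1) \<in> l'" for f1 g1 z1 w1
        using that old_node new_node by blast
    qed (use stateD(2-6)[OF st'] in blast)+
    then show ?thesis by (rule that[rotated]) (auto simp: l'_def)
  qed
qed

text \<open>The new value is found by extending the map of its own node by one pair. The same node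
  may be presented by several branches and indices, with the same map by
  \<open>node_map_cong\<close>; at other nodes nothing changes.\<close>

lemma state_add_val:
  assumes st: "state p l c" and p: "(branch u, g) \<in> p" and l: "(index u, y) \<in> l" and k: "val u \<in> K"
  obtains v where "branch v = g" "index v = y" "val v \<in> K" "state p l (insert (u, v) c)"
proof -
  note fr = stateD(1)[OF st]
  let ?N = "node_map p c (branch u) (q (index u)) (q y)"
  obtain k' where k': "k' \<in> K" "type_map K tk (insert (val u, k') ?N)"
    by (rule type_map_extend[OF teK stateD(7)[OF st p l] finite_node_map[OF frameD(1)[OF fr] stateD(2)[OF st]] k])
  let ?v = "(g, y, k')"
  have "type_map K tk (node_map p (insert (u, ?v) c) f1 (q z1) (q w1))"
    if f1: "(f1, g1) \<in> p" and zw: "(z1, w1) \<in> l" for f1 g1 z1 w1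
  proof (cases "q (index u) = q z1 \<and> agree f1 (branch u) (q z1)")
    case True
    then have "q w1 = q y" using type_map_q_eq[OF frameD(5)[OF fr] l zw] by simp
    have "node_map p (insert (u, ?v) c) f1 (q z1) (q w1) = insert (val u, k') (node_map p c f1 (q z1) (q w1))"
      using True by (simp add: node_map_insert_val)
    also have "node_map p c f1 (q z1) (q w1) = ?N"
      using node_map_cong[of f1 "branch u" "q z1"] True \<open>q w1 = q y\<close> by simp
    finally show ?thesis using k'(2) by simp
  next
    case False
    then have "node_map p (insert (u, ?v) c) f1 (q z1) (q w1) = node_map p c f1 (q z1) (q w1)"
      by (auto simp: node_map_insert_val)
    then show ?thesis using stateD(7)[OF st f1 zw] by simp
  qed
  then have "state p l (insert (u, ?v) c)"
    unfolding state_def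
  proof (intro conjI allI impI fr)
    fix u' v' assume "(u', v') \<in> insert (u, ?v) c"
    then consider "u' = u" "v' = ?v" | "(u', v') \<in> c" by blast
    then have "(branch u', branch v') \<in> p \<and> (index u', index v') \<in> l \<and> val u' \<in> K \<and> val v' \<in> K"
    proof cases
      case 1 then show ?thesis using p l k k'(1) by simp
    next
      case 2 then show ?thesis using stateD(3-6)[OF st 2] by simp
    qed
    then show "(branch u', branch v') \<in> p" "(index u', index v') \<in> l" "val u' \<in> K" "val v' \<in> K" by simp_all
  qed (use stateD(2)[OF st] in simp_all)
  then show ?thesis using that[of ?v] k'(1) by simp
qed


lemma state_pair:
  assumes st: "state p l c" and u: "(u, v) \<in> c" and u': "(u', v') \<in> c"
  shows "branch u = branch u' \<longleftrightarrow> branch v = branch v'" "same_node u u' \<longleftrightarrow> same_node v v'"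
    "same_node u u' \<Longrightarrow> (val u', val v') \<in> node_map p c (branch u) (q (index u)) (q (index v))"
    "type_map K tk (node_map p c (branch u) (q (index u)) (q (index v)))"
    "u = u' \<longleftrightarrow> v = v'" "on_branch u \<longleftrightarrow> on_branch v"
proof -
  let ?N = "node_map p c (branch u) (q (index u)) (q (index v))"
  note fr = stateD(1)[OF st] and tm = frameD(5)[OF stateD(1)[OF st]]
  note p = stateD(3)[OF st u] stateD(3)[OF st u'] and l = stateD(4)[OF st u] stateD(4)[OF st u']
  show br: "branch u = branch u' \<longleftrightarrow> branch v = branch v'" by (rule frameD(6)[OF fr p])
  show node: "same_node u u' \<longleftrightarrow> same_node v v'"
    unfolding same_node_def using type_map_q_eq[OF tm l] frame_agree[OF fr p l(1)] by simp
  show mem: "(val u', val v') \<in> ?N" if "same_node u u'"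
  proof -
    have e: "q (index u) = q (index u')" and a: "agree (branch u) (branch u') (q (index u))"
      using that unfolding same_node_def by blast+
    show ?thesis by (rule node_map_valI[OF u' e[symmetric] a])
  qed
  show N: "type_map K tk ?N" by (rule stateD(7)[OF st p(1) l(1)])
  have "(val u, val v) \<in> ?N" by (rule node_map_valI[OF u]) simp_all
  note val = type_map_eq[OF teK N this]
  have "(branch u (q (index u)), branch v (q (index v))) \<in> ?N" by (rule node_map_branchI[OF p(1)]) simp
  then show "on_branch u \<longleftrightarrow> on_branch v" unfolding on_branch_def by (rule val)
  have ix: "index u = index u' \<longleftrightarrow> index v = index v'" by (rule type_map_eq[OF teI tm l])
  show "u = u' \<longleftrightarrow> v = v'"
  proof
    assume "u = u'"
    then have "same_node u u'" by (simp add: same_node_def)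
    then have "val v = val v'" using val[OF mem] \<open>u = u'\<close> by simp
    then show "v = v'" using br ix \<open>u = u'\<close> by (simp add: prod_eq_iff)
  next
    assume "v = v'"
    then have "same_node v v'" by (simp add: same_node_def)
    then have "val u = val u'" using val[OF mem] node \<open>v = v'\<close> by simp
    then show "u = u'" using br ix \<open>v = v'\<close> by (simp add: prod_eq_iff)
  qed
qed

section \<open>The typing of tuples of the tree\<close>

definition tree_rel :: "'a elem list \<Rightarrow> 'a elem list \<Rightarrow> bool" where
  "tree_rel us vs \<longleftrightarrow> length us = length vs \<and> (\<exists>p l c. state p l c \<and> set (zip us vs) \<subseteq> c)"

lemma tree_relE:
  assumes "tree_rel us vs"
  obtains p l c where "length us = length vs" "state p l c" "set (zip us vs) \<subseteq> c"
    "\<forall>i<length us. (us ! i, vs ! i) \<in> c"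
proof -
  obtain p l c where *: "length us = length vs" "state p l c" "set (zip us vs) \<subseteq> c"
    using assms unfolding tree_rel_def by blast
  have "(us ! i, vs ! i) \<in> c" if "i < length us" for i
  proof -
    have "zip us vs ! i \<in> set (zip us vs)" by (rule nth_mem) (use that *(1) in simp)
    then show ?thesis using *(1,3) that by (auto simp: nth_zip)
  qed
  then show ?thesis using that[OF *] by blast
qed

lemma tree_rel_sym:
  assumes "tree_rel us vs"
  shows "tree_rel vs us"
proof -
  obtain p l c where *: "length us = length vs" "state p l c" "set (zip us vs) \<subseteq> c"
    using assms unfolding tree_rel_def by blast
  have "set (zip vs us) = (set (zip us vs))\<inverse>" using *(1) unfolding set_zip by force
  then have "set (zip vs us) \<subseteq> c\<inverse>" using *(3) by (simp only: converse_mono)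
  then show ?thesis using state_converse[OF *(2)] *(1) unfolding tree_rel_def by metis
qed

lemma tree_rel_extend:
  assumes "tree_rel us vs" "u \<in> elems"
  shows "\<exists>v\<in>elems. tree_rel (us @ [u]) (vs @ [v])"
proof -
  obtain p l c where *: "length us = length vs" "state p l c" "set (zip us vs) \<subseteq> c"
    using assms unfolding tree_rel_def by blast
  have u: "branch u \<in> F" "index u \<in> I" "val u \<in> K" using assms(2) by (auto simp: elems_def)
  obtain y where y: "state p (insert (index u, y) l) c" by (rule state_add_point[OF *(2) u(2)])
  obtain g l' where g: "insert (index u, y) l \<subseteq> l'" "state (insert (branch u, g) p) l' c"
    by (rule state_add_branch[OF y u(1)])
  have "(branch u, g) \<in> insert (branch u, g) p" "(index u, y) \<in> l'" using g(1) by auto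
  note mem = this
  obtain v where v: "branch v = g" "index v = y" "val v \<in> K" "state (insert (branch u, g) p) l' (insert (u, v) c)"
    by (rule state_add_val[OF g(2) mem u(3)])
  have "g \<in> F" by (rule frameD(4)[OF stateD(1)[OF g(2)] mem(1)])
  moreover have "y \<in> I" using frameD(5)[OF stateD(1)[OF g(2)]] mem(2) by (auto simp: type_map_def)
  ultimately have "v \<in> elems" using v(1-3) by (simp add: elems_def mem_Times_iff)
  moreover have "set (zip (us @ [u]) (vs @ [v])) \<subseteq> insert (u, v) c" using *(1,3) by auto
  then have "tree_rel (us @ [u]) (vs @ [v])" unfolding tree_rel_def using v(4) *(1) by auto
  ultimately show ?thesis by blast
qed

lemma tree_rel_sub:
  assumes "tree_rel us vs" "set is \<subseteq> {..<length us}"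
  shows "tree_rel (map ((!) us) is) (map ((!) vs) is)"
proof -
  obtain p l c where *: "length us = length vs" "state p l c" "set (zip us vs) \<subseteq> c"
    "\<forall>i<length us. (us ! i, vs ! i) \<in> c" by (rule tree_relE[OF assms(1)])
  note * = *(1-3) *(4)[rule_format]
  have "set (zip (map ((!) us) is) (map ((!) vs) is)) = (\<lambda>i. (us ! i, vs ! i)) ` set is"
    by (simp add: zip_map_map zip_same_conv_map image_image)
  also have "\<dots> \<subseteq> c" using *(4) assms(2) by (intro image_subsetI) (simp add: subset_iff)
  finally show ?thesis using *(2) unfolding tree_rel_def by auto
qed

text \<open>A finite set of indices whose levels suffice to describe \<open>us\<close>: besides the
  indices of \<open>us\<close> it has one at each splitting level, as \<open>frame\<close>
  requires.\<close>

definition test_points :: "'a elem list \<Rightarrow> point list \<Rightarrow> bool" where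
  "test_points us zs \<longleftrightarrow> set zs \<subseteq> I \<and> set (map index us) \<subseteq> set zs \<and>
     (\<forall>u\<in>set us. \<forall>u'\<in>set us. branch u \<noteq> branch u' \<longrightarrow> (\<exists>z\<in>set zs. splits (branch u) (branch u') (q z)))"

lemma test_points_exist:
  assumes "set us \<subseteq> elems"
  shows "\<exists>zs. test_points us zs"
proof -
  let ?z = "\<lambda>w. SOME z. z \<in> I \<and> splits (branch (fst w)) (branch (snd w)) (q z)"
  let ?W = "{w \<in> set us \<times> set us. branch (fst w) \<noteq> branch (snd w)}"
  have z: "?z w \<in> I \<and> splits (branch (fst w)) (branch (snd w)) (q (?z w))" if w: "w \<in> ?W" for w
  proof (rule someI_ex)
    have "fst w \<in> elems" "snd w \<in> elems" using w assms by (auto simp: mem_Times_iff)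
    then have "branch (fst w) \<in> F" "branch (snd w) \<in> F" by (simp_all add: elems_def mem_Times_iff)
    moreover have "branch (fst w) \<noteq> branch (snd w)" using w by simp
    ultimately obtain d where d: "splits (branch (fst w)) (branch (snd w)) d" using splits_exists by blast
    have "d \<in> q ` I" using q_surj by simp
    then show "\<exists>z. z \<in> I \<and> splits (branch (fst w)) (branch (snd w)) (q z)" using d by blast
  qed
  have fin: "finite (index ` set us \<union> ?z ` ?W)" by simp
  obtain zs where zs: "set zs = index ` set us \<union> ?z ` ?W" using finite_list[OF fin] by (elim exE)
  have "index u \<in> I" if "u \<in> set us" for u
  proof -
    have "u \<in> elems" using assms that by (rule subsetD)
    then show ?thesis by (simp add: elems_def mem_Times_iff)
  qed
  then have "index ` set us \<subseteq> I" by (rule image_subsetI)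
  moreover have "?z ` ?W \<subseteq> I" by (rule image_subsetI) (rule conjunct1[OF z])
  ultimately have "set zs \<subseteq> I" unfolding zs by (rule Un_least)
  moreover have "\<exists>z\<in>set zs. splits (branch u) (branch u') (q z)"
    if "u \<in> set us" "u' \<in> set us" "branch u \<noteq> branch u'" for u u'
  proof -
    have w: "(u, u') \<in> ?W" using that by simp
    have "?z (u, u') \<in> set zs" unfolding zs by (intro UnI2 imageI w)
    moreover have "splits (branch u) (branch u') (q (?z (u, u')))" using z[OF w] by simp
    ultimately show ?thesis by (rule bexI[rotated])
  qed
  moreover have "set (map index us) \<subseteq> set zs" unfolding zs by simp
  ultimately show ?thesis unfolding test_points_def by blast
qed

text \<open>The domain of \<open>node_map\<close> as a list, in which positions of other nodes repeat the point of the branch.\<close>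

definition node_list :: "'a elem list \<Rightarrow> nat \<Rightarrow> level \<Rightarrow> 'a list" where
  "node_list us i d =
     map (\<lambda>j. if agree (branch (us ! i)) (branch (us ! j)) d then branch (us ! j) d
        else branch (us ! i) d) [0..<length us] @
     map (\<lambda>j. if q (index (us ! j)) = d \<and> agree (branch (us ! i)) (branch (us ! j)) d then val (us ! j)
        else branch (us ! i) d) [0..<length us]"

lemma set_zip_two_maps:
  "set (zip (map f xs @ map f' xs) (map g xs @ map g' xs)) =
     (\<lambda>j. (f j, g j)) ` set xs \<union> (\<lambda>j. (f' j, g' j)) ` set xs"
  by (simp add: zip_map_map zip_same_conv_map image_image)

text \<open>Only natural numbers and truth values occur, so there are countably many codes. Types of
  node lists are recorded at the levels of the test points, which is where \<open>state\<close>
  imposes conditions on nodes.\<close>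

definition tree_code :: "'a elem list \<Rightarrow> point list \<Rightarrow>
    nat \<times> nat \<times> nat \<times> bool list \<times> bool list \<times> bool list \<times> nat list" where
  "tree_code us zs = (length us, length zs, ti zs,
     map (\<lambda>(i, j). branch (us ! i) = branch (us ! j)) (List.product [0..<length us] [0..<length us]),
     map (\<lambda>(i, j, a). splits (branch (us ! i)) (branch (us ! j)) (q (zs ! a)))
       (List.product [0..<length us] (List.product [0..<length us] [0..<length zs])),
     map (\<lambda>(i, a). index (us ! i) = zs ! a) (List.product [0..<length us] [0..<length zs]),
     map (\<lambda>(i, a). tk (node_list us i (q (zs ! a)))) (List.product [0..<length us] [0..<length zs]))"

text \<open>Pairing branches, test points and elements position by position gives the three maps of
  a state; each condition on a state can be read off from one entry of the code.\<close>

lemma tree_code_imp: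
  assumes us: "set us \<subseteq> elems" "test_points us zs" and vs: "set vs \<subseteq> elems" "test_points vs ws"
    and eq: "tree_code us zs = tree_code vs ws"
  shows "tree_rel us vs"
proof -
  define n m where "n = length us" and "m = length zs"
  have len: "length us = n" "length vs = n" "length zs = m" "length ws = m" "ti zs = ti ws"
    using eq by (simp_all add: tree_code_def n_def m_def)
  have c: "branch (us ! i) = branch (us ! j) \<longleftrightarrow> branch (vs ! i) = branch (vs ! j)"
    "splits (branch (us ! i)) (branch (us ! j)) (q (zs ! a)) \<longleftrightarrow> splits (branch (vs ! i)) (branch (vs ! j)) (q (ws ! a))"
    "index (us ! i) = zs ! a \<longleftrightarrow> index (vs ! i) = ws ! a"
    "tk (node_list us i (q (zs ! a))) = tk (node_list vs i (q (ws ! a)))"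
    if "i < n" "j < n" "a < m" for i j a
    using eq that unfolding tree_code_def len(1-4) by auto
  have c1: "branch (us ! i) = branch (us ! j) \<longleftrightarrow> branch (vs ! i) = branch (vs ! j)" if "i < n" "j < n" for i j
    using eq that unfolding tree_code_def len(1-4) by auto
  have el: "branch (us ! i) \<in> F" "index (us ! i) \<in> I" "val (us ! i) \<in> K"
    "branch (vs ! i) \<in> F" "index (vs ! i) \<in> I" "val (vs ! i) \<in> K" if "i < n" for i
  proof -
    have "us ! i \<in> elems" "vs ! i \<in> elems" using us(1) vs(1) that len(1,2) by auto
    then show "branch (us ! i) \<in> F" "index (us ! i) \<in> I" "val (us ! i) \<in> K"
      "branch (vs ! i) \<in> F" "index (vs ! i) \<in> I" "val (vs ! i) \<in> K"
      by (simp_all add: elems_def mem_Times_iff)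
  qed
  define p where "p = (\<lambda>i. (branch (us ! i), branch (vs ! i))) ` {..<n}"
  define l where "l = (\<lambda>a. (zs ! a, ws ! a)) ` {..<m}"
  define cc where "cc = (\<lambda>i. (us ! i, vs ! i)) ` {..<n}"
  have pI: "\<exists>i<n. f = branch (us ! i) \<and> g = branch (vs ! i)" if "(f, g) \<in> p" for f g
    using that unfolding p_def by blast
  have lI: "\<exists>a<m. z = zs ! a \<and> w = ws ! a" if "(z, w) \<in> l" for z w
    using that unfolding l_def by blast
  have cI: "\<exists>i<n. u = us ! i \<and> v = vs ! i" if "(u, v) \<in> cc" for u v
    using that unfolding cc_def by blast
  have zsI: "set zs \<subseteq> I" "set ws \<subseteq> I" using us(2) vs(2) by (simp_all add: test_points_def)
  have "l = set (zip zs ws)" unfolding l_def set_zip len by force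
  then have tml: "type_map I ti l" using type_map_zip[OF teI zsI len(5)] by simp
  have fr: "frame p l"
    unfolding frame_def
  proof (intro conjI allI impI tml)
    show "finite p" "finite l" by (simp_all add: p_def l_def)
    show "p \<subseteq> F \<times> F" using el unfolding p_def by (intro image_subsetI) simp
    fix f g f' g' assume "(f, g) \<in> p" "(f', g') \<in> p"
    then obtain i j where ij: "i < n" "f = branch (us ! i)" "g = branch (vs ! i)"
      "j < n" "f' = branch (us ! j)" "g' = branch (vs ! j)" using pI by metis
    show "f = f' \<longleftrightarrow> g = g'" using c1[of i j] ij by simp
    fix d assume d: "splits f f' d"
    have "us ! i \<in> set us" "us ! j \<in> set us" using ij(1,4) len(1) by simp_all
    moreover have "branch (us ! i) \<noteq> branch (us ! j)" using splits_neq[OF d] ij by simp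
    ultimately obtain z where z: "z \<in> set zs" "splits f f' (q z)"
      using us(2) ij(2,5) unfolding test_points_def by blast
    then obtain a where a: "a < m" "z = zs ! a" using len(3) by (metis in_set_conv_nth)
    have "q z = d" by (rule splits_unique[OF z(2) d])
    moreover have "splits g g' (q (ws ! a))" using c(2)[OF ij(1,4) a(1)] z(2) a(2) ij by simp
    moreover have "(z, ws ! a) \<in> l" using a by (simp add: l_def)
    ultimately show "\<exists>z w. (z, w) \<in> l \<and> q z = d \<and> splits g g' (q w)" by blast
  qed
  have pm: "(branch (us ! i), branch (vs ! i)) \<in> p" if "i < n" for i using that by (simp add: p_def)
  have ixl: "(index (us ! i), index (vs ! i)) \<in> l" if i: "i < n" for i
  proof -
    have "index (us ! i) \<in> set zs" using us(2) i len(1) by (auto simp: test_points_def)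
    then obtain a where a: "a < m" "index (us ! i) = zs ! a" using len(3) by (metis in_set_conv_nth)
    then have "index (vs ! i) = ws ! a" using c(3)[OF i i a(1)] by simp
    then show ?thesis using a by (simp add: l_def)
  qed
  have tmn: "type_map K tk (node_map p cc f (q z) (q w))" if fg: "(f, g) \<in> p" and zw: "(z, w) \<in> l" for f g z w
  proof -
    obtain i where i: "i < n" "f = branch (us ! i)" "g = branch (vs ! i)" using pI[OF fg] by blast
    obtain a where a: "a < m" "z = zs ! a" "w = ws ! a" using lI[OF zw] by blast
    let ?A = "node_list us i (q z)" and ?B = "node_list vs i (q w)"
    have DK: "h x \<in> K" if "h \<in> F" for h x using F_D[OF that] by (simp add: D_def)
    have "branch (us ! j) (q z) \<in> K" "branch (vs ! j) (q w) \<in> K" if "j < n" for j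
      using DK[OF el(1)[OF that]] DK[OF el(4)[OF that]] by blast+
    then have AB: "set ?A \<subseteq> K" "set ?B \<subseteq> K"
      using el(3,6) i(1) unfolding node_list_def len(1,2) by auto
    have "tk ?A = tk ?B" using c(4)[OF i(1) i(1) a(1)] a by simp
    note tm = type_map_zip[OF teK AB this]
    \<comment> \<open>Agreement at corresponding levels holds for the same positions on both sides,
      so points and values of the node occupy the same places in the two lists, and the fillers pair
      the two points of the chosen branch.\<close>
    have "node_map p cc f (q z) (q w) \<subseteq> set (zip ?A ?B)"
    proof
      fix x assume "x \<in> node_map p cc f (q z) (q w)"
      then show "x \<in> set (zip ?A ?B)"
      proof (cases rule: node_map_cases)
        case (1 f' g')
        obtain j where j: "j < n" "f' = branch (us ! j)" "g' = branch (vs ! j)" using pI[OF 1(2)] by blast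
        have "agree g g' (q w)" using frame_agree[OF fr fg 1(2) zw] 1(3) by simp
        then show ?thesis unfolding node_list_def len(1,2) set_zip_two_maps
          by (intro UnI1 image_eqI[of _ _ j]) (use 1 i j in simp_all)
      next
        case (2 u v)
        obtain j where j: "j < n" "u = us ! j" "v = vs ! j" using cI[OF 2(2)] by blast
        have "agree g (branch v) (q w)"
          using frame_agree[OF fr fg pm[OF j(1)] zw] 2(4) j by simp
        moreover have "q (index v) = q w"
          using type_map_q_eq[OF tml ixl[OF j(1)] zw] 2(3) j by simp
        ultimately show ?thesis unfolding node_list_def len(1,2) set_zip_two_maps
          by (intro UnI2 image_eqI[of _ _ j]) (use 2 i j in simp_all)
      qed
    qed
    then show ?thesis by (rule type_map_mono[OF tm])
  qed
  have "state p l cc"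
    unfolding state_def
  proof (intro conjI allI impI fr)
    show "finite cc" by (simp add: cc_def)
    fix u v assume "(u, v) \<in> cc"
    then obtain i where "i < n" "u = us ! i" "v = vs ! i" using cI by blast
    then show "(branch u, branch v) \<in> p" "(index u, index v) \<in> l" "val u \<in> K" "val v \<in> K"
      using pm ixl el by simp_all
  qed (rule tmn)
  moreover have "set (zip us vs) \<subseteq> cc" unfolding cc_def set_zip len by auto
  ultimately show ?thesis unfolding tree_rel_def len(1,2) by blast
qed

lemma tree_typing_exists: "\<exists>s. typing_of elems tree_rel s"
proof (rule typing_exists[where code = "\<lambda>us. to_nat (tree_code us (SOME zs. test_points us zs))"])
  fix us vs assume us: "set us \<subseteq> elems" and vs: "set vs \<subseteq> elems"
  have tp: "test_points us (SOME zs. test_points us zs)" "test_points vs (SOME zs. test_points vs zs)"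
    by (rule someI_ex[OF test_points_exist[OF us]]) (rule someI_ex[OF test_points_exist[OF vs]])
  show "tree_rel us vs"
    if "to_nat (tree_code us (SOME zs. test_points us zs)) = to_nat (tree_code vs (SOME zs. test_points vs zs))"
    using tree_code_imp[OF us tp(1) vs tp(2)] that by simp
  assume rel: "tree_rel us vs"
  obtain p l c where *: "length us = length vs" "state p l c" "set (zip us vs) \<subseteq> c"
    "\<forall>i<length us. (us ! i, vs ! i) \<in> c" by (rule tree_relE[OF rel])
  note * = *(1-3) *(4)[rule_format]
  show "length us = length vs" by (rule *(1))
  show "tree_rel vs us" by (rule tree_rel_sym[OF rel])
  show "us ! i = us ! j \<longleftrightarrow> vs ! i = vs ! j" if "i < length us" "j < length us" for i j
    by (rule state_pair(5)[OF *(2) *(4) *(4)]) (use that in simp_all)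
  show "tree_rel (map ((!) us) is) (map ((!) vs) is)" if "set is \<subseteq> {..<length us}" for "is"
    by (rule tree_rel_sub[OF rel that])
  show "\<exists>b\<in>elems. tree_rel (us @ [a]) (vs @ [b])" if "a \<in> elems" for a
    by (rule tree_rel_extend[OF rel that])
qed

lemma tree_rel_invariants:
  assumes "tree_rel us vs"
  shows "length us = length vs" "ti (map index us) = ti (map index vs)"
    "\<And>i j. i < length us \<Longrightarrow> j < length us \<Longrightarrow> branch (us ! i) = branch (us ! j) \<longleftrightarrow> branch (vs ! i) = branch (vs ! j)"
    "\<And>i j. i < length us \<Longrightarrow> j < length us \<Longrightarrow> same_node (us ! i) (us ! j) \<longleftrightarrow> same_node (vs ! i) (vs ! j)"
    "\<And>i. i < length us \<Longrightarrow> on_branch (us ! i) \<longleftrightarrow> on_branch (vs ! i)"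
    "(\<And>i. i < length us \<Longrightarrow> same_node (us ! 0) (us ! i)) \<Longrightarrow> us \<noteq> [] \<Longrightarrow> tk (map val us) = tk (map val vs)"
proof -
  obtain p l c where *: "length us = length vs" "state p l c" "set (zip us vs) \<subseteq> c"
    "\<forall>i<length us. (us ! i, vs ! i) \<in> c" by (rule tree_relE[OF assms])
  note * = *(1-3) *(4)[rule_format]
  show "length us = length vs" by (rule *(1))
  let ?ps = "zip (map index us) (map index vs)"
  have "set ?ps \<subseteq> l"
  proof
    fix x assume "x \<in> set ?ps"
    then obtain i where i: "i < length us" "x = (index (us ! i), index (vs ! i))"
      using *(1) by (auto simp: set_zip)
    then show "x \<in> l" using stateD(4)[OF *(2) *(4)[OF i(1)]] by simp
  qed
  then have "ti (map fst ?ps) = ti (map snd ?ps)"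
    by (rule type_map_lists[OF frameD(5)[OF stateD(1)[OF *(2)]]])
  then show "ti (map index us) = ti (map index vs)" using *(1) by simp
  fix i j assume ij: "i < length us" "j < length us"
  show "branch (us ! i) = branch (us ! j) \<longleftrightarrow> branch (vs ! i) = branch (vs ! j)"
    by (rule state_pair(1)[OF *(2) *(4)[OF ij(1)] *(4)[OF ij(2)]])
  show "same_node (us ! i) (us ! j) \<longleftrightarrow> same_node (vs ! i) (vs ! j)"
    by (rule state_pair(2)[OF *(2) *(4)[OF ij(1)] *(4)[OF ij(2)]])
next
  obtain p l c where *: "length us = length vs" "state p l c" "set (zip us vs) \<subseteq> c"
    "\<forall>i<length us. (us ! i, vs ! i) \<in> c" by (rule tree_relE[OF assms])
  note * = *(1-3) *(4)[rule_format]
  show "on_branch (us ! i) \<longleftrightarrow> on_branch (vs ! i)" if i: "i < length us" for i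
    by (rule state_pair(6)[OF *(2) *(4)[OF i] *(4)[OF i]])
  assume node: "\<And>i. i < length us \<Longrightarrow> same_node (us ! 0) (us ! i)" and "us \<noteq> []"
  then have 0: "(us ! 0, vs ! 0) \<in> c" using *(4) by simp
  let ?ps = "zip (map val us) (map val vs)"
  have "set ?ps \<subseteq> node_map p c (branch (us ! 0)) (q (index (us ! 0))) (q (index (vs ! 0)))"
  proof
    fix x assume "x \<in> set ?ps"
    then obtain i where i: "i < length us" "x = (val (us ! i), val (vs ! i))"
      using *(1) by (auto simp: set_zip)
    then show "x \<in> node_map p c (branch (us ! 0)) (q (index (us ! 0))) (q (index (vs ! 0)))"
      using state_pair(3)[OF *(2) 0 *(4)[OF i(1)] node[OF i(1)]] by simp
  qed
  from type_map_lists[OF state_pair(4)[OF *(2) 0 0] this] show "tk (map val us) = tk (map val vs)"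
    using *(1) by simp
qed

end

section \<open>Bounding the models\<close>

lemma class_representatives:
  assumes refl: "\<And>v. v \<in> V \<Longrightarrow> E v v" and sym: "\<And>v w. v \<in> V \<Longrightarrow> w \<in> V \<Longrightarrow> E v w \<Longrightarrow> E w v"
    and trans: "\<And>u v w. u \<in> V \<Longrightarrow> v \<in> V \<Longrightarrow> w \<in> V \<Longrightarrow> E u v \<Longrightarrow> E v w \<Longrightarrow> E u w"
  shows "\<exists>r. \<forall>v\<in>V. r v \<in> V \<and> E v (r v) \<and> (\<forall>w\<in>V. r v = r w \<longleftrightarrow> E v w)"
proof -
  define r where "r v = (SOME w. w \<in> V \<and> E v w)" for v
  have r: "r v \<in> V \<and> E v (r v)" if v: "v \<in> V" for v
    unfolding r_def by (rule someI[of "\<lambda>w. w \<in> V \<and> E v w" v]) (use v refl in simp)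
  have "r v = r w \<longleftrightarrow> E v w" if vw: "v \<in> V" "w \<in> V" for v w
  proof
    assume "r v = r w"
    then have "E v (r w)" using r[OF vw(1)] by simp
    moreover have "E (r w) w" using sym[OF vw(2)] r[OF vw(2)] by blast
    ultimately show "E v w" using trans[OF vw(1) _ vw(2)] r[OF vw(2)] by blast
  next
    assume e: "E v w"
    have "x \<in> V \<and> E v x \<longleftrightarrow> x \<in> V \<and> E w x" for x
      using trans[OF vw(1,2), of x] trans[OF vw(2,1), of x] e sym[OF vw e] by blast
    then show "r v = r w" by (simp add: r_def)
  qed
  then have "\<forall>v\<in>V. r v \<in> V \<and> E v (r v) \<and> (\<forall>w\<in>V. r v = r w \<longleftrightarrow> E v w)" using r by simp
  then show ?thesis by (rule exI[of _ r])
qed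

text \<open>The bound is requested only for transversals that meet every class, since a set of
  representatives over a node can be typed like \<open>K\<close> only if it represents every value
  there.\<close>

lemma class_coding:
  assumes refl: "\<And>v. v \<in> V \<Longrightarrow> E v v" and sym: "\<And>v w. v \<in> V \<Longrightarrow> w \<in> V \<Longrightarrow> E v w \<Longrightarrow> E w v"
    and trans: "\<And>u v w. u \<in> V \<Longrightarrow> v \<in> V \<Longrightarrow> w \<in> V \<Longrightarrow> E u v \<Longrightarrow> E v w \<Longrightarrow> E u w"
    and bound: "\<And>X. X \<subseteq> V \<Longrightarrow> (\<And>x y. x \<in> X \<Longrightarrow> y \<in> X \<Longrightarrow> E x y \<Longrightarrow> x = y) \<Longrightarrow>
       (\<And>v. v \<in> V \<Longrightarrow> \<exists>x\<in>X. E v x) \<Longrightarrow> |X| \<le>o |B|"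
  shows "\<exists>c. (\<forall>v\<in>V. c v \<in> B) \<and> (\<forall>v\<in>V. \<forall>w\<in>V. c v = c w \<longleftrightarrow> E v w)"
proof -
  have "\<exists>r. \<forall>v\<in>V. r v \<in> V \<and> E v (r v) \<and> (\<forall>w\<in>V. r v = r w \<longleftrightarrow> E v w)"
    by (rule class_representatives) (fact refl sym trans)+
  then obtain r where r0: "\<forall>v\<in>V. r v \<in> V \<and> E v (r v) \<and> (\<forall>w\<in>V. r v = r w \<longleftrightarrow> E v w)" ..
  have r: "v \<in> V \<Longrightarrow> r v \<in> V" "v \<in> V \<Longrightarrow> E v (r v)" "v \<in> V \<Longrightarrow> w \<in> V \<Longrightarrow> r v = r w \<longleftrightarrow> E v w" for v w
    using r0 by simp_all
  have "|r ` V| \<le>o |B|"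
  proof (rule bound)
    show "r ` V \<subseteq> V" using r(1) by (rule image_subsetI)
    show "x = y" if xy: "x \<in> r ` V" "y \<in> r ` V" "E x y" for x y
    proof -
      obtain v w where vw: "v \<in> V" "x = r v" "w \<in> V" "y = r w" using xy(1,2) by blast
      have "r v = r (r v)" "r w = r (r w)" using r(3)[OF vw(1) r(1)[OF vw(1)]] r(2)[OF vw(1)]
          r(3)[OF vw(3) r(1)[OF vw(3)]] r(2)[OF vw(3)] by simp_all
      moreover have "r (r v) = r (r w)" using r(3)[OF r(1)[OF vw(1)] r(1)[OF vw(3)]] xy(3) vw by simp
      ultimately show ?thesis using vw by simp
    qed
    show "\<exists>x\<in>r ` V. E v x" if "v \<in> V" for v using r(2)[OF that] that by blast
  qed
  then have "\<exists>e. inj_on e (r ` V) \<and> e ` r ` V \<subseteq> B" by (simp only: card_of_ordLeq)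
  then obtain e where e: "inj_on e (r ` V)" "e ` r ` V \<subseteq> B" by blast
  have "e (r v) \<in> B" if "v \<in> V" for v using e(2) that by blast
  moreover have "e (r v) = e (r w) \<longleftrightarrow> E v w" if "v \<in> V" "w \<in> V" for v w
    using inj_on_eq_iff[OF e(1), of "r v" "r w"] r(3)[OF that] that by simp
  ultimately show ?thesis by (intro exI[of _ "\<lambda>v. e (r v)"]) blast
qed

section \<open>Relations of the tree that the types decide\<close>

context
  fixes I :: "point set" and q :: "point \<Rightarrow> level" and T and ti :: "point list \<Rightarrow> nat"
    and K :: "'a set" and tk :: "'a list \<Rightarrow> nat" and d0 :: 'a
    and s :: "'a elem list \<Rightarrow> nat"
  assumes index: "index_typing I q T ti" and teK: "type_equiv K tk K tk" and d0: "d0 \<in> K"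
    and s: "typing_of (elems I K tk d0) (tree_rel I q ti K tk d0) s"
begin

abbreviation U :: "'a elem set" where "U \<equiv> elems I K tk d0"
abbreviation node :: "'a elem \<Rightarrow> 'a elem \<Rightarrow> bool" where "node \<equiv> same_node q"
abbreviation onb :: "'a elem \<Rightarrow> bool" where "onb \<equiv> on_branch q"

lemma U_parts: "u \<in> U \<Longrightarrow> index u \<in> I" "u \<in> U \<Longrightarrow> val u \<in> K" "u \<in> U \<Longrightarrow> branch u \<in> F K tk d0"
  unfolding elems_def[OF index teK d0] by (simp_all add: mem_Times_iff)

lemma U_I: "f \<in> F K tk d0 \<Longrightarrow> x \<in> I \<Longrightarrow> k \<in> K \<Longrightarrow> (f, x, k) \<in> U"
  unfolding elems_def[OF index teK d0] by simp

lemma teU: "type_equiv U s U s"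
  by (rule typing_of_type_equiv[OF s])

lemma teI': "type_equiv I ti I ti"
  by (rule teI[OF index teK d0])

context
  fixes us vs
  assumes us: "set us \<subseteq> U" and vs: "set vs \<subseteq> U" and eq: "s us = s vs"
begin

lemma s_index: "ti (map index us) = ti (map index vs)"
  by (rule typing_of_invariant[where P = "\<lambda>zs. ti (map index us) = ti (map index zs)", OF s us vs eq])
    (use tree_rel_invariants(2)[OF index teK d0] in simp_all)

lemma s_branch:
  assumes "i < length us" "j < length us"
  shows "branch (us ! i) = branch (us ! j) \<longleftrightarrow> branch (vs ! i) = branch (vs ! j)"
proof -
  let ?P = "\<lambda>zs. length zs = length us \<and>
     (branch (us ! i) = branch (us ! j) \<longleftrightarrow> branch (zs ! i) = branch (zs ! j))"
  have "?P vs"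
    by (rule typing_of_invariant[where P = ?P, OF s us vs eq])
      (use tree_rel_invariants(1,3)[OF index teK d0] assms in simp_all)
  then show ?thesis by blast
qed

lemma s_node:
  assumes "i < length us" "j < length us"
  shows "node (us ! i) (us ! j) \<longleftrightarrow> node (vs ! i) (vs ! j)"
proof -
  let ?P = "\<lambda>zs. length zs = length us \<and> (node (us ! i) (us ! j) \<longleftrightarrow> node (zs ! i) (zs ! j))"
  have "?P vs"
    by (rule typing_of_invariant[where P = ?P, OF s us vs eq])
      (use tree_rel_invariants(1,4)[OF index teK d0] assms in simp_all)
  then show ?thesis by blast
qed

lemma s_onb:
  assumes "i < length us"
  shows "onb (us ! i) \<longleftrightarrow> onb (vs ! i)"
proof -
  let ?P = "\<lambda>zs. length zs = length us \<and> (onb (us ! i) \<longleftrightarrow> onb (zs ! i))"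
  have "?P vs"
    by (rule typing_of_invariant[where P = ?P, OF s us vs eq])
      (use tree_rel_invariants(1,5)[OF index teK d0] assms in simp_all)
  then show ?thesis by blast
qed

text \<open>Elements over one node have their values moved by one node map, which preserves
  \<open>tk\<close>. Over distinct nodes the maps are separate.\<close>

lemma s_val:
  assumes node: "\<And>i. i < length us \<Longrightarrow> node (us ! 0) (us ! i)" and ne: "us \<noteq> []"
  shows "tk (map val us) = tk (map val vs)"
proof -
  let ?P = "\<lambda>zs. zs \<noteq> [] \<and> (\<forall>i<length zs. node (zs ! 0) (zs ! i)) \<and> tk (map val us) = tk (map val zs)"
  have "?P vs"
  proof (rule typing_of_invariant[where P = ?P, OF s us vs eq])
    show "?P us" using node ne by simp
    fix xs ys assume rel: "tree_rel I q ti K tk d0 xs ys" and P: "?P xs"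
    note inv = tree_rel_invariants[OF index teK d0 rel]
    have "ys \<noteq> []" using inv(1) P by auto
    moreover have "node (ys ! 0) (ys ! i)" if "i < length ys" for i
      using inv(4)[of 0 i] inv(1) P that by (cases xs) auto
    moreover have "tk (map val xs) = tk (map val ys)" by (rule inv(6)) (use P in auto)
    ultimately show "?P ys" using P by simp
  qed
  then show ?thesis by blast
qed

end

definition same_index :: "'a elem \<Rightarrow> 'a elem \<Rightarrow> bool" where "same_index u v \<longleftrightarrow> index u = index v"
definition same_branch :: "'a elem \<Rightarrow> 'a elem \<Rightarrow> bool" where "same_branch u v \<longleftrightarrow> branch u = branch v"
definition same_val :: "'a elem \<Rightarrow> 'a elem \<Rightarrow> bool" where "same_val u v \<longleftrightarrow> node u v \<and> val u = val v"
text \<open>A unary predicate, made binary so that \<open>lift\<close> applies.\<close>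

definition fst_onb :: "'a elem \<Rightarrow> 'a elem \<Rightarrow> bool" where "fst_onb u v \<longleftrightarrow> onb u"

lemma node_sym: "node u v \<longleftrightarrow> node v u"
  unfolding same_node_def[OF index teK d0] using agree_sym by metis

lemma node_trans: "node u v \<Longrightarrow> node v w \<Longrightarrow> node u w"
  unfolding same_node_def[OF index teK d0] using agree_trans by metis

lemma node_refl: "node u u"
  unfolding same_node_def[OF index teK d0] by simp

definition preserved :: "('a elem \<Rightarrow> 'a elem \<Rightarrow> bool) \<Rightarrow> bool" where
  "preserved P \<longleftrightarrow> (\<forall>u u' v v'. u \<in> U \<longrightarrow> u' \<in> U \<longrightarrow> v \<in> U \<longrightarrow> v' \<in> U \<longrightarrow>
     s [u, u'] = s [v, v'] \<longrightarrow> P u u' \<longrightarrow> P v v')"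

lemma preserved: "preserved same_index" "preserved same_branch" "preserved node" "preserved same_val" "preserved fst_onb"
proof -
  have *: "(same_index u u' \<longrightarrow> same_index v v') \<and> (same_branch u u' \<longrightarrow> same_branch v v') \<and>
      (node u u' \<longrightarrow> node v v') \<and> (same_val u u' \<longrightarrow> same_val v v') \<and> (fst_onb u u' \<longrightarrow> fst_onb v v')"
    if mem: "u \<in> U" "u' \<in> U" "v \<in> U" "v' \<in> U" and eq: "s [u, u'] = s [v, v']" for u u' v v'
  proof -
    have st: "set [u, u'] \<subseteq> U" "set [v, v'] \<subseteq> U" using mem by simp_all
    note h = st eq
    have "set (map index [u, u']) \<subseteq> I" "set (map index [v, v']) \<subseteq> I" using mem U_parts(1) by simp_all
    from type_equiv_eq[OF teI' this s_index[OF h], of 0 1]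
    have 1: "same_index u u' \<longrightarrow> same_index v v'" by (simp add: same_index_def)
    have 2: "same_branch u u' \<longrightarrow> same_branch v v'" using s_branch[OF h, of 0 1] by (simp add: same_branch_def)
    have 3: "node u u' \<longrightarrow> node v v'" using s_node[OF h, of 0 1] by simp
    have 5: "fst_onb u u' \<longrightarrow> fst_onb v v'" using s_onb[OF h, of 0] by (simp add: fst_onb_def)
    have "same_val v v'" if sv: "same_val u u'"
    proof -
      have n: "node u u'" using sv by (simp add: same_val_def)
      have "tk (map val [u, u']) = tk (map val [v, v'])"
      proof (rule s_val[OF h])
        fix i assume "i < length [u, u']"
        then have "i = 0 \<or> i = 1" by auto
        then show "node ([u, u'] ! 0) ([u, u'] ! i)" using n node_refl[of u] by (elim disjE) simp_all
      qed simp
      moreover have "set (map val [u, u']) \<subseteq> K" "set (map val [v, v']) \<subseteq> K" using mem U_parts(2) by simp_all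
      ultimately have "val u = val u' \<longleftrightarrow> val v = val v'" using type_equiv_eq[OF teK, of "map val [u, u']" "map val [v, v']" 0 1] by simp
      then show ?thesis using sv 3 n by (simp add: same_val_def)
    qed
    then show ?thesis using 1 2 3 5 by blast
  qed
  show "preserved same_index" "preserved same_branch" "preserved node" "preserved same_val" "preserved fst_onb"
    unfolding preserved_def using * by blast+
qed

section \<open>Transfer of the tree to an equivalent typed set\<close>

context
  fixes V :: "'v set" and t :: "'v list \<Rightarrow> nat"
  assumes te: "type_equiv U s V t"
begin

text \<open>\<open>lift P\<close> is the relation on \<open>V\<close> that corresponds to \<open>P\<close>, meaningful if \<open>P\<close> is invariant.\<close>

definition lift :: "('a elem \<Rightarrow> 'a elem \<Rightarrow> bool) \<Rightarrow> 'v \<Rightarrow> 'v \<Rightarrow> bool" where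
  "lift P v v' \<longleftrightarrow> (\<exists>u\<in>U. \<exists>u'\<in>U. s [u, u'] = t [v, v'] \<and> P u u')"

definition matched :: "'a elem list \<Rightarrow> 'v list \<Rightarrow> bool" where
  "matched us vs \<longleftrightarrow> set us \<subseteq> U \<and> set vs \<subseteq> V \<and> s us = t vs"

lemma matchedD:
  assumes "matched us vs"
  shows "set us \<subseteq> U" "set vs \<subseteq> V" "s us = t vs" "length us = length vs"
  using assms type_equiv_length[OF te, of us vs] by (simp_all add: matched_def)

lemma matched_sub:
  assumes m: "matched us vs" and "is": "set is \<subseteq> {..<length us}"
  shows "matched (map ((!) us) is) (map ((!) vs) is)"
proof -
  have "set (map ((!) us) is) \<subseteq> set us" "set (map ((!) vs) is) \<subseteq> set vs"
    using "is" matchedD(4)[OF m] by (auto simp: subset_iff)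
  then show ?thesis using matchedD(1,2)[OF m] type_equiv_sub[OF te matchedD(1-3)[OF m] "is"]
    unfolding matched_def by blast
qed

lemma matched_zip:
  assumes m: "matched us vs" and ps: "set ps \<subseteq> set (zip us vs)"
  shows "matched (map fst ps) (map snd ps)"
proof -
  obtain "is" where "is": "set is \<subseteq> {..<length (zip us vs)}" "ps = map ((!) (zip us vs)) is"
    by (rule index_list_exists[OF ps])
  have "map fst ps = map ((!) us) is" "map snd ps = map ((!) vs) is"
    using "is" matchedD(4)[OF m] by (auto simp: subset_iff)
  then show ?thesis using matched_sub[OF m, of "is"] "is"(1) matchedD(4)[OF m] by simp
qed

lemma matched_exists: "set vs \<subseteq> V \<Longrightarrow> \<exists>us. matched us vs"
  by (rule type_equiv_match_back[OF te]) (auto simp: matched_def)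

lemma matched_forth: "matched us vs \<Longrightarrow> u \<in> U \<Longrightarrow> \<exists>v\<in>V. matched (us @ [u]) (vs @ [v])"
  using type_equiv_forth[OF te, of us vs u] by (auto simp: matched_def)

lemma matched_back: "matched us vs \<Longrightarrow> v \<in> V \<Longrightarrow> \<exists>u\<in>U. matched (us @ [u]) (vs @ [v])"
  using type_equiv_back[OF te, of us vs v] by (auto simp: matched_def)

lemma matched_eq: "matched us vs \<Longrightarrow> i < length us \<Longrightarrow> j < length us \<Longrightarrow> us ! i = us ! j \<longleftrightarrow> vs ! i = vs ! j"
  by (rule type_equiv_eq[OF te]) (auto simp: matched_def)

lemma lift_iff:
  assumes P: "preserved P" and m: "matched us vs" and ij: "i < length us" "j < length us"
  shows "lift P (vs ! i) (vs ! j) \<longleftrightarrow> P (us ! i) (us ! j)"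
proof -
  have "matched (map ((!) us) [i, j]) (map ((!) vs) [i, j])" by (rule matched_sub[OF m]) (use ij in simp)
  then have m2: "us ! i \<in> U" "us ! j \<in> U" "s [us ! i, us ! j] = t [vs ! i, vs ! j]"
    by (simp_all add: matched_def)
  show ?thesis
  proof
    assume "lift P (vs ! i) (vs ! j)"
    then obtain u u' where u: "u \<in> U" "u' \<in> U" "s [u, u'] = t [vs ! i, vs ! j]" "P u u'"
      unfolding lift_def by blast
    have "s [u, u'] = s [us ! i, us ! j]" using u(3) m2(3) by simp
    with P u(1,2,4) m2(1,2) show "P (us ! i) (us ! j)" unfolding preserved_def by blast
  next
    assume "P (us ! i) (us ! j)"
    then show "lift P (vs ! i) (vs ! j)" unfolding lift_def using m2 by blast
  qed
qed

lemma matched1: "v \<in> V \<Longrightarrow> \<exists>u\<in>U. matched [u] [v]"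
  using matched_back[of "[]" "[]" v] type_equiv_Nil[OF te] by (simp add: matched_def)

lemma matched2: "v \<in> V \<Longrightarrow> w \<in> V \<Longrightarrow> \<exists>u u'. matched [u, u'] [v, w]"
  using matched1[of v] matched_back[of "[_]" "[v]" w] by fastforce

lemma matched3: "v \<in> V \<Longrightarrow> w \<in> V \<Longrightarrow> x \<in> V \<Longrightarrow> \<exists>u u' u''. matched [u, u', u''] [v, w, x]"
  using matched2[of v w] matched_back[of "[_, _]" "[v, w]" x] by fastforce

lemma lift_pair: "preserved P \<Longrightarrow> matched [u, u'] [v, w] \<Longrightarrow> lift P v w \<longleftrightarrow> P u u'"
  using lift_iff[of P "[u, u']" "[v, w]" 0 1] by simp

lemma lift_equiv:
  assumes P: "preserved P" and eq: "equivp P"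
  shows "v \<in> V \<Longrightarrow> lift P v v" "v \<in> V \<Longrightarrow> w \<in> V \<Longrightarrow> lift P v w \<Longrightarrow> lift P w v"
    "v \<in> V \<Longrightarrow> w \<in> V \<Longrightarrow> x \<in> V \<Longrightarrow> lift P v w \<Longrightarrow> lift P w x \<Longrightarrow> lift P v x"
proof -
  show "lift P v v" if v: "v \<in> V"
  proof -
    obtain u where "matched [u] [v]" using matched1[OF v] by blast
    from lift_iff[OF P this, of 0 0] equivp_reflp[OF eq] show ?thesis by simp
  qed
  show "lift P w v" if vw: "v \<in> V" "w \<in> V" "lift P v w"
  proof -
    obtain u u' where m: "matched [u, u'] [v, w]" using matched2[OF vw(1,2)] by blast
    from lift_iff[OF P m, of 0 1] lift_iff[OF P m, of 1 0] vw(3) equivp_symp[OF eq, of u u'] show ?thesis by simp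
  qed
  show "lift P v x" if vw: "v \<in> V" "w \<in> V" "x \<in> V" "lift P v w" "lift P w x"
  proof -
    obtain u u' u'' where m: "matched [u, u', u''] [v, w, x]" using matched3[OF vw(1-3)] by blast
    from lift_iff[OF P m, of 0 1] lift_iff[OF P m, of 1 2] lift_iff[OF P m, of 0 2] vw(4,5) equivp_transp[OF eq, of u u' u'']
    show ?thesis by simp
  qed
qed

text \<open>In \<open>V\<close> an index survives only as a class of the lifted relation.
  \<open>T\<close> is lifted to a transversal of these classes through matched triples, and both
  hypotheses of \<open>kuratowski_bound\<close> are transferred.\<close>

lemma index_coding: "\<exists>c :: 'v \<Rightarrow> omega1. \<forall>v\<in>V. \<forall>w\<in>V. c v = c w \<longleftrightarrow> lift same_index v w"
proof -
  note P = preserved(1)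
  have e: "equivp same_index" by (rule equivpI) (auto simp: reflp_def symp_def transp_def same_index_def)
  note eqv = lift_equiv[OF P e]
  have "\<exists>c :: 'v \<Rightarrow> omega1. (\<forall>v\<in>V. c v \<in> UNIV) \<and> (\<forall>v\<in>V. \<forall>w\<in>V. c v = c w \<longleftrightarrow> lift same_index v w)"
  proof (rule class_coding[of V "lift same_index" UNIV])
    show "lift same_index v v" if "v \<in> V" for v by (rule eqv(1)[OF that])
    show "lift same_index w v" if "v \<in> V" "w \<in> V" "lift same_index v w" for v w by (rule eqv(2)[OF that])
    show "lift same_index v x" if "v \<in> V" "w \<in> V" "x \<in> V" "lift same_index v w" "lift same_index w x" for v w x
      by (rule eqv(3)[OF that])
    fix X assume X: "X \<subseteq> V" and tr: "\<And>x y. x \<in> X \<Longrightarrow> y \<in> X \<Longrightarrow> lift same_index x y \<Longrightarrow> x = y"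
    define TV where "TV a b c \<longleftrightarrow> (\<exists>u u' u''. matched [u, u', u''] [a, b, c] \<and> T (index u) (index u') (index u''))"
      for a b c
    have Tinv: "T (index u) (index u') (index u'') \<longleftrightarrow> T (index v) (index v') (index v'')"
      if m: "matched [u, u', u''] [a, b, c]" "matched [v, v', v''] [a, b, c]" for u u' u'' v v' v'' a b c
    proof -
      have U3: "set [u, u', u''] \<subseteq> U" "set [v, v', v''] \<subseteq> U" using matchedD(1)[OF m(1)] matchedD(1)[OF m(2)] .
      have "s [u, u', u''] = s [v, v', v'']" using matchedD(3)[OF m(1)] matchedD(3)[OF m(2)] by simp
      note e = s_index[OF U3 this]
      have "\<forall>xs ys i j k. set xs \<subseteq> I \<longrightarrow> set ys \<subseteq> I \<longrightarrow> ti xs = ti ys \<longrightarrow>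
        i < length xs \<longrightarrow> j < length xs \<longrightarrow> k < length xs \<longrightarrow>
        (T (xs ! i) (xs ! j) (xs ! k) \<longleftrightarrow> T (ys ! i) (ys ! j) (ys ! k))"
        using index by (simp add: index_typing_def)
      have "set (map index [u, u', u'']) \<subseteq> I" "set (map index [v, v', v'']) \<subseteq> I"
        using U3 U_parts(1) by simp_all
      note i = this
      from \<open>\<forall>xs ys i j k. _\<close>[rule_format, OF i e, of 0 1 2] show ?thesis by simp
    qed
    have TV: "TV a b c \<longleftrightarrow> T (index u) (index u') (index u'')" if m: "matched [u, u', u''] [a, b, c]" for a b c u u' u''
      unfolding TV_def using Tinv[OF _ m] m by blast
    show "|X| \<le>o |UNIV :: omega1 set|"
    proof (rule kuratowski_bound[of X TV])
      fix a b assume ab: "a \<in> X" "b \<in> X"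
      obtain u u' where m: "matched [u, u'] [a, b]" using matched2 ab X by blast
      let ?G = "{z \<in> I. T (index u) (index u') z}"
      have "index u \<in> I" "index u' \<in> I" using matchedD(1)[OF m] U_parts(1) by simp_all
      then have finG: "finite ?G" using index by (simp add: index_typing_def)
      show "finite {c \<in> X. TV a b c}"
      proof (rule ccontr)
        assume "infinite {c \<in> X. TV a b c}"
        \<comment> \<open>One element more than there are solutions in the tree is enough: matching
          all of \<open>C\<close> at once would give distinct indices inside \<open>?G\<close>,
          because elements of \<open>X\<close> have pairwise different indices.\<close>
        then obtain C where C: "finite C" "card C = Suc (card ?G)" "C \<subseteq> {c \<in> X. TV a b c}"
          using infinite_arbitrarily_large by blast
        obtain cs where cs: "set cs = C" "distinct cs" using finite_distinct_list[OF C(1)] by blast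
        have "set cs \<subseteq> V" using cs(1) C(3) X by auto
        from type_equiv_extend_back[OF te matchedD(1-3)[OF m] this]
        obtain ws where ws: "set ws \<subseteq> U" "length ws = length cs" "s ([u, u'] @ ws) = t ([a, b] @ cs)" by blast
        have mm: "matched ([u, u'] @ ws) ([a, b] @ cs)"
          using ws \<open>set cs \<subseteq> V\<close> matchedD(1,2)[OF m] by (simp add: matched_def)
        have w: "index (ws ! i) \<in> ?G" if i: "i < length cs" for i
        proof -
          have "matched (map ((!) ([u, u'] @ ws)) [0, 1, i + 2]) (map ((!) ([a, b] @ cs)) [0, 1, i + 2])"
            by (rule matched_sub[OF mm]) (use i ws(2) in simp)
          then have m3: "matched [u, u', ws ! i] [a, b, cs ! i]" by (simp add: nth_append)
          have "TV a b (cs ! i)" using C(3) cs(1) i by (auto dest: nth_mem)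
          then have "T (index u) (index u') (index (ws ! i))" using TV[OF m3] by simp
          moreover have "index (ws ! i) \<in> I" using matchedD(1)[OF m3] U_parts(1) by simp
          ultimately show ?thesis by simp
        qed
        have "inj_on (\<lambda>i. index (ws ! i)) {..<length cs}"
        proof (rule inj_onI)
          fix i j assume ij: "i \<in> {..<length cs}" "j \<in> {..<length cs}" "index (ws ! i) = index (ws ! j)"
          then have "lift same_index (([a, b] @ cs) ! (i + 2)) (([a, b] @ cs) ! (j + 2))"
            using lift_iff[OF P mm, of "i + 2" "j + 2"] ws(2) by (simp add: same_index_def nth_append)
          then have "cs ! i = cs ! j" using tr[of "cs ! i" "cs ! j"] ij C(3) cs(1) by (auto dest: nth_mem simp: nth_append)
          then show "i = j" using cs(2) ij nth_eq_iff_index_eq by auto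
        qed
        moreover have "(\<lambda>i. index (ws ! i)) ` {..<length cs} \<subseteq> ?G" using w by auto
        ultimately have "length cs \<le> card ?G" using card_inj_on_le[OF _ _ finG] by fastforce
        moreover have "length cs = Suc (card ?G)" using cs C(2) distinct_card by fastforce
        ultimately show False by simp
      qed
    next
      fix a b c assume abc: "a \<in> X" "b \<in> X" "c \<in> X" "a \<noteq> b" "b \<noteq> c" "a \<noteq> c"
      obtain u u' u'' where m: "matched [u, u', u''] [a, b, c]" using matched3 abc(1-3) X by blast
      have m1: "matched [u', u'', u] [b, c, a]" using matched_sub[OF m, of "[1, 2, 0]"] by simp
      have m2: "matched [u, u'', u'] [a, c, b]" using matched_sub[OF m, of "[0, 2, 1]"] by simp
      have "index u \<noteq> index u'" "index u' \<noteq> index u''" "index u \<noteq> index u''"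
        using lift_iff[OF P m, of 0 1] lift_iff[OF P m, of 1 2] lift_iff[OF P m, of 0 2]
          tr[of a b] tr[of b c] tr[of a c] abc by (auto simp: same_index_def)
      moreover have "index u \<in> I" "index u' \<in> I" "index u'' \<in> I" using matchedD(1)[OF m] U_parts(1) by simp_all
      ultimately show "TV a b c \<or> TV b c a \<or> TV a c b"
        unfolding TV[OF m] TV[OF m1] TV[OF m2] using index by (simp add: index_typing_def)
    qed
  qed
  then show ?thesis by simp
qed

lemma equivp_node: "equivp node"
proof (rule equivpI)
  show "reflp node" by (rule reflpI) (rule node_refl)
  show "symp node" by (rule sympI) (simp only: node_sym)
  show "transp node" by (rule transpI) (rule node_trans)
qed

lemma equivp_same_val: "equivp same_val"
proof (rule equivpI)
  show "reflp same_val" by (rule reflpI) (simp add: same_val_def node_refl)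
  show "symp same_val" by (rule sympI) (simp add: same_val_def node_sym)
  show "transp same_val"
    by (rule transpI) (unfold same_val_def, elim conjE, intro conjI, erule (1) node_trans, simp)
qed

lemma equivp_same_branch: "equivp same_branch"
  by (rule equivpI) (auto simp: reflp_def symp_def transp_def same_branch_def)

text \<open>A complete set of representatives for the values over one node is typed by the values of
  matched elements of the tree. The element \<open>v0\<close> is matched along with every list in
  order to anchor all these elements at one node.\<close>

lemma node_transversal:
  assumes v0: "v0 \<in> V" and Z: "Z \<subseteq> V" and nd: "\<And>v. v \<in> Z \<Longrightarrow> lift node v0 v"
    and tr: "\<And>v w. v \<in> Z \<Longrightarrow> w \<in> Z \<Longrightarrow> lift same_val v w \<Longrightarrow> v = w"
    and full: "\<And>v. v \<in> V \<Longrightarrow> lift node v0 v \<Longrightarrow> \<exists>w\<in>Z. lift same_val v w"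
  shows "\<exists>z. type_equiv K tk Z z"
proof -
  define z where "z zs = (SOME n. \<exists>u us. matched (u # us) (v0 # zs) \<and> n = tk (map val us))" for zs
  have nodes: "node u (us ! i)" if m: "matched (u # us) (v0 # zs)" "set zs \<subseteq> Z" "i < length us" for u us zs i
  proof -
    have "lift node v0 (zs ! i)"
      by (rule nd) (use that matchedD(4)[OF m(1)] in auto)
    then show ?thesis using lift_iff[OF preserved(3) m(1), of 0 "Suc i"] m(3) by simp
  qed
  have z: "z zs = tk (map val us)" if m: "matched (u # us) (v0 # zs)" "set zs \<subseteq> Z" for u us zs
  proof -
    have uniq: "tk (map val ws) = tk (map val us)" if m': "matched (w # ws) (v0 # zs)" for w ws
    proof -
      have e: "s (w # ws) = s (u # us)" using matchedD(3)[OF m(1)] matchedD(3)[OF m'] by simp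
      have len: "length ws = length us" using matchedD(4)[OF m(1)] matchedD(4)[OF m'] by simp
      have "tk (map val (w # ws)) = tk (map val (u # us))"
      proof (rule s_val[OF matchedD(1)[OF m'] matchedD(1)[OF m(1)] e])
        fix i assume "i < length (w # ws)"
        then show "node ((w # ws) ! 0) ((w # ws) ! i)"
          using node_refl nodes[OF m' m(2)] by (cases i) simp_all
      qed simp
      moreover have "set (map val (w # ws)) \<subseteq> K" "set (map val (u # us)) \<subseteq> K"
        using matchedD(1)[OF m(1)] matchedD(1)[OF m'] U_parts(2) by auto
      ultimately have "tk (map fst (zip (map val ws) (map val us))) = tk (map snd (zip (map val ws) (map val us)))"
        by (intro type_equiv_zip[OF teK, of "map val (w # ws)" "map val (u # us)"]) auto
      then show ?thesis using len by simp
    qed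
    have "\<exists>n u us. matched (u # us) (v0 # zs) \<and> n = tk (map val us)" using m(1) by (intro exI conjI) (assumption, rule refl)
    then have "\<exists>u us. matched (u # us) (v0 # zs) \<and> z zs = tk (map val us)"
      unfolding z_def by (rule someI_ex)
    then show ?thesis by (elim exE conjE) (simp add: uniq)
  qed
  have ex: "\<exists>u us. matched (u # us) (v0 # zs)" if zs: "set zs \<subseteq> Z" for zs
  proof -
    have "set (v0 # zs) \<subseteq> V" using zs Z v0 by auto
    from matched_exists[OF this] obtain us where m: "matched us (v0 # zs)" ..
    then obtain u us' where "us = u # us'" using matchedD(4)[OF m] by (cases us) simp_all
    then show ?thesis using m by blast
  qed
  have "type_equiv K tk Z z"
  proof (rule type_equivI)
    obtain u us where m: "matched (u # us) [v0]" using ex[of "[]"] by auto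
    show "tk [] = z []" using z[OF m] matchedD(4)[OF m] by simp
  next
    fix ks zs assume ks: "set ks \<subseteq> K" and zs: "set zs \<subseteq> Z" and eq: "tk ks = z zs"
    obtain u us where m: "matched (u # us) (v0 # zs)" using ex[OF zs] by blast
    have len: "length us = length zs" using matchedD(4)[OF m] by simp
    have k: "tk ks = tk (map val us)" using eq z[OF m zs] by simp
    have usU: "set (u # us) \<subseteq> U" by (rule matchedD(1)[OF m])
    then have usK: "set (map val us) \<subseteq> K" using U_parts(2) by auto
    have len': "length ks = length us" using type_equiv_length[OF teK ks usK k] by simp
    show "length ks = length zs" using len len' by simp
    show "ks ! i = ks ! j \<longleftrightarrow> zs ! i = zs ! j" if ij: "i < length ks" "j < length ks" for i j
    proof -
      have ij': "i < length us" "j < length us" using ij len' by simp_all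
      have n: "node (us ! i) (us ! j)"
        using node_trans nodes[OF m zs ij'(1)] nodes[OF m zs ij'(2)] node_sym by blast
      have zz: "zs ! i \<in> Z" "zs ! j \<in> Z" using zs ij' len by auto
      have "ks ! i = ks ! j \<longleftrightarrow> val (us ! i) = val (us ! j)"
        using type_equiv_eq[OF teK ks usK k ij] ij' by simp
      also have "\<dots> \<longleftrightarrow> same_val (us ! i) (us ! j)" using n by (simp add: same_val_def)
      also have "\<dots> \<longleftrightarrow> lift same_val (zs ! i) (zs ! j)"
        using lift_iff[OF preserved(4) m, of "Suc i" "Suc j"] ij' by simp
      also have "\<dots> \<longleftrightarrow> zs ! i = zs ! j"
        using tr[OF zz] lift_equiv(1)[OF preserved(4) equivp_same_val, of "zs ! j"] zz Z by auto
      finally show ?thesis .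
    qed
    show "tk (map ((!) ks) is) = z (map ((!) zs) is)" if "is": "set is \<subseteq> {..<length ks}" for "is"
    proof -
      have "matched (map ((!) (u # us)) (0 # map Suc is)) (map ((!) (v0 # zs)) (0 # map Suc is))"
        by (rule matched_sub[OF m]) (use "is" len' in auto)
      then have m': "matched (u # map ((!) us) is) (v0 # map ((!) zs) is)" by (simp add: comp_def)
      have "set (map ((!) zs) is) \<subseteq> Z" using "is" len len' zs by (auto simp: subset_iff)
      note z[OF m' this]
      moreover have "tk (map ((!) ks) is) = tk (map ((!) (map val us)) is)"
        by (rule type_equiv_sub[OF teK ks usK k "is"])
      moreover have "map ((!) (map val us)) is = map val (map ((!) us) is)" using "is" len' by (auto simp: subset_iff)
      ultimately show ?thesis by simp
    qed
    show "\<exists>b\<in>Z. tk (ks @ [a]) = z (zs @ [b])" if a: "a \<in> K" for a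
    proof -
      obtain b where b: "b \<in> K" "tk (ks @ [a]) = tk (map val us @ [b])"
        using type_equiv_forth[OF teK ks usK k a] by blast
      \<comment> \<open>The branch and the index of \<open>u\<close> place \<open>x\<close> over the
        anchoring node; only its value is new.\<close>
      define x where "x = (branch u, index u, b)"
      have "u \<in> U" using usU by simp
      then have xU: "x \<in> U" unfolding x_def by (intro U_I U_parts b(1))
      have nx: "node u x" unfolding same_node_def[OF index teK d0] x_def by simp
      obtain v where v: "v \<in> V" "matched ((u # us) @ [x]) ((v0 # zs) @ [v])"
        using matched_forth[OF m xU] by blast
      have "lift node v0 v"
        using lift_iff[OF preserved(3) v(2), of 0 "Suc (length us)"] nx len by (simp add: nth_append)
      from full[OF v(1) this] obtain w where w: "w \<in> Z" "lift same_val v w" by blast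
      \<comment> \<open>The match \<open>v\<close> of \<open>x\<close> need not belong to
        \<open>Z\<close>, but it has a representative \<open>w\<close> there. Any match
        \<open>y\<close> of \<open>w\<close> has the same value as \<open>x\<close>.\<close>
      obtain y where y: "matched (((u # us) @ [x]) @ [y]) (((v0 # zs) @ [v]) @ [w])"
        using matched_back[OF v(2), of w] w(1) Z by blast
      have "same_val x y"
        using lift_iff[OF preserved(4) y, of "Suc (length us)" "Suc (Suc (length us))"] w(2) len by (simp add: nth_append)
      then have vy: "val y = b" by (simp add: same_val_def x_def)
      have "matched (map fst (zip (u # us @ [y]) (v0 # zs @ [w]))) (map snd (zip (u # us @ [y]) (v0 # zs @ [w])))"
        by (rule matched_zip[OF y]) (use len in auto)
      then have m': "matched (u # us @ [y]) (v0 # zs @ [w])" using len by simp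
      have "z (zs @ [w]) = tk (map val (us @ [y]))" by (rule z[OF m']) (use zs w(1) in simp)
      then show ?thesis using b(2) vy w(1) by (intro bexI[of _ w]) simp_all
    qed
    show "\<exists>a\<in>K. tk (ks @ [a]) = z (zs @ [b])" if b: "b \<in> Z" for b
    proof -
      obtain x where x: "x \<in> U" "matched ((u # us) @ [x]) ((v0 # zs) @ [b])"
        using matched_back[OF m, of b] b Z by blast
      have m': "matched (u # us @ [x]) (v0 # zs @ [b])" using x(2) by simp
      have "z (zs @ [b]) = tk (map val us @ [val x])" using z[OF m'] zs b by simp
      then show ?thesis using type_equiv_back[OF teK ks usK k U_parts(2)[OF x(1)]] by simp
    qed
  qed
  then show ?thesis by blast
qed

text \<open>Every node has its own injection of values into \<open>B\<close>, and fixing one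
  representative of each node makes all its elements use the same injection. Codes over different
  nodes are unrelated.\<close>

lemma val_coding:
  assumes bound: "\<And>Z z. type_equiv K tk (Z :: 'v set) z \<Longrightarrow> |Z| \<le>o |B|"
  shows "\<exists>c. (\<forall>v\<in>V. c v \<in> B) \<and> (\<forall>v\<in>V. \<forall>w\<in>V. lift node v w \<longrightarrow> (c v = c w \<longleftrightarrow> lift same_val v w))"
proof -
  note vn = lift_equiv[OF preserved(3) equivp_node]
  note vv = lift_equiv[OF preserved(4) equivp_same_val]
  define N where "N v0 = {v \<in> V. lift node v0 v}" for v0
  have ne: "\<exists>c. (\<forall>v\<in>N v0. c v \<in> B) \<and> (\<forall>v\<in>N v0. \<forall>w\<in>N v0. c v = c w \<longleftrightarrow> lift same_val v w)" if v0: "v0 \<in> V" for v0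
  proof (rule class_coding)
    show "lift same_val v v" if "v \<in> N v0" for v using vv(1)[of v] that by (simp add: N_def)
    show "lift same_val w v" if "v \<in> N v0" "w \<in> N v0" "lift same_val v w" for v w
      using vv(2)[of v w] that by (simp add: N_def)
    show "lift same_val v x" if "v \<in> N v0" "w \<in> N v0" "x \<in> N v0" "lift same_val v w" "lift same_val w x" for v w x
      using vv(3)[of v w x] that by (simp add: N_def)
    fix X assume X: "X \<subseteq> N v0" "\<And>x y. x \<in> X \<Longrightarrow> y \<in> X \<Longrightarrow> lift same_val x y \<Longrightarrow> x = y"
      "\<And>v. v \<in> N v0 \<Longrightarrow> \<exists>x\<in>X. lift same_val v x"
    have "\<exists>z. type_equiv K tk X z"
    proof (rule node_transversal[OF v0])
      show "X \<subseteq> V" using X(1) by (auto simp: N_def)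
      show "lift node v0 v" if "v \<in> X" for v using X(1) that by (auto simp: N_def)
      show "v = w" if "v \<in> X" "w \<in> X" "lift same_val v w" for v w by (rule X(2)[OF that])
      show "\<exists>w\<in>X. lift same_val v w" if "v \<in> V" "lift node v0 v" for v by (rule X(3)) (simp add: N_def that)
    qed
    then show "|X| \<le>o |B|" using bound by (elim exE)
  qed
  then have "\<forall>v0\<in>V. \<exists>c. (\<forall>v\<in>N v0. c v \<in> B) \<and> (\<forall>v\<in>N v0. \<forall>w\<in>N v0. c v = c w \<longleftrightarrow> lift same_val v w)"
    by (rule ballI)
  from bchoice[OF this] obtain e where e: "\<forall>v0\<in>V. (\<forall>v\<in>N v0. e v0 v \<in> B) \<and> (\<forall>v\<in>N v0. \<forall>w\<in>N v0. e v0 v = e v0 w \<longleftrightarrow> lift same_val v w)" ..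
  have "\<exists>r. \<forall>v\<in>V. r v \<in> V \<and> lift node v (r v) \<and> (\<forall>w\<in>V. r v = r w \<longleftrightarrow> lift node v w)"
    by (rule class_representatives) (fact vn)+
  then obtain r where r: "\<forall>v\<in>V. r v \<in> V \<and> lift node v (r v) \<and> (\<forall>w\<in>V. r v = r w \<longleftrightarrow> lift node v w)" ..
  have rN: "v \<in> N (r v)" if "v \<in> V" for v using r vn(2)[of v "r v"] that by (simp add: N_def)
  have "e (r v) v \<in> B" if "v \<in> V" for v using e r rN[OF that] that by blast
  moreover have "e (r v) v = e (r w) w \<longleftrightarrow> lift same_val v w" if "v \<in> V" "w \<in> V" "lift node v w" for v w
  proof -
    have "r v = r w" using r that by blast
    then have "w \<in> N (r v)" "r v \<in> V" using rN[OF that(2)] r[rule_format, OF that(1)] by simp_all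
    then show ?thesis using e rN[OF that(1)] \<open>r v = r w\<close> by simp
  qed
  ultimately show ?thesis by (intro exI[of _ "\<lambda>v. e (r v) v"]) simp
qed

text \<open>The value of an element on its branch is the point of the branch at the level of its
  index, so branch and index determine the element. This makes the choice in
  \<open>model_bound\<close> unique.\<close>

lemma on_branch_unique:
  assumes vw: "v \<in> V" "w \<in> V" and eq: "lift same_branch v w" "lift same_index v w"
    and on: "lift fst_onb v v" "lift fst_onb w w"
  shows "v = w"
proof -
  obtain x y where m: "matched [x, y] [v, w]" using matched2[OF vw] by blast
  have 1: "branch x = branch y" "index x = index y"
    using lift_pair[OF preserved(2) m] lift_pair[OF preserved(1) m] eq by (simp_all add: same_branch_def same_index_def)
  have "onb x" "onb y"
    using lift_iff[OF preserved(5) m, of 0 0] lift_iff[OF preserved(5) m, of 1 1] on by (simp_all add: fst_onb_def)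
  then have "val x = val y" using 1 by (simp add: on_branch_def[OF index teK d0])
  then have "x = y" using 1 by (simp add: prod_eq_iff)
  then show ?thesis using matched_eq[OF m, of 0 1] by simp
qed

text \<open>An element is determined by its index, its value code and the value codes along its branch.\<close>

lemma model_bound:
  assumes bound: "\<And>Z z. type_equiv K tk (Z :: 'v set) z \<Longrightarrow> |Z| \<le>o |B|"
  shows "|V| \<le>o |Func (UNIV :: omega1 set) B \<times> (UNIV :: omega1 set) \<times> B|"
proof -
  obtain i :: "'v \<Rightarrow> omega1" where i: "\<forall>v\<in>V. \<forall>w\<in>V. i v = i w \<longleftrightarrow> lift same_index v w"
    using index_coding ..
  have "\<exists>c. (\<forall>v\<in>V. c v \<in> B) \<and> (\<forall>v\<in>V. \<forall>w\<in>V. lift node v w \<longrightarrow> (c v = c w \<longleftrightarrow> lift same_val v w))"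
    by (rule val_coding) (rule bound)
  then obtain c where c: "\<forall>v\<in>V. c v \<in> B" "\<forall>v\<in>V. \<forall>w\<in>V. lift node v w \<longrightarrow> (c v = c w \<longleftrightarrow> lift same_val v w)"
    by (elim exE conjE)
  define Q where "Q v j w \<longleftrightarrow> w \<in> V \<and> lift same_branch v w \<and> i w = j \<and> lift fst_onb w w" for v j w
  \<comment> \<open>This is the code of the element at which the branch of \<open>v\<close> passes
    through the index coded by \<open>j\<close>. Where there is none, \<open>c v\<close> serves as a
    default value in \<open>B\<close>.\<close>
  define h where "h v j = (if \<exists>w. Q v j w then c (SOME w. Q v j w) else c v)" for v j
  have QV: "Q v j w \<Longrightarrow> w \<in> V" for v j w by (simp add: Q_def)
  have hB: "h v j \<in> B" if "v \<in> V" for v j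
  proof (cases "\<exists>w. Q v j w")
    case True
    then have "(SOME w. Q v j w) \<in> V" using someI_ex[of "Q v j"] QV by blast
    then show ?thesis using c(1) True by (simp add: h_def)
  qed (use c(1) that in \<open>simp add: h_def\<close>)
  note eb = lift_equiv[OF preserved(2) equivp_same_branch]
  have h: "h v j = c w" if v: "v \<in> V" and w: "Q v j w" for v j w
  proof -
    have w': "Q v j (SOME w. Q v j w)" by (rule someI[of "Q v j", OF w])
    have "(SOME w. Q v j w) = w"
    proof (rule on_branch_unique)
      show V: "(SOME w. Q v j w) \<in> V" "w \<in> V" using QV w w' by blast+
      show "lift same_branch (SOME w. Q v j w) w"
        using eb(3)[OF V(1) v V(2)] eb(2)[OF v V(1)] w w' by (simp add: Q_def)
      show "lift same_index (SOME w. Q v j w) w"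
        using i[rule_format, OF V] w w' by (simp add: Q_def)
      show "lift fst_onb (SOME w. Q v j w) (SOME w. Q v j w)" "lift fst_onb w w" using w w' by (simp_all add: Q_def)
    qed
    then show ?thesis using w by (auto simp: h_def)
  qed
  define g where "g v = (h v, i v, c v)" for v
  have "inj_on g V"
  proof (rule inj_onI)
    fix v v' assume vv: "v \<in> V" "v' \<in> V" and "g v = g v'"
    then have gg: "h v = h v'" "i v = i v'" "c v = c v'" by (simp_all add: g_def)
    obtain u u' where m: "matched [u, u'] [v, v']" using matched2[OF vv] by blast
    have uU: "u \<in> U" "u' \<in> U" using matchedD(1)[OF m] by simp_all
    have ind: "index u = index u'"
      using i[rule_format, OF vv] gg(2) lift_pair[OF preserved(1) m] by (simp add: same_index_def)
    have br: "branch u = branch u'"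
    proof (rule ccontr)
      assume "branch u \<noteq> branch u'"
      from splits_exists[OF index teK d0 U_parts(3)[OF uU(1)] U_parts(3)[OF uU(2)] this]
      obtain d where d: "splits (branch u) (branch u') d" ..
      obtain x where x: "x \<in> I" "q x = d" using q_surj[OF index teK d0] by (metis UNIV_I imageE)
      have FK: "f d \<in> K" if "f \<in> F K tk d0" for f :: "level \<Rightarrow> 'a"
        using F_D[OF index teK d0 that] by (simp add: D_def[OF index teK d0])
      \<comment> \<open>At the splitting level both branches pass through the same node at different
        points. If \<open>h\<close> agreed on \<open>v\<close> and \<open>v'\<close>, the matches of
        \<open>y\<close> and \<open>y'\<close> would have equal codes over this node, hence equal
        values.\<close>
      define y y' where "y = (branch u, x, branch u d)" and "y' = (branch u', x, branch u' d)"
      have y: "y \<in> U" "y' \<in> U" unfolding y_def y'_def by (intro U_I U_parts uU x(1) FK)+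
      obtain w where w: "w \<in> V" "matched ([u, u'] @ [y]) ([v, v'] @ [w])" using matched_forth[OF m y(1)] by blast
      obtain w' where w': "w' \<in> V" "matched (([u, u'] @ [y]) @ [y']) (([v, v'] @ [w]) @ [w'])"
        using matched_forth[OF w(2) y(2)] by blast
      have m4: "matched [u, u', y, y'] [v, v', w, w']" using w'(2) by simp
      have on: "onb y" "onb y'" by (simp_all add: on_branch_def[OF index teK d0] y_def y'_def x(2))
      have "lift same_branch v w" "lift same_branch v' w'" "lift fst_onb w w" "lift fst_onb w' w'" "lift same_index w w'"
        using lift_iff[OF preserved(2) m4, of 0 2] lift_iff[OF preserved(2) m4, of 1 3]
          lift_iff[OF preserved(5) m4, of 2 2] lift_iff[OF preserved(5) m4, of 3 3] lift_iff[OF preserved(1) m4, of 2 3] on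
        by (simp_all add: same_branch_def fst_onb_def same_index_def y_def y'_def numeral_nat)
      then have "Q v (i w) w" "Q v' (i w) w'" using w(1) w'(1) i[rule_format, OF w(1) w'(1)] by (simp_all add: Q_def)
      then have "c w = c w'" using h[OF vv(1)] h[OF vv(2)] gg(1) by metis
      moreover have "node y y'" using d by (simp add: same_node_def[OF index teK d0] y_def y'_def x(2) splits_def)
      then have "lift node w w'" using lift_iff[OF preserved(3) m4, of 2 3] by (simp add: numeral_nat)
      ultimately have "lift same_val w w'" using c(2) w(1) w'(1) by blast
      then have "same_val y y'" using lift_iff[OF preserved(4) m4, of 2 3] by (simp add: numeral_nat)
      then show False using d by (simp add: same_val_def y_def y'_def splits_def)
    qed
    have "node u u'" using ind br by (simp add: same_node_def[OF index teK d0])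
    then have "lift node v v'" using lift_pair[OF preserved(3) m] by simp
    then have "lift same_val v v'" using c(2) vv gg(3) by blast
    then have "val u = val u'" using lift_pair[OF preserved(4) m] by (simp add: same_val_def)
    then have "u = u'" using ind br by (simp add: prod_eq_iff)
    then show "v = v'" using matched_eq[OF m, of 0 1] by simp
  qed
  moreover have "g ` V \<subseteq> Func (UNIV :: omega1 set) B \<times> (UNIV :: omega1 set) \<times> B"
    using hB c(1) by (simp add: g_def Func_def image_subset_iff)
  ultimately show ?thesis using card_of_ordLeq by blast
qed

end

end

section \<open>Cardinal arithmetic and the theorem\<close>

text \<open>By Koenig's diagonal argument, with \<open>e\<close> an enumeration of all sequences in \<open>K\<close> by \<open>K\<close>.\<close>

lemma large_fibre:
  fixes p :: "'a \<Rightarrow> nat"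
  assumes ne: "K \<noteq> {}" and le: "|Func (UNIV :: nat set) K| \<le>o |K|"
  shows "\<exists>n. |{k \<in> K. p k = n}| =o |K|"
proof (rule ccontr)
  assume no: "\<nexists>n. |{k \<in> K. p k = n}| =o |K|"
  have small: "|{k \<in> K. p k = n}| <o |K|" for n
    using no card_of_mono1[of "{k \<in> K. p k = n}" K] ordLeq_iff_ordLess_or_ordIso by blast
  have "Func (UNIV :: nat set) K \<noteq> {}" using ne by (simp add: Func_is_emp)
  from card_of_ordLeq2[OF this, of K] le obtain e where e: "e ` K = Func (UNIV :: nat set) K" by blast
  have "\<exists>y. y \<in> K \<and> y \<notin> (\<lambda>x. e x n) ` {k \<in> K. p k = n}" for n
  proof (rule ccontr)
    assume "\<nexists>y. y \<in> K \<and> y \<notin> (\<lambda>x. e x n) ` {k \<in> K. p k = n}"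
    then have "K \<subseteq> (\<lambda>x. e x n) ` {k \<in> K. p k = n}" by blast
    then have "|K| \<le>o |{k \<in> K. p k = n}|"
      using ordLeq_transitive[OF card_of_mono1 card_of_image] by blast
    then show False using small[of n] not_ordLess_ordLeq by blast
  qed
  then obtain y where y: "\<And>n. y n \<in> K" "\<And>n. y n \<notin> (\<lambda>x. e x n) ` {k \<in> K. p k = n}" by metis
  have "y \<in> Func UNIV K" using y(1) by (simp add: Func_def)
  then obtain x where x: "x \<in> K" "y = e x" using e by blast
  have "y (p x) \<in> (\<lambda>z. e z (p x)) ` {k \<in> K. p k = p x}" using x by (intro image_eqI[of _ _ x]) simp_all
  then show False using y(2) by blast
qed

lemma least_exponent_sequences:
  fixes \<kappa> :: "'a rel"
  assumes le: "least_exponent \<kappa> aleph_1" and \<kappa>: "Card_order \<kappa>" and K: "|K| =o \<kappa>"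
  shows "|Func (UNIV :: nat set) K| \<le>o |K|"
proof -
  \<comment> \<open>The cardinality of the natural numbers as a cardinal order on
    \<open>nat set\<close>, the type of \<open>aleph_1\<close>, because
    \<open>least_exponent\<close> tests minimality at this type.\<close>
  let ?\<nu> = "|range (\<lambda>n :: nat. {n})|"
  have "bij_betw (\<lambda>n :: nat. {n}) UNIV (range (\<lambda>n. {n}))" by (intro inj_on_imp_bij_betw injI) simp
  then have n: "|UNIV :: nat set| =o ?\<nu>" using card_of_ordIso by blast
  have "?\<nu> <o aleph_1"
  proof -
    have "?\<nu> =o natLeq" by (rule ordIso_transitive[OF ordIso_symmetric[OF n] card_of_nat])
    then show ?thesis using cardSuc_greater[OF natLeq_Card_order] by (rule ordIso_ordLess_trans)
  qed
  then have "\<not> aleph_1 \<le>o ?\<nu>" using not_ordLess_ordLeq by blast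
  then have "\<not> \<kappa> <o \<kappa> ^c ?\<nu>" using le card_of_Card_order unfolding least_exponent_def by blast
  then have 1: "\<kappa> ^c ?\<nu> \<le>o \<kappa>"
    using not_ordLess_iff_ordLeq[of "\<kappa> ^c ?\<nu>" \<kappa>] \<kappa> Card_order_cexp[of \<kappa> ?\<nu>] by (simp add: card_order_on_well_order_on)
  have "|K| ^c |UNIV :: nat set| =o \<kappa> ^c ?\<nu>"
    by (rule cexp_cong[OF K n card_of_Card_order card_of_Card_order])
  then have "|Func (UNIV :: nat set) K| =o \<kappa> ^c ?\<nu>" by (simp add: cexp_def Field_card_of)
  from ordIso_ordLeq_trans[OF this 1] show ?thesis using ordLeq_ordIso_trans[OF _ ordIso_symmetric[OF K]] by blast
qed

text \<open>A function on the copy \<open>omega1 \<times> {0}\<close> of \<open>omega1\<close>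
  inside the levels, continued by \<open>d0\<close>, has well-ordered support. So every function
  from \<open>omega1\<close> to \<open>D\<close> yields a branch, and index and value are held
  fixed.\<close>

lemma elems_lower_bound:
  assumes index: "index_typing I q T ti" and teK: "type_equiv K tk K tk" and d0: "d0 \<in> K"
  shows "|Func (UNIV :: omega1 set) (D K tk d0)| \<le>o |elems I K tk d0|"
proof -
  obtain x where x: "x \<in> I" using q_surj[OF index teK d0] by blast
  define f where "f h = (\<lambda>e :: level. if snd e = 0 then h (fst e) else d0)" for h :: "omega1 \<Rightarrow> 'a"
  have wo: "well_ordered {e. f h e \<noteq> d0}" for h
    unfolding well_ordered_def
  proof (intro allI impI)
    fix S assume S: "S \<subseteq> {e. f h e \<noteq> d0}" "S \<noteq> {}"
    have S0: "snd e = 0" if "e \<in> S" for e using S(1) that by (auto simp: f_def split: if_splits)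
    obtain e where e: "e \<in> S" using S(2) by blast
    define a where "a = (LEAST a. (a, 0) \<in> S)"
    have "(fst e, 0) \<in> S" using e S0[OF e] by (metis prod.collapse)
    then have "(a, 0) \<in> S" unfolding a_def by (rule LeastI)
    moreover have "(a, 0) \<le> x" if "x \<in> S" for x
    proof -
      have "(fst x, 0) \<in> S" using that S0[OF that] by (metis prod.collapse)
      then have "a \<le> fst x" unfolding a_def by (rule Least_le)
      then show ?thesis using S0[OF that] by (auto simp: less_eq_prod_def)
    qed
    ultimately show "\<exists>m\<in>S. \<forall>x\<in>S. m \<le> x" by blast
  qed
  have "f h \<in> F K tk d0" if "h \<in> Func UNIV (D K tk d0)" for h
    unfolding F_def[OF index teK d0] using wo that d0_D[OF index teK d0] by (auto simp: f_def Func_def)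
  then have "(\<lambda>h. (f h, x, d0)) ` Func UNIV (D K tk d0) \<subseteq> elems I K tk d0"
    using x d0 by (simp add: elems_def[OF index teK d0] image_subset_iff)
  moreover have "inj_on (\<lambda>h. (f h, x, d0)) (Func UNIV (D K tk d0))"
  proof (rule inj_onI)
    fix h h' assume "(f h, x, d0) = (f h', x, d0)"
    then have "f h (a, 0) = f h' (a, 0)" for a by simp
    then show "h = h'" by (simp add: f_def fun_eq_iff)
  qed
  ultimately show ?thesis using card_of_ordLeq by blast
qed

theorem theorem4p2:
  fixes \<kappa> :: "'a rel"
  assumes "completely_characterizable \<kappa>"
    and "least_exponent \<kappa> aleph_1"
  shows "completely_characterizable (\<kappa> ^c aleph_1)"
proof -
  have \<kappa>: "Cinfinite \<kappa>" using assms(1) unfolding completely_characterizable_def by (rule conjunct1)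
  have \<kappa>C: "Card_order \<kappa>" by (rule conjunct2[OF \<kappa>])
  obtain L and M :: "nat struct" and \<phi> where M: "is_structure L M" "is_scott_sentence L M \<phi>"
    and has: "has_model_of_card L \<phi> \<kappa>" and no: "\<not> has_model_of_card L \<phi> (cardSuc \<kappa>)"
    using assms(1)[unfolded completely_characterizable_def, THEN conjunct2] by (elim exE conjE)
  have sent: "is_sentence L \<phi>" using M(2) by (simp add: is_scott_sentence_def)
  from has obtain N :: "'a struct" where N: "is_structure L N" "|universe N| =o \<kappa>" "models N \<phi>"
    unfolding has_model_of_card_def by (elim exE conjE)
  define K where "K = universe N"
  obtain tk where teK: "type_equiv K tk K tk"
    and rel: "\<forall>R us vs. rel_arity L R = Some (length us) \<longrightarrow> set us \<subseteq> K \<longrightarrow> set vs \<subseteq> K \<longrightarrow>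
       tk us = tk vs \<longrightarrow> (rel_interp N R us \<longleftrightarrow> rel_interp N R vs)"
    and func: "\<forall>f us vs a b. fun_arity L f = Some (length us) \<longrightarrow> set us \<subseteq> K \<longrightarrow> set vs \<subseteq> K \<longrightarrow>
       a \<in> K \<longrightarrow> b \<in> K \<longrightarrow> tk (us @ [a]) = tk (vs @ [b]) \<longrightarrow>
       (fun_interp N f us = a \<longleftrightarrow> fun_interp N f vs = b)"
    unfolding K_def by (rule scott_model_typing_exists[OF M N(1,3)])
  have K: "|K| =o \<kappa>" "K \<noteq> {}" using N(1,2) by (simp_all add: K_def is_structure_def)
  have FK: "|Field \<kappa>| =o \<kappa>" by (rule card_of_Field_ordIso[OF \<kappa>C])
  from large_fibre[OF K(2) least_exponent_sequences[OF assms(2) \<kappa>C K(1)], of "\<lambda>k. tk [k]"]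
  obtain n where n: "|{k \<in> K. tk [k] = n}| =o |K|" ..
  have "{k \<in> K. tk [k] = n} \<noteq> {}" using n K(2) card_of_empty2 ordIso_symmetric by metis
  then obtain d0 where d0: "d0 \<in> K" "tk [d0] = n" by blast
  obtain I q T ti where index: "index_typing I q T ti" using index_typing_exists by (elim exE)
  note ctx = index teK d0(1)
  have D\<kappa>: "|D K tk d0| =o \<kappa>"
    using ordIso_transitive[OF n K(1)] by (simp add: D_def[OF ctx] d0(2))
  obtain s where s: "typing_of (elems I K tk d0) (tree_rel I q ti K tk d0) s"
    using tree_typing_exists[OF ctx] ..
  let ?U = "elems I K tk d0" and ?\<mu> = "\<kappa> ^c aleph_1"
  have teU: "type_equiv ?U s ?U s" by (rule typing_of_type_equiv[OF s])
  have ao: "Card_order aleph_1" by (rule cardSuc_Card_order[OF natLeq_Card_order])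
  have ai: "Cinfinite aleph_1" by (rule Cinfinite_cardSuc[OF natLeq_Cinfinite])
  have two: "ctwo \<le>o \<kappa>" by (rule ctwo_ordLeq_Cinfinite[OF \<kappa>])
  have \<mu>: "Cinfinite ?\<mu>" by (rule Cinfinite_cexp[OF two ai])
  have pow: "|Func (UNIV :: omega1 set) B| =o ?\<mu>" if "|B| =o \<kappa>" for B :: "'a set"
    using cexp_cong[OF that card_omega1 ao card_of_Card_order] by (simp add: cexp_def Field_card_of)
  \<comment> \<open>This is applied over two types, to the tree itself and to a supposed model of
    cardinality \<open>cardSuc ?\<mu>\<close>. The premise \<open>b\<close> is the bound on the
    equivalents of \<open>K\<close> over the same type.\<close>
  have bound: "|V| \<le>o ?\<mu>" if V: "type_equiv ?U s V t"
    and b: "\<And>Z z. type_equiv K tk (Z :: 'v set) z \<Longrightarrow> |Z| \<le>o \<kappa>" for V :: "'v set" and t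
  proof -
    have "|V| \<le>o |Func (UNIV :: omega1 set) (Field \<kappa>) \<times> (UNIV :: omega1 set) \<times> Field \<kappa>|"
    proof (rule model_bound[OF ctx s V])
      fix Z :: "'v set" and z assume "type_equiv K tk Z z"
      from ordLeq_ordIso_trans[OF b[OF this] ordIso_symmetric[OF FK]] show "|Z| \<le>o |Field \<kappa>|" .
    qed
    also have "|Func (UNIV :: omega1 set) (Field \<kappa>) \<times> (UNIV :: omega1 set) \<times> Field \<kappa>| \<le>o ?\<mu>"
    proof -
      have inf: "\<not> finite (Field ?\<mu>)" and C: "Card_order ?\<mu>" using \<mu> by (simp_all add: cinfinite_def)
      have 1: "|Func (UNIV :: omega1 set) (Field \<kappa>)| \<le>o ?\<mu>" by (rule ordIso_imp_ordLeq[OF pow[OF FK]])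
      have 2: "|UNIV :: omega1 set| \<le>o ?\<mu>"
        by (rule ordIso_ordLeq_trans[OF card_omega1 ordLeq_cexp2[OF two ao]])
      have 3: "|Field \<kappa>| \<le>o ?\<mu>"
        by (rule ordIso_ordLeq_trans[OF FK ordLeq_cexp1[OF Cinfinite_Cnotzero[OF ai] \<kappa>C]])
      show ?thesis
        by (rule card_of_Times_ordLeq_infinite_Field[OF inf 1 card_of_Times_ordLeq_infinite_Field[OF inf 2 3 C] C])
    qed
    finally show ?thesis .
  qed
  note K_bound = type_equiv_bound[OF sent N(1,3) rel[unfolded K_def] func[unfolded K_def] \<kappa> no, folded K_def]
  have upper: "|?U| \<le>o ?\<mu>" by (rule bound[OF teU]) (rule K_bound)
  have lower: "?\<mu> \<le>o |?U|"
    by (rule ordIso_ordLeq_trans[OF ordIso_symmetric[OF pow[OF D\<kappa>]] elems_lower_bound[OF ctx]])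
  have U\<mu>: "|?U| =o ?\<mu>" using upper lower ordIso_iff_ordLeq by blast
  have ne: "?U \<noteq> {}"
  proof -
    obtain x where x: "x \<in> I" using q_surj[OF ctx] by blast
    have "(\<lambda>_. d0) \<in> F K tk d0"
      unfolding F_def[OF ctx] using d0_D[OF ctx] by (simp add: well_ordered_def)
    from U_I[OF ctx s this x d0(1)] show ?thesis by blast
  qed
  let ?L = "scott_lang ?U s" and ?\<psi> = "scott_sentence ?U s"
  show ?thesis
    unfolding completely_characterizable_def
  proof (rule conjI)
    show "Cinfinite ?\<mu>" by (rule \<mu>)
  next
    obtain P :: "nat struct" where P: "is_structure ?L P \<and> is_scott_sentence ?L P ?\<psi>"
      using scott_sentence_exists[OF teU ne] ..
    let ?S = "typed_structure ?U s"
    have S: "is_structure ?L ?S" "|universe ?S| =o ?\<mu>" "models ?S ?\<psi>"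
      using typed_structure_models[OF teU ne teU ne] ne U\<mu>
      by (simp_all add: typed_structure_def[OF teU ne] is_structure_scott_lang[OF teU ne])
    have "has_model_of_card ?L ?\<psi> ?\<mu>"
      by (rule has_model_of_cardI[OF S(1,2) _ S(3) is_sentence_scott_sentence[OF teU ne]]) (use \<mu> in simp)
    moreover have "\<not> has_model_of_card ?L ?\<psi> (cardSuc ?\<mu>)"
    proof
      assume "has_model_of_card ?L ?\<psi> (cardSuc ?\<mu>)"
      then obtain Q :: "(nat set \<Rightarrow> 'a) set struct" where Q: "is_structure ?L Q" "|universe Q| =o cardSuc ?\<mu>" "models Q ?\<psi>"
        unfolding has_model_of_card_def by (elim exE conjE)
      have "universe Q \<noteq> {}" using Q(1) by (simp add: is_structure_def)
      then obtain t where t: "type_equiv ?U s (universe Q) t"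
        by (rule scott_model_typing[OF teU ne _ Q(3)])
      have "|universe Q| \<le>o ?\<mu>" by (rule bound[OF t]) (rule K_bound)
      from ordIso_ordLeq_trans[OF ordIso_symmetric[OF Q(2)] this]
      show False using cardSuc_greater[of ?\<mu>] \<mu> not_ordLess_ordLeq by blast
    qed
    ultimately show "\<exists>L (M :: nat struct) \<phi>. is_structure L M \<and> is_scott_sentence L M \<phi> \<and>
        has_model_of_card L \<phi> ?\<mu> \<and> \<not> has_model_of_card L \<phi> (cardSuc ?\<mu>)"
      using P by blast
  qed
qed

end
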